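(* Let $K$ be an algebraically closed field of characteristic different from $3$. For each integer $m\ge 19$ let $\mathcal{S}_m=\operatorname{Spec} K[[X,Y,Z]]/(F_m)$ be the embedded algebroid surface of multiplicity $3$ defined by $$F_m = Z^3 + X^m Z + (X-Y)^4 .$$ Then: (i) for every $m\ge 19$, Hironaka's characteristic polygon is $$\Delta(\mathcal{S}_m,\{X,Y\})=\Delta_{\{X,Y,Z\}}(F_m)=\mathrm{CH}\left(\left[\left(\tfrac43,0\right)+\mathbb{N}^2\right]\cup\left[\left(0,\tfrac43\right)+\mathbb{N}^2\right]\right),$$ so all the surfaces $\mathcal{S}_m$ have the same characteristic polygon; (ii) for every $N\in\mathbb{N}$ there exist an integer $m\ge 19$ and a Levi--Zariski sequence of $N$ blowing-ups starting at $\mathcal{S}_m$ all of whose members have multiplicity $3$. Consequently, the number of blowing-ups that can be performed following the Levi--Zariski procedure on an embedded algebroid surface before its multiplicity drops cannot be bounded by a function of its Hironaka characteristic polygon.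
   Context: An embedded algebroid surface over an algebraically closed field $K$ is a scheme $\mathcal{S}=\operatorname{Spec} R$, with $R=K[[X,Y,Z]]/(F)$, where $F$ is a power series of order $n>0$; $F$ is called an equation of $\mathcal{S}$, and $n$ is called the multiplicity of $\mathcal{S}$. **Polygon.** Suppose the equation is in Weierstrass form $F=Z^n+\sum_{k=0}^{n-1}a_k(X,Y)Z^k$ with $a_k(X,Y)=\sum_{i,j}a_{ijk}X^iY^j$. The Hironaka polygon of $F$ is $$\Delta_{\{X,Y,Z\}}(F)=\mathrm{CH}\left(\bigcup_{0\le k<n,\ a_{ijk}\neq 0}\left[\left(\tfrac{i}{n-k},\tfrac{j}{n-k}\right)+\mathbb{N}^2\right]\right),$$ where $\mathrm{CH}$ denotes the convex hull in $\mathbb{R}^2$ and $\mathbb{N}$ contains $0$. Among the polygons obtained from the equations resulting from changes of variable $Z\mapsto Z+\alpha(X,Y)$, with $\alpha\in K[[X,Y]]$ not a unit, there is a minimal one with respect to inclusion (a theorem of Hironaka). This minimal polygon is the characteristic polygon of the pair $(\mathcal{S},\{X,Y\})$, denoted $\Delta(\mathcal{S},\{X,Y\})$. **Levi--Zariski procedure.** A permitted curve of $\mathcal{S}=\operatorname{Spec} R$ is a smooth equimultiple curve, that is, a curve given by a prime ideal $P$ of $R$ such that $R/P$ is regular of dimension $1$ and the multiplicity of the local ring $R_P$ equals the multiplicity of $\mathcal{S}$. A maximal center of $\mathcal{S}$ is a permitted curve if one exists, and the closed point of $\mathcal{S}$ if there are no permitted curves. A Levi--Zariski sequence of $N$ blowing-ups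 starting at $\mathcal{S}$ is a sequence of embedded algebroid surfaces $\mathcal{S}=\mathcal{S}^{(0)},\mathcal{S}^{(1)},\dots,\mathcal{S}^{(N)}$ such that, for each $0\le i<N$, $\mathcal{S}^{(i+1)}$ is the spectrum of the completed local ring, at a closed point lying over the closed point of $\mathcal{S}^{(i)}$, of the blowing-up of $\mathcal{S}^{(i)}$ along a maximal center. The blowing-up of a closed point is called a quadratic transformation, and the blowing-up of a permitted curve a monoidal transformation. *)

theory Defs
  imports
    "HOL-Analysis.Analysis"
    "HOL-Algebra.Algebra"
    "HOL-Algebra.Algebraic_Closure_Type"
    "HOL-Computational_Algebra.Computational_Algebra"
    "HOL-Library.Extended_Nat"
begin

section \<open>Power series in three variables\<close>

text \<open>
  \<open>K[[X,Y,Z]]\<close> is \<open>((K[[X]])[[Y]])[[Z]]\<close>: the outermost variable is \<open>Z\<close>, so that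
  \<open>fps_nth F k\<close> is the coefficient \<open>a_k(X,Y)\<close> of \<open>Z^k\<close>, an element of \<open>(K[[X]])[[Y]]\<close>.
\<close>

type_synonym 'a ps3 = "'a fps fps fps"

definition ps_coeff :: "'a::zero ps3 \<Rightarrow> nat \<Rightarrow> nat \<Rightarrow> nat \<Rightarrow> 'a"
  where "ps_coeff F i j k = fps_nth (fps_nth (fps_nth F k) j) i"

definition ps_const :: "'a::zero \<Rightarrow> 'a ps3"
  where "ps_const c = fps_const (fps_const (fps_const c))"

definition ps_X :: "'a::comm_ring_1 ps3" where "ps_X = fps_const (fps_const fps_X)"
definition ps_Y :: "'a::comm_ring_1 ps3" where "ps_Y = fps_const fps_X"
definition ps_Z :: "'a::comm_ring_1 ps3" where "ps_Z = fps_X"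

definition ps_order :: "'a::zero ps3 \<Rightarrow> nat"
  where "ps_order F = (LEAST n. \<exists>i j k. i + j + k = n \<and> ps_coeff F i j k \<noteq> 0)"


section \<open>Hironaka polygons\<close>

definition weierstrass_form :: "'a::comm_ring_1 ps3 \<Rightarrow> bool"
  where "weierstrass_form F \<longleftrightarrow>
    fps_nth F (ps_order F) = 1 \<and> (\<forall>k>ps_order F. fps_nth F k = 0)"

definition quadrant_at :: "real \<times> real \<Rightarrow> (real \<times> real) set"
  where "quadrant_at p = {p + (real a, real b) | a b. True}"

definition hironaka_polygon :: "'a::comm_ring_1 ps3 \<Rightarrow> (real \<times> real) set"
  where "hironaka_polygon F = convex hull
    (\<Union>{quadrant_at (real i / real (ps_order F - k), real j / real (ps_order F - k)) | i j k.
          k < ps_order F \<and> ps_coeff F i j k \<noteq> 0})"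

text \<open>
  The substitution \<open>Z \<mapsto> Z + \<alpha>(X,Y)\<close>, for \<open>F\<close> in Weierstrass form, i.e. a polynomial in \<open>Z\<close> of
  degree \<open>ps_order F\<close>.
\<close>

definition shift_Z :: "'a::comm_ring_1 fps fps \<Rightarrow> 'a ps3 \<Rightarrow> 'a ps3"
  where "shift_Z \<alpha> F = (\<Sum>k\<le>ps_order F. fps_const (fps_nth F k) * (ps_Z + fps_const \<alpha>) ^ k)"

text \<open>
  The smallest polygon, with respect to inclusion, among those of the equations obtained from the
  Weierstrass equation \<open>F\<close>; it exists by a theorem of Hironaka.
\<close>

definition characteristic_polygon :: "'a::comm_ring_1 ps3 \<Rightarrow> (real \<times> real) set"
  where "characteristic_polygon F =
    (LEAST D. \<exists>\<alpha>. \<not> \<alpha> dvd 1 \<and> D = hironaka_polygon (shift_Z \<alpha> F))"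


section \<open>Commutative algebra\<close>

definition local_ring :: "('r, 'm) ring_scheme \<Rightarrow> bool"
  where "local_ring A \<longleftrightarrow> cring A \<and> (\<exists>!M. maximalideal M A)"

definition max_ideal :: "('r, 'm) ring_scheme \<Rightarrow> 'r set"
  where "max_ideal A = (THE M. maximalideal M A)"

primrec ideal_pow :: "('r, 'm) ring_scheme \<Rightarrow> 'r set \<Rightarrow> nat \<Rightarrow> 'r set" where
  "ideal_pow A I 0 = carrier A"
| "ideal_pow A I (Suc n) = I \<cdot>\<^bsub>A\<^esub> ideal_pow A I n"

definition krull_dim :: "('r, 'm) ring_scheme \<Rightarrow> enat"
  where "krull_dim A = Sup {enat n | n. \<exists>C :: nat \<Rightarrow> 'r set.
    (\<forall>i\<le>n. primeideal (C i) A) \<and> (\<forall>i<n. C i \<subset> C (Suc i))}"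

definition regular_local_ring :: "('r, 'm) ring_scheme \<Rightarrow> bool"
  where "regular_local_ring A \<longleftrightarrow> local_ring A \<and> noetherian_ring A \<and>
    (\<exists>S. finite S \<and> S \<subseteq> carrier A \<and> max_ideal A = Idl\<^bsub>A\<^esub> S \<and> enat (card S) = krull_dim A)"

text \<open>
  The length of the \<open>A\<close>-module \<open>A/J\<close>; its submodules correspond to the ideals containing \<open>J\<close>.
\<close>

definition quot_length :: "('r, 'm) ring_scheme \<Rightarrow> 'r set \<Rightarrow> enat"
  where "quot_length A J = Sup {enat n | n. \<exists>C :: nat \<Rightarrow> 'r set.
    (\<forall>i\<le>n. ideal (C i) A \<and> J \<subseteq> C i) \<and> (\<forall>i<n. C i \<subset> C (Suc i))}"

text \<open>
  The multiplicity of a Noetherian local ring: \<open>d!\<close> times the leading coefficient of its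
  Hilbert-Samuel polynomial, where \<open>d\<close> is the degree of that polynomial.
\<close>

definition has_multiplicity :: "('r, 'm) ring_scheme \<Rightarrow> nat \<Rightarrow> bool"
  where "has_multiplicity A e \<longleftrightarrow> (\<exists>p :: real Polynomial.poly.
    (\<forall>\<^sub>F k in sequentially. \<exists>l. quot_length A (ideal_pow A (max_ideal A) k) = enat l \<and>
        real l = poly p (real k)) \<and>
    real e = fact (Polynomial.degree p) * Polynomial.lead_coeff p)"

text \<open>
  Rings of fractions: \<open>T\<close> is the set of admissible pairs (numerator, denominator), and
  \<open>a/s = b/t\<close> iff \<open>u(at - bs) = 0\<close> for some admissible denominator \<open>u\<close>.
\<close>

definition frac_rel :: "('r, 'm) ring_scheme \<Rightarrow> ('r \<times> 'r) set \<Rightarrow> (('r \<times> 'r) \<times> ('r \<times> 'r)) set"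
  where "frac_rel R T = {((a, s), (b, t)). (a, s) \<in> T \<and> (b, t) \<in> T \<and>
    (\<exists>u\<in>snd ` T. u \<otimes>\<^bsub>R\<^esub> (a \<otimes>\<^bsub>R\<^esub> t \<ominus>\<^bsub>R\<^esub> b \<otimes>\<^bsub>R\<^esub> s) = \<zero>\<^bsub>R\<^esub>)}"

definition frac_ring :: "('r, 'm) ring_scheme \<Rightarrow> ('r \<times> 'r) set \<Rightarrow> ('r \<times> 'r) set ring"
  where "frac_ring R T = \<lparr>
    carrier = T // frac_rel R T,
    monoid.mult = (\<lambda>A B. \<Union>(a, s)\<in>A. \<Union>(b, t)\<in>B. frac_rel R T `` {(a \<otimes>\<^bsub>R\<^esub> b, s \<otimes>\<^bsub>R\<^esub> t)}),
    monoid.one = frac_rel R T `` {(\<one>\<^bsub>R\<^esub>, \<one>\<^bsub>R\<^esub>)},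
    ring.zero = frac_rel R T `` {(\<zero>\<^bsub>R\<^esub>, \<one>\<^bsub>R\<^esub>)},
    ring.add = (\<lambda>A B. \<Union>(a, s)\<in>A. \<Union>(b, t)\<in>B.
      frac_rel R T `` {(a \<otimes>\<^bsub>R\<^esub> t \<oplus>\<^bsub>R\<^esub> b \<otimes>\<^bsub>R\<^esub> s, s \<otimes>\<^bsub>R\<^esub> t)})\<rparr>"

definition frac_map :: "('r, 'm) ring_scheme \<Rightarrow> ('r \<times> 'r) set \<Rightarrow> 'r \<Rightarrow> ('r \<times> 'r) set"
  where "frac_map R T a = frac_rel R T `` {(a, \<one>\<^bsub>R\<^esub>)}"

definition localization :: "('r, 'm) ring_scheme \<Rightarrow> 'r set \<Rightarrow> ('r \<times> 'r) set ring"
  where "localization R P = frac_ring R (carrier R \<times> (carrier R - P))"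

text \<open>The completion of \<open>A\<close> along \<open>I\<close>, as the inverse limit of the rings \<open>A/I^k\<close>: a coset of
  \<open>I^(k+1)\<close> is sent to the coset of \<open>I^k\<close> that contains it.\<close>

definition completion :: "('r, 'm) ring_scheme \<Rightarrow> 'r set \<Rightarrow> (nat \<Rightarrow> 'r set) ring"
  where "completion A I = \<lparr>
    carrier = {x. (\<forall>k. x k \<in> carrier (A Quot ideal_pow A I k)) \<and> (\<forall>k. x (Suc k) \<subseteq> x k)},
    monoid.mult = (\<lambda>x y k. x k \<otimes>\<^bsub>A Quot ideal_pow A I k\<^esub> y k),
    monoid.one = (\<lambda>k. \<one>\<^bsub>A Quot ideal_pow A I k\<^esub>),
    ring.zero = (\<lambda>k. \<zero>\<^bsub>A Quot ideal_pow A I k\<^esub>),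
    ring.add = (\<lambda>x y k. x k \<oplus>\<^bsub>A Quot ideal_pow A I k\<^esub> y k)\<rparr>"

definition completion_map :: "('r, 'm) ring_scheme \<Rightarrow> 'r set \<Rightarrow> 'r \<Rightarrow> (nat \<Rightarrow> 'r set)"
  where "completion_map A I a = (\<lambda>k. ideal_pow A I k +>\<^bsub>A\<^esub> a)"


section \<open>Blowing-up an affine scheme\<close>

text \<open>
  The blowing-up of \<open>Spec R\<close> along \<open>I\<close> is \<open>Proj\<close> of the Rees algebra, the direct sum of the
  \<open>I^d\<close>.  A point is a homogeneous prime ideal that does not contain the irrelevant ideal; it is
  given by the family \<open>Q\<close> of its homogeneous components \<open>Q d \<subseteq> I^d\<close>.  Its image in
  \<open>Spec R\<close> is \<open>Q 0\<close>.
\<close>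

definition blowup_point :: "('r, 'm) ring_scheme \<Rightarrow> 'r set \<Rightarrow> (nat \<Rightarrow> 'r set) \<Rightarrow> bool"
  where "blowup_point R I Q \<longleftrightarrow>
    (\<forall>d. additive_subgroup (Q d) R \<and> Q d \<subseteq> ideal_pow R I d) \<and>
    (\<forall>d e. \<forall>a\<in>ideal_pow R I d. \<forall>b\<in>Q e. a \<otimes>\<^bsub>R\<^esub> b \<in> Q (d + e)) \<and>
    (\<forall>d e. \<forall>a\<in>ideal_pow R I d. \<forall>b\<in>ideal_pow R I e.
        a \<otimes>\<^bsub>R\<^esub> b \<in> Q (d + e) \<longrightarrow> a \<in> Q d \<or> b \<in> Q e) \<and>
    (\<exists>d>0. Q d \<noteq> ideal_pow R I d)"

definition blowup_closed_point :: "('r, 'm) ring_scheme \<Rightarrow> 'r set \<Rightarrow> (nat \<Rightarrow> 'r set) \<Rightarrow> bool"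
  where "blowup_closed_point R I Q \<longleftrightarrow> blowup_point R I Q \<and>
    (\<forall>Q'. blowup_point R I Q' \<and> (\<forall>d. Q d \<subseteq> Q' d) \<longrightarrow> Q' = Q)"

text \<open>
  The local ring at \<open>Q\<close> consists of the fractions \<open>a/s\<close> with \<open>a\<close>, \<open>s\<close> homogeneous of the same
  degree \<open>d\<close> and \<open>s\<close> not in the prime.  The degree need not be recorded: whether two such
  fractions are equal depends only on the underlying elements of \<open>R\<close>.
\<close>

definition blowup_fractions :: "('r, 'm) ring_scheme \<Rightarrow> 'r set \<Rightarrow> (nat \<Rightarrow> 'r set) \<Rightarrow> ('r \<times> 'r) set"
  where "blowup_fractions R I Q = (\<Union>d. ideal_pow R I d \<times> (ideal_pow R I d - Q d))"

definition blowup_stalk :: "('r, 'm) ring_scheme \<Rightarrow> 'r set \<Rightarrow> (nat \<Rightarrow> 'r set) \<Rightarrow> ('r \<times> 'r) set ring"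
  where "blowup_stalk R I Q = frac_ring R (blowup_fractions R I Q)"


section \<open>Embedded algebroid surfaces and the Levi--Zariski procedure\<close>

text \<open>
  A surface is represented by an equation \<open>F\<close>; its multiplicity is \<open>ps_order F\<close>.
\<close>

definition algebroid_surface :: "'a::field ps3 \<Rightarrow> bool"
  where "algebroid_surface F \<longleftrightarrow> F \<noteq> 0 \<and> ps_order F > 0"

definition surface_ideal :: "'a::field ps3 \<Rightarrow> 'a ps3 set"
  where "surface_ideal F = Idl\<^bsub>ring_of_type_algebra\<^esub> {F}"

definition surface_ring :: "'a::field ps3 \<Rightarrow> 'a ps3 set ring"
  where "surface_ring F = ring_of_type_algebra Quot surface_ideal F"

definition surface_const :: "'a::field ps3 \<Rightarrow> 'a \<Rightarrow> 'a ps3 set"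
  where "surface_const F c = surface_ideal F +>\<^bsub>ring_of_type_algebra\<^esub> ps_const c"

definition permitted_curve :: "'a::field ps3 \<Rightarrow> 'a ps3 set set \<Rightarrow> bool"
  where "permitted_curve F P \<longleftrightarrow>
    primeideal P (surface_ring F) \<and>
    regular_local_ring (surface_ring F Quot P) \<and>
    krull_dim (surface_ring F Quot P) = 1 \<and>
    has_multiplicity (localization (surface_ring F) P) (ps_order F)"

definition maximal_center :: "'a::field ps3 \<Rightarrow> 'a ps3 set set \<Rightarrow> bool"
  where "maximal_center F P \<longleftrightarrow>
    (if \<exists>C. permitted_curve F C then permitted_curve F P else P = max_ideal (surface_ring F))"

text \<open>
  \<open>K[[X,Y,Z]]/(G)\<close> is isomorphic, as a \<open>K\<close>-algebra, to the completed local ring at a closed point,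
  over the closed point of \<open>Spec K[[X,Y,Z]]/(F)\<close>, of the blowing-up along a maximal center.
\<close>

definition levi_zariski_step :: "'a::field ps3 \<Rightarrow> 'a ps3 \<Rightarrow> bool"
  where "levi_zariski_step F G \<longleftrightarrow> (\<exists>P Q.
    maximal_center F P \<and>
    blowup_closed_point (surface_ring F) P Q \<and>
    Q 0 = max_ideal (surface_ring F) \<and>
    (let T = blowup_fractions (surface_ring F) P Q;
         A = blowup_stalk (surface_ring F) P Q
     in \<exists>h \<in> ring_iso (surface_ring G) (completion A (max_ideal A)).
          \<forall>c. h (surface_const G c) =
            completion_map A (max_ideal A) (frac_map (surface_ring F) T (surface_const F c))))"

text \<open>Only the members \<open>S 0, \<dots>, S N\<close> of \<open>S\<close> matter.\<close>

definition levi_zariski_sequence :: "(nat \<Rightarrow> 'a::field ps3) \<Rightarrow> nat \<Rightarrow> bool"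
  where "levi_zariski_sequence S N \<longleftrightarrow>
    (\<forall>i\<le>N. algebroid_surface (S i)) \<and> (\<forall>i<N. levi_zariski_step (S i) (S (Suc i)))"

definition F_eq :: "nat \<Rightarrow> 'a::field ps3"
  where "F_eq m = ps_Z ^ 3 + ps_X ^ m * ps_Z + (ps_X - ps_Y) ^ 4"

end

theory Submission
  imports Defs
begin

text \<open>
  Put \<open>W = X - Y\<close>.  The substitution \<open>X \<mapsto> X\<close>, \<open>W \<mapsto> X^e W\<close>, \<open>Z \<mapsto> X Z\<close> carries
  \<open>Z^3 + X^m Z + X^r W^4\<close> to \<open>X^3\<close> times \<open>Z^3 + X^(m-2) Z + X^(r+4e-3) W^4\<close>.  With \<open>e = 1\<close> (closed
  point) three times and then \<open>e = 0\<close> (curve \<open>X = Z = 0\<close>), the exponent \<open>r\<close> runs through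
  \<open>0, 1, 2, 3, 0, \<dots>\<close> while \<open>m\<close> drops by two at each step, so the multiplicity stays \<open>3\<close> for about
  \<open>m / 2\<close> blowing-ups, whereas the polygon does not depend on \<open>m\<close>.

  The centers are maximal.  For \<open>r \<le> 2\<close> no smooth curve is equimultiple: its prime has generators
  \<open>u, v\<close> such that, after localization, the equation expresses \<open>u^2\<close> through \<open>v\<close>, hence the
  Hilbert function grows by at most two per step.  For \<open>r = 3\<close> the \<open>k\<close>-th power of the maximal ideal
  at \<open>X = Z = 0\<close> has colength \<open>3 k - 3\<close>.

  That the completed local ring of the blowing-up is the ring of the transformed equation is seen by
  comparing both rings modulo the powers of their maximal ideals; the substitution maps the
  numerators onto a dense set of power series.
\<close>

section \<open>Weighted orders on power series\<close>

text \<open>The exponent four closes the cycle: a quadratic step changes \<open>r\<close> by 4 - 3 =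
  1, the monoidal step by -3. Only the initial equation is written in X - Y; it is the image of
  \<open>cubic m 0\<close> under the involution \<open>reflect\<close>, along which chart and center
  are transported. The obstacle is that Hilbert-Samuel polynomials, homogeneous primes and inverse
  limits are abstract, whereas only power series can be computed with. Ideals are therefore replaced
  by their preimages in K[[X,Y,Z]], and residue classes by remainders of Weierstrass division. The
  pivot is \<open>nf_order\<close>: a remainder has the largest weighted order in its class, for the
  weights of both kinds of center. Division asks for \<open>m >= 3\<close>; it is used before and
  after a step, hence \<open>m >= 5\<close> in the charts. Characteristic three is excluded because
  the expansion of the equation at Z = \<alpha> has 3 \<alpha> + u as coefficient of u^2, which must
  be a unit at the curve when \<alpha> is nonzero. The polygon is minimal because on each axis a
  shift with a linear term produces a point at distance 1, and a shift without one leaves the point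
  at distance 4/3.\<close>

lemma ps_eqI:
  assumes "\<And>i j l. ps_coeff f i j l = ps_coeff g i j l"
  shows "f = g"
  using assms unfolding ps_coeff_def by (intro fps_ext) auto

lemma ps_coeff_simps [simp]:
  fixes f g :: "'a::comm_ring_1 ps3"
  shows "ps_coeff (f + g) i j l = ps_coeff f i j l + ps_coeff g i j l"
    and "ps_coeff (f - g) i j l = ps_coeff f i j l - ps_coeff g i j l"
    and "ps_coeff (- f) i j l = - ps_coeff f i j l"
    and "ps_coeff 0 i j l = (0::'a)"
  by (auto simp: ps_coeff_def)

lemma ps_coeff_1: "ps_coeff 1 i j l = (if i = 0 \<and> j = 0 \<and> l = 0 then 1 else (0::'a::comm_ring_1))"
  by (auto simp: ps_coeff_def)

lemma ps_coeff_const: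
  "ps_coeff (ps_const c) i j l = (if i = 0 \<and> j = 0 \<and> l = 0 then c else (0::'a::comm_ring_1))"
  by (auto simp: ps_coeff_def ps_const_def)

lemma ps_coeff_mult:
  fixes f g :: "'a::comm_ring_1 ps3"
  shows "ps_coeff (f * g) i j l = (\<Sum>l'\<le>l. \<Sum>j'\<le>j. \<Sum>i'\<le>i.
            ps_coeff f i' j' l' * ps_coeff g (i - i') (j - j') (l - l'))"
  by (simp add: ps_coeff_def fps_mult_nth fps_sum_nth atLeast0AtMost)

lemma ps_coeff_sum [simp]:
  fixes f :: "'b \<Rightarrow> 'a::comm_ring_1 ps3"
  shows "ps_coeff (sum f A) i j l = (\<Sum>x\<in>A. ps_coeff (f x) i j l)"
  by (simp add: ps_coeff_def fps_sum_nth)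

lemma ps_coeff_const_mult [simp]:
  fixes f :: "'a::comm_ring_1 ps3"
  shows "ps_coeff (ps_const c * f) i j l = c * ps_coeff f i j l"
  by (simp add: ps_coeff_def ps_const_def)

lemma ps_coeff_X_power_mult [simp]:
  fixes f :: "'a::comm_ring_1 ps3"
  shows "ps_coeff (ps_X ^ n * f) i j l = (if i < n then 0 else ps_coeff f (i - n) j l)"
  by (simp add: ps_coeff_def ps_X_def fps_const_power fps_X_power_mult_nth)

lemma ps_coeff_Y_power_mult [simp]:
  fixes f :: "'a::comm_ring_1 ps3"
  shows "ps_coeff (ps_Y ^ n * f) i j l = (if j < n then 0 else ps_coeff f i (j - n) l)"
  by (simp add: ps_coeff_def ps_Y_def fps_const_power fps_X_power_mult_nth)

lemma ps_coeff_Z_power_mult [simp]: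
  fixes f :: "'a::comm_ring_1 ps3"
  shows "ps_coeff (ps_Z ^ n * f) i j l = (if l < n then 0 else ps_coeff f i j (l - n))"
  by (simp add: ps_coeff_def ps_Z_def fps_X_power_mult_nth)

lemma ps_coeff_XYZ_mult [simp]:
  fixes f :: "'a::comm_ring_1 ps3"
  shows "ps_coeff (ps_X * f) i j l = (if i = 0 then 0 else ps_coeff f (i - 1) j l)"
    and "ps_coeff (ps_Y * f) i j l = (if j = 0 then 0 else ps_coeff f i (j - 1) l)"
    and "ps_coeff (ps_Z * f) i j l = (if l = 0 then 0 else ps_coeff f i j (l - 1))"
  using ps_coeff_X_power_mult[of 1 f i j l] ps_coeff_Y_power_mult[of 1 f i j l]
    ps_coeff_Z_power_mult[of 1 f i j l] by (simp_all del: ps_coeff_X_power_mult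
      ps_coeff_Y_power_mult ps_coeff_Z_power_mult)

text \<open>One family of filtrations serves all purposes: the weights \<open>1 1 1\<close> give the
  powers of the maximal ideal, \<open>1 0 1\<close> those of the ideal of the curve X = Z = 0,
  \<open>1 e 1\<close> those of the current center, and \<open>1 (1 + e) 2\<close> the order that a
  series acquires under \<open>blow e\<close>.\<close>

definition wt :: "nat \<Rightarrow> nat \<Rightarrow> nat \<Rightarrow> nat \<Rightarrow> 'a::comm_ring_1 ps3 set"
  where "wt p q r k = {f. \<forall>i j l. p * i + q * j + r * l < k \<longrightarrow> ps_coeff f i j l = 0}"

lemma wtI: "(\<And>i j l. p * i + q * j + r * l < k \<Longrightarrow> ps_coeff f i j l = 0) \<Longrightarrow> f \<in> wt p q r k"
  by (auto simp: wt_def)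

lemma wtD: "f \<in> wt p q r k \<Longrightarrow> p * i + q * j + r * l < k \<Longrightarrow> ps_coeff f i j l = 0"
  by (auto simp: wt_def)

lemma wt_0 [simp]: "wt p q r 0 = UNIV"
  by (auto simp: wt_def)

lemma wt_antimono: "k \<le> k' \<Longrightarrow> f \<in> wt p q r k' \<Longrightarrow> f \<in> wt p q r k"
  by (auto simp: wt_def)

lemma wt_zero [simp, intro]: "0 \<in> wt p q r k"
  by (auto simp: wt_def)

lemma wt_add: "f \<in> wt p q r k \<Longrightarrow> g \<in> wt p q r k \<Longrightarrow> f + g \<in> wt p q r k"
  and wt_diff: "f \<in> wt p q r k \<Longrightarrow> g \<in> wt p q r k \<Longrightarrow> f - g \<in> wt p q r k"
  and wt_minus: "f \<in> wt p q r k \<Longrightarrow> - f \<in> wt p q r k"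
  by (auto simp: wt_def)

lemma wt_mult:
  assumes "f \<in> wt p q r a" "g \<in> wt p q r b"
  shows "f * g \<in> wt p q r (a + b)"
proof (rule wtI)
  fix i j l assume *: "p * i + q * j + r * l < a + b"
  have "ps_coeff f i' j' l' * ps_coeff g (i - i') (j - j') (l - l') = 0"
    if "l' \<le> l" "j' \<le> j" "i' \<le> i" for i' j' l'
  proof (cases "p * i' + q * j' + r * l' < a")
    case True
    then show ?thesis using wtD[OF assms(1)] by simp
  next
    case False
    have "p * i = p * i' + p * (i - i')" "q * j = q * j' + q * (j - j')"
      "r * l = r * l' + r * (l - l')"
      using that by (simp_all flip: distrib_left)
    with * False have "p * (i - i') + q * (j - j') + r * (l - l') < b" by linarith
    then show ?thesis using wtD[OF assms(2)] by simp
  qed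
  then show "ps_coeff (f * g) i j l = 0"
    unfolding ps_coeff_mult by (intro sum.neutral ballI) auto
qed

lemma wt_mult_left: "f \<in> wt p q r k \<Longrightarrow> g * f \<in> wt p q r k"
  using wt_mult[of g p q r 0 f k] by simp

lemma wt_mult_right: "f \<in> wt p q r k \<Longrightarrow> f * g \<in> wt p q r k"
  using wt_mult_left[of f p q r k g] by (simp add: mult.commute)

lemma wt_power: "f \<in> wt p q r a \<Longrightarrow> f ^ n \<in> wt p q r (n * a)"
  by (induction n) (auto intro: wt_mult)

lemma X_power_in_wt: "(ps_X ^ n :: 'a::comm_ring_1 ps3) \<in> wt p q r (n * p)"
  and Y_power_in_wt: "(ps_Y ^ n :: 'a ps3) \<in> wt p q r (n * q)"
  and Z_power_in_wt: "(ps_Z ^ n :: 'a ps3) \<in> wt p q r (n * r)"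
proof -
  have "(ps_X::'a ps3) \<in> wt p q r p" "(ps_Y::'a ps3) \<in> wt p q r q" "(ps_Z::'a ps3) \<in> wt p q r r"
    using ps_coeff_XYZ_mult[of "1::'a ps3"] by (auto intro!: wtI simp: ps_coeff_1)
  from this[THEN wt_power, of n]
  show "(ps_X ^ n :: 'a ps3) \<in> wt p q r (n * p)" "(ps_Y ^ n :: 'a ps3) \<in> wt p q r (n * q)"
    "(ps_Z ^ n :: 'a ps3) \<in> wt p q r (n * r)" by auto
qed

lemma wt_all_eq_0:
  assumes "\<And>k. f \<in> wt 1 e 1 k" shows "f = 0"
proof (rule ps_eqI)
  fix i j l
  show "ps_coeff f i j l = ps_coeff 0 i j l"
    using wtD[OF assms[of "Suc (i + e * j + l)"], of i j l] by simp
qed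

text \<open>A coefficient of total degree n sees only the first n + 1 terms, so the infinite sum can
  be formed coefficientwise.\<close>

lemma ps_complete:
  fixes h :: "nat \<Rightarrow> 'a::comm_ring_1 ps3"
  assumes "\<And>n. h n \<in> wt 1 1 1 n"
  shows "\<exists>s. \<forall>k. s - (\<Sum>n<k. h n) \<in> wt 1 1 1 k"
proof -
  define s where "s = Abs_fps (\<lambda>l. Abs_fps (\<lambda>j. Abs_fps (\<lambda>i. \<Sum>n<Suc (i+j+l). ps_coeff (h n) i j l)))"
  have s: "ps_coeff s i j l = (\<Sum>n<Suc (i+j+l). ps_coeff (h n) i j l)" for i j l
    by (simp add: s_def ps_coeff_def)
  have "s - (\<Sum>n<k. h n) \<in> wt 1 1 1 k" for k
  proof (rule wtI)
    fix i j l assume lt: "1 * i + 1 * j + 1 * l < k"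
    have "(\<Sum>n<k. ps_coeff (h n) i j l) = (\<Sum>n<Suc (i+j+l). ps_coeff (h n) i j l)"
      using lt by (intro sum.mono_neutral_right) (auto intro!: wtD[OF assms])
    then show "ps_coeff (s - (\<Sum>n<k. h n)) i j l = 0" by (simp add: s)
  qed
  then show ?thesis by blast
qed

text \<open>The solution is the Neumann series: \<open>h n\<close> is the image of \<open>g\<close>
  under the n-th iterate of \<open>- T\<close>. The partial sums telescope, and the contraction
  property controls \<open>T\<close> on the tail.\<close>

lemma ps_contraction:
  fixes T :: "'a::comm_ring_1 ps3 \<Rightarrow> 'a ps3"
  assumes add: "\<And>f g. T (f + g) = T f + T g"
    and contr: "\<And>f k. f \<in> wt 1 1 1 k \<Longrightarrow> T f \<in> wt 1 1 1 (Suc k)"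
  shows "\<exists>q. q + T q = g"
proof -
  define h where "h n = ((\<lambda>f. - T f) ^^ n) g" for n
  have h_Suc: "h (Suc n) = - T (h n)" for n by (simp add: h_def)
  have "h n \<in> wt 1 1 1 n" for n
  proof (induction n)
    case (Suc n)
    from wt_minus[OF contr[OF Suc]] show ?case by (simp only: h_Suc)
  qed simp
  note h_wt = this
  from ps_complete[OF h_wt] obtain s where s: "\<And>k. s - (\<Sum>n<k. h n) \<in> wt 1 1 1 k" by blast
  have T0: "T 0 = 0" using add[of 0 0] by simp
  have Tdiff: "T (f - f') = T f - T f'" for f f' using add[of "f - f'" f'] by simp
  have tel: "(\<Sum>n<k. h n) + T (\<Sum>n<k. h n) = g - h k" for k
    by (induction k) (simp_all add: T0 add h_Suc algebra_simps, simp add: h_def)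
  have "s + T s - g \<in> wt 1 1 1 k" for k
  proof -
    have "s + T s - g = (s - (\<Sum>n<k. h n)) + T (s - (\<Sum>n<k. h n)) - h k"
      using tel[of k] by (simp add: Tdiff algebra_simps)
    also have "\<dots> \<in> wt 1 1 1 k"
      by (intro wt_diff wt_add s wt_antimono[OF _ contr[OF s]] h_wt) simp
    finally show ?thesis .
  qed
  then show ?thesis using wt_all_eq_0[of "s + T s - g" 1] by auto
qed

text \<open>A nonconstant monomial is assigned to Z if it contains Z, otherwise to Y if it contains
  Y, otherwise to X. The coefficients of the cofactors are recorded because their weighted orders
  are read off later.\<close>

lemma ps_decompose:
  fixes f :: "'a::comm_ring_1 ps3"
  obtains a b c where "f = ps_const (ps_coeff f 0 0 0) + ps_X * a + ps_Y * b + ps_Z * c"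
    "\<And>i j l. ps_coeff a i j l = (if j = 0 \<and> l = 0 then ps_coeff f (Suc i) 0 0 else 0)"
    "\<And>i j l. ps_coeff b i j l = (if l = 0 then ps_coeff f i (Suc j) 0 else 0)"
    "\<And>i j l. ps_coeff c i j l = ps_coeff f i j (Suc l)"
proof -
  define a where "a = Abs_fps (\<lambda>l. Abs_fps (\<lambda>j. Abs_fps (\<lambda>i. if j = 0 \<and> l = 0 then ps_coeff f (Suc i) 0 0 else 0)))"
  define b where "b = Abs_fps (\<lambda>l. Abs_fps (\<lambda>j. Abs_fps (\<lambda>i. if l = 0 then ps_coeff f i (Suc j) 0 else 0)))"
  define c where "c = Abs_fps (\<lambda>l. Abs_fps (\<lambda>j. Abs_fps (\<lambda>i. ps_coeff f i j (Suc l))))"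
  have a: "ps_coeff a i j l = (if j = 0 \<and> l = 0 then ps_coeff f (Suc i) 0 0 else 0)"
    and b: "ps_coeff b i j l = (if l = 0 then ps_coeff f i (Suc j) 0 else 0)"
    and c: "ps_coeff c i j l = ps_coeff f i j (Suc l)" for i j l
    by (simp_all add: a_def b_def c_def ps_coeff_def)
  have "f = ps_const (ps_coeff f 0 0 0) + ps_X * a + ps_Y * b + ps_Z * c"
    by (rule ps_eqI) (auto simp: a b c ps_coeff_const)
  with a b c that show ?thesis by blast
qed

section \<open>Weierstrass division by the cubic\<close>

text \<open>Here \<open>ps_Y\<close> is the W of the overview, not the original second
  coordinate.\<close>

definition cubic :: "nat \<Rightarrow> nat \<Rightarrow> 'a::comm_ring_1 ps3"
  where "cubic m r = ps_Z ^ 3 + ps_X ^ m * ps_Z + ps_X ^ r * ps_Y ^ 4"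

text \<open>The shape of a remainder of Weierstrass division by \<open>cubic\<close>; remainders
  represent the residue classes modulo the equation.\<close>

definition nf :: "'a::comm_ring_1 ps3 \<Rightarrow> bool"
  where "nf f \<longleftrightarrow> (\<forall>l\<ge>3. fps_nth f l = 0)"

lemma nf_iff: "nf f \<longleftrightarrow> (\<forall>i j l. l \<ge> 3 \<longrightarrow> ps_coeff f i j l = 0)"
  by (auto simp: nf_def ps_coeff_def fps_eq_iff)

lemma ps_coeff_cubic_mult:
  "ps_coeff (cubic m r * q) i j l =
    (if l < 3 then 0 else ps_coeff q i j (l - 3)) +
    (if i < m \<or> l = 0 then 0 else ps_coeff q (i - m) j (l - 1)) +
    (if i < r \<or> j < 4 then 0 else ps_coeff q (i - r) (j - 4) l)"
  unfolding cubic_def by (simp add: distrib_right mult.assoc)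

text \<open>For \<open>e = 1\<close> this is order at least three at the origin; for
  \<open>e = 0\<close>, where the second condition reads \<open>r >= 3\<close>, it is order at least
  three along the curve X = Z = 0.\<close>

lemma cubic_in_wt: "m \<ge> 2 \<Longrightarrow> r + 4 * e \<ge> 3 \<Longrightarrow> cubic m r \<in> wt 1 e 1 3"
  unfolding cubic_def
proof (intro wt_add)
  assume m: "m \<ge> 2" and r: "r + 4 * e \<ge> 3"
  show "ps_Z ^ 3 \<in> wt 1 e 1 3" using Z_power_in_wt[of 3 1 e 1] by simp
  show "ps_X ^ m * ps_Z \<in> wt 1 e 1 3"
    using wt_mult[OF X_power_in_wt[of m 1 e 1] Z_power_in_wt[of 1 1 e 1]] m
    by (auto elim: wt_antimono[rotated])
  show "ps_X ^ r * ps_Y ^ 4 \<in> wt 1 e 1 3"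
    using wt_mult[OF X_power_in_wt[of r 1 e 1] Y_power_in_wt[of 4 1 e 1]] r
    by (auto elim: wt_antimono[rotated])
qed

text \<open>Comparing the coefficients of Z^(l+3) turns the division into
  \<open>q + T q = sh 3 f\<close>. The operator \<open>T\<close> is a contraction: its two terms
  raise the order by at least m - 2 and r + 4 - 3.\<close>

lemma weierstrass_division:
  fixes f :: "'a::comm_ring_1 ps3"
  assumes "m \<ge> 3"
  obtains q where "nf (f - cubic m r * q)"
proof -
  define sh where "sh n f = Abs_fps (\<lambda>l. fps_nth f (l + n))" for n and f :: "'a ps3"
  have sh: "ps_coeff (sh n f) i j l = ps_coeff f i j (l + n)" for n f i j l
    by (simp add: sh_def ps_coeff_def)
  define T where "T q = ps_X ^ m * sh 2 q + ps_X ^ r * (ps_Y ^ 4 * sh 3 q)" for q :: "'a ps3"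
  have "\<exists>q. q + T q = sh 3 f"
  proof (rule ps_contraction)
    show "T (f + g) = T f + T g" for f g
      by (rule ps_eqI) (simp add: T_def sh)
    show "T f \<in> wt 1 1 1 (Suc k)" if "f \<in> wt 1 1 1 k" for f k
    proof -
      have "ps_coeff f i j l = 0" if "i + j + l < k" for i j l
        using wtD[OF \<open>f \<in> wt 1 1 1 k\<close>, of i j l] that by simp
      then show ?thesis using assms by (intro wtI) (auto simp: T_def sh)
    qed
  qed
  then obtain q where q: "q + T q = sh 3 f" by blast
  have "nf (f - cubic m r * q)" unfolding nf_iff
  proof (intro allI impI)
    fix i j l :: nat assume "l \<ge> 3"
    then obtain l' where l: "l = l' + 3" using le_Suc_ex by (metis add.commute)
    have "ps_coeff (q + T q) i j l' = ps_coeff f i j l" unfolding q by (simp add: sh l)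
    then show "ps_coeff (f - cubic m r * q) i j l = 0"
      by (simp add: ps_coeff_cubic_mult l T_def sh add.assoc split: if_splits)
  qed
  with that show ?thesis by blast
qed

text \<open>The coefficients of Z^(l+3) in \<open>p\<close> vanish, which expresses each coefficient
  of \<open>q\<close> of low weight through coefficients with smaller \<open>i + e * j\<close> and
  no larger weight. Hence \<open>q\<close> has order at least \<open>k - 3\<close>, and the
  correction \<open>cubic m r * q\<close> has order at least \<open>k\<close>.\<close>

lemma nf_order:
  assumes nf: "nf p" and c: "p - cubic m r * q \<in> wt 1 e 1 k" and m: "m \<ge> 2" and r: "r + 4 * e \<ge> 3"
  shows "p \<in> wt 1 e 1 k"
proof -
  have "ps_coeff q i j l = 0" if "i + e * j + l + 3 < k" for i j l
    using that
  proof (induction "i + e * j" arbitrary: i j l rule: less_induct)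
    case less
    have "ps_coeff p i j (l + 3) = 0" using nf by (simp add: nf_iff)
    moreover have "ps_coeff (p - cubic m r * q) i j (l + 3) = 0"
      using less.prems by (intro wtD[OF c]) simp
    ultimately have "ps_coeff (cubic m r * q) i j (l + 3) = 0" by simp
    moreover have "ps_coeff q (i - m) j (l + 2) = 0" if "i \<ge> m"
      using that m less.prems by (intro less.hyps) auto
    moreover have "ps_coeff q (i - r) (j - 4) (l + 3) = 0" if "i \<ge> r" "j \<ge> 4"
    proof -
      obtain i' j' where ij: "i = i' + r" "j = j' + 4" using \<open>i \<ge> r\<close> \<open>j \<ge> 4\<close>
        by (metis add.commute le_Suc_ex)
      show ?thesis
        using r less.prems by (intro less.hyps) (auto simp: ij algebra_simps)
    qed
    ultimately show "ps_coeff q i j l = 0"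
      unfolding ps_coeff_cubic_mult by (auto split: if_splits)
  qed
  then have "q \<in> wt 1 e 1 (k - 3)" by (intro wtI) auto
  then have "cubic m r * q \<in> wt 1 e 1 (3 + (k - 3))" by (intro wt_mult cubic_in_wt m r)
  then have "cubic m r * q \<in> wt 1 e 1 k" by (auto elim: wt_antimono[rotated])
  from wt_add[OF c this] show ?thesis by simp
qed

lemma nf_dvd_eq_0:
  assumes "nf p" "cubic m r dvd p" "m \<ge> 2"
  shows "p = 0"
proof -
  obtain q where "p = cubic m r * q" using assms(2) by (auto simp: dvd_def)
  then have "p \<in> wt 1 1 1 k" for k
    using assms by (intro nf_order[of p m r q]) auto
  then show ?thesis using wt_all_eq_0[of p 1] by auto
qed

text \<open>Multiplication by a series free of Z turns remainders into remainders, and a remainder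
  divisible by the cubic is zero. So such series are nonzerodivisors modulo the equation.\<close>

lemma cubic_dvd_cancel:
  fixes b f :: "'a::idom ps3"
  assumes b: "b \<noteq> 0" "\<And>l. l > 0 \<Longrightarrow> fps_nth b l = 0" and dvd: "cubic m r dvd b * f" and m: "m \<ge> 3"
  shows "cubic m r dvd f"
proof -
  obtain q where q: "nf (f - cubic m r * q)" using weierstrass_division[OF m] .
  have b': "b = fps_const (fps_nth b 0)" using b(2) by (auto simp: fps_eq_iff)
  have "nf (b * (f - cubic m r * q))" using q by (subst b') (simp add: nf_def)
  moreover have "cubic m r dvd b * (f - cubic m r * q)"
    using dvd by (simp add: right_diff_distrib mult.left_commute)
  ultimately have "b * (f - cubic m r * q) = 0" using nf_dvd_eq_0[of _ m r] m by force
  with b show ?thesis by auto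
qed

lemma cubic_dvd_X_power_cancel:
  fixes f :: "'a::idom ps3"
  assumes "cubic m r dvd ps_X ^ d * f" "m \<ge> 3"
  shows "cubic m r dvd f"
proof (rule cubic_dvd_cancel[OF _ _ assms])
  show "(ps_X ^ d :: 'a ps3) \<noteq> 0" by (simp add: ps_X_def)
  show "fps_nth (ps_X ^ d :: 'a ps3) l = 0" if "l > 0" for l
    using that by (simp add: ps_X_def fps_const_power)
qed

section \<open>Substitutions\<close>

definition rhom :: "('r::comm_ring_1 \<Rightarrow> 's::comm_ring_1) \<Rightarrow> bool"
  where "rhom h \<longleftrightarrow> h 1 = 1 \<and> (\<forall>a b. h (a + b) = h a + h b) \<and> (\<forall>a b. h (a * b) = h a * h b)"

lemma rhomI:
  "h 1 = 1 \<Longrightarrow> (\<And>a b. h (a + b) = h a + h b) \<Longrightarrow> (\<And>a b. h (a * b) = h a * h b) \<Longrightarrow> rhom h"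
  by (simp add: rhom_def)

lemma
  assumes "rhom h"
  shows rhom_1: "h 1 = 1" and rhom_add: "h (a + b) = h a + h b"
    and rhom_mult: "h (a * b) = h a * h b"
  using assms by (simp_all add: rhom_def)

lemma rhom_0: "rhom h \<Longrightarrow> h 0 = 0"
  using rhom_add[of h 0 0] by simp

lemma rhom_minus: "rhom h \<Longrightarrow> h (- a) = - h a"
  using rhom_add[of h a "- a"] by (simp add: rhom_0 add_eq_0_iff)

lemma rhom_diff: "rhom h \<Longrightarrow> h (a - b) = h a - h b"
  using rhom_add[of h a "- b"] by (simp add: rhom_minus)

lemma rhom_power: "rhom h \<Longrightarrow> h (a ^ n) = h a ^ n"
  by (induction n) (simp_all add: rhom_1 rhom_mult)

lemma rhom_sum: "rhom h \<Longrightarrow> h (sum f A) = (\<Sum>x\<in>A. h (f x))"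
  by (induction A rule: infinite_finite_induct) (simp_all add: rhom_0 rhom_add)

lemma rhom_comp: "rhom h \<Longrightarrow> rhom g \<Longrightarrow> rhom (h \<circ> g)"
  by (simp add: rhom_def)

lemma rhom_dvd: "rhom h \<Longrightarrow> a dvd b \<Longrightarrow> h a dvd h b"
  by (auto simp: dvd_def rhom_mult)

lemmas rhom_simps = rhom_0 rhom_1 rhom_add rhom_diff rhom_minus rhom_mult rhom_power

definition fmap :: "('r \<Rightarrow> 's) \<Rightarrow> 'r fps \<Rightarrow> 's fps"
  where "fmap h f = Abs_fps (\<lambda>n. h (fps_nth f n))"

lemma fmap_nth [simp]: "fps_nth (fmap h f) n = h (fps_nth f n)"
  by (simp add: fmap_def)

lemma rhom_fmap: "rhom h \<Longrightarrow> rhom (fmap h)"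
  by (intro rhomI fps_ext) (simp_all add: fps_mult_nth rhom_simps rhom_sum)

lemma fmap_const: "h 0 = 0 \<Longrightarrow> fmap h (fps_const c) = fps_const (h c)"
  by (intro fps_ext) simp

lemma rhom_fps_const: "rhom fps_const"
  by (intro rhomI) simp_all

text \<open>The substitution of \<open>c\<close> times the variable for the variable.\<close>

definition fscale :: "'r::comm_ring_1 \<Rightarrow> 'r fps \<Rightarrow> 'r fps"
  where "fscale c f = Abs_fps (\<lambda>n. c ^ n * fps_nth f n)"

lemma rhom_fscale: "rhom (fscale c)"
proof (intro rhomI fps_ext)
  fix f g :: "'a fps" and n
  have "c ^ n * (fps_nth f i * fps_nth g (n - i)) = c ^ i * fps_nth f i * (c ^ (n - i) * fps_nth g (n - i))"
    if "i \<in> {0..n}" for i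
  proof -
    have "c ^ n = c ^ i * c ^ (n - i)" using that by (simp flip: power_add)
    then show ?thesis by (simp add: ac_simps)
  qed
  then show "fps_nth (fscale c (f * g)) n = fps_nth (fscale c f * fscale c g) n"
    by (simp add: fscale_def fps_mult_nth sum_distrib_left)
qed (simp_all add: fscale_def algebra_simps)

text \<open>The substitution \<open>X \<mapsto> X\<close>, \<open>Y \<mapsto> X^e Y\<close>, \<open>Z \<mapsto> X Z\<close>: the \<open>X\<close>-chart of the blowing-up of the
  closed point (\<open>e = 1\<close>) or of the curve \<open>X = Z = 0\<close> (\<open>e = 0\<close>).\<close>

definition blow :: "nat \<Rightarrow> 'a::comm_ring_1 ps3 \<Rightarrow> 'a ps3"
  where "blow e = fscale (fps_const fps_X) \<circ> fmap (fscale (fps_X ^ e))"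

lemma rhom_blow: "rhom (blow e)"
  unfolding blow_def by (intro rhom_comp rhom_fscale rhom_fmap)

lemma ps_coeff_blow:
  "ps_coeff (blow e f) i j l = (if i < e * j + l then 0 else ps_coeff f (i - (e * j + l)) j l)"
  by (auto simp: blow_def ps_coeff_def fscale_def fps_const_power fps_X_power_mult_nth add.commute[of l]
      simp flip: power_mult)

lemma ps_coeff_blow_shift: "ps_coeff (blow e f) (i + e * j + l) j l = ps_coeff f i j l"
  by (simp add: ps_coeff_blow)

lemma blow_gens:
  "blow e (ps_X :: 'a::comm_ring_1 ps3) = ps_X"
  "blow e (ps_Y :: 'a ps3) = ps_X ^ e * ps_Y"
  "blow e (ps_Z :: 'a ps3) = ps_X * ps_Z"
  "blow e (ps_const c :: 'a ps3) = ps_const c"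
  by (auto intro!: ps_eqI simp: ps_coeff_blow ps_coeff_const
      ps_coeff_XYZ_mult[of "1::'a ps3", simplified] ps_coeff_1 split: if_splits)

lemma blow_eq_0: "blow e f = 0 \<Longrightarrow> f = 0"
proof (rule ps_eqI)
  fix i j l assume "blow e f = 0"
  then show "ps_coeff f i j l = ps_coeff 0 i j l"
    using ps_coeff_blow_shift[of e f i j l] by simp
qed

lemma blow_nf: "nf f \<Longrightarrow> nf (blow e f)"
  by (auto simp: nf_iff ps_coeff_blow)

lemma X_power_nf: "nf (ps_X ^ d * f) \<Longrightarrow> nf f"
  unfolding nf_iff
proof (intro allI impI)
  fix i j l :: nat assume "\<forall>i j l. 3 \<le> l \<longrightarrow> ps_coeff (ps_X ^ d * f) i j l = 0" "3 \<le> l"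
  then have "ps_coeff (ps_X ^ d * f) (i + d) j l = 0" by blast
  then show "ps_coeff f i j l = 0" by simp
qed

text \<open>The three monomials acquire the factors X^3, X^(m+1) and X^(r+4e). The common factor X^3
  is the exceptional part, the cofactor the strict transform.\<close>

lemma blow_cubic:
  assumes "m \<ge> 2" "r + 4 * e \<ge> 3"
  shows "blow e (cubic m r) = ps_X ^ 3 * cubic (m - 2) (r + 4 * e - 3)"
proof -
  obtain m' where m: "m = m' + 2" using assms(1) by (metis add.commute le_Suc_ex)
  obtain r' where r: "r + 4 * e = r' + 3" using assms(2) by (metis add.commute le_Suc_ex)
  have "blow e (cubic m r) = (ps_X * ps_Z) ^ 3 + ps_X ^ m * (ps_X * ps_Z) + ps_X ^ (r + 4 * e) * ps_Y ^ 4"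
    by (simp add: cubic_def rhom_simps[OF rhom_blow] blow_gens power_mult_distrib power_add
        power_mult[symmetric] mult.assoc mult.commute[of e 4])
  also have "\<dots> = ps_X ^ 3 * cubic (m - 2) (r + 4 * e - 3)"
    unfolding r by (simp add: cubic_def m power_mult_distrib power_add distrib_left power2_eq_square
        power3_eq_cube mult.assoc)
  finally show ?thesis .
qed

lemma blow_divisible:
  assumes "f \<in> wt 1 e 1 d"
  obtains h where "blow e f = ps_X ^ d * h"
proof
  let ?h = "Abs_fps (\<lambda>l. Abs_fps (\<lambda>j. Abs_fps (\<lambda>i. ps_coeff (blow e f) (i + d) j l)))"
  have h: "ps_coeff ?h i j l = ps_coeff (blow e f) (i + d) j l" for i j l
    by (simp add: ps_coeff_def)
  show "blow e f = ps_X ^ d * ?h"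
  proof (rule ps_eqI)
    fix i j l
    show "ps_coeff (blow e f) i j l = ps_coeff (ps_X ^ d * ?h) i j l"
    proof (cases "i < d")
      case True
      have "1 * (i - (e*j+l)) + e * j + 1 * l < d" if "e * j + l \<le> i" using True that by simp
      then have "ps_coeff (blow e f) i j l = 0"
        using wtD[OF assms] by (auto simp: ps_coeff_blow)
      then show ?thesis using True by simp
    qed (simp add: h)
  qed
qed

text \<open>The ideal \<open>jet e d k\<close> consists of the numerators \<open>f\<close> for which \<open>f / X^d\<close> belongs to the \<open>k\<close>-th
  power of the ideal generated by \<open>X\<close>, \<open>Y / X^e\<close>, \<open>Z / X\<close>.\<close>

definition jet :: "nat \<Rightarrow> nat \<Rightarrow> nat \<Rightarrow> 'a::comm_ring_1 ps3 set"
  where "jet e d k = wt 1 e 1 d \<inter> wt 1 (1 + e) 2 (d + k)"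

text \<open>After division by X^(d+1) the identity reads f/X^d = X (a/X^d) + (y/X) (b/X^d) + (Z/X)
  (c/X^d), with y = Y or y = X Y. This is the induction step for membership in powers of the maximal
  ideal of the blown-up ring; multiplying by X clears the denominators.\<close>

lemma jet_decompose:
  assumes "f \<in> jet e d (Suc k)" "e \<le> 1"
  obtains a b c where "a \<in> jet e d k" "b \<in> jet e d k" "c \<in> jet e d k"
    "ps_X * f = ps_X * ps_X * a + (if e = 1 then ps_Y else ps_X * ps_Y) * b + ps_Z * c"
proof -
  have f1: "f \<in> wt 1 e 1 d" and f2: "f \<in> wt 1 (1 + e) 2 (Suc (d + k))"
    using assms by (auto simp: jet_def)
  have f00: "ps_coeff f 0 0 0 = 0" by (rule wtD[OF f2]) simp
  obtain a b c where f: "f = ps_const (ps_coeff f 0 0 0) + ps_X * a + ps_Y * b + ps_Z * c"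
    and a: "\<And>i j l. ps_coeff a i j l = (if j = 0 \<and> l = 0 then ps_coeff f (Suc i) 0 0 else 0)"
    and b: "\<And>i j l. ps_coeff b i j l = (if l = 0 then ps_coeff f i (Suc j) 0 else 0)"
    and c: "\<And>i j l. ps_coeff c i j l = ps_coeff f i j (Suc l)"
    using ps_decompose[of f] by blast
  have "ps_const 0 = 0" by (simp add: ps_const_def)
  with f f00 have f': "f = ps_X * a + ps_Y * b + ps_Z * c" by simp
  have a': "a \<in> jet e d k"
    unfolding jet_def by (intro IntI wtI) (auto simp: a intro!: wtD[OF f2])
  \<comment> \<open>Trading one factor Z for X keeps the first weight and lowers the second by
    exactly one.\<close>
  have c': "ps_X * c \<in> jet e d k"
    unfolding jet_def
  proof (intro IntI wtI)
    fix i j l :: nat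
    show "ps_coeff (ps_X * c) i j l = 0" if "1 * i + e * j + 1 * l < d"
      using that by (auto simp: c intro!: wtD[OF f1])
    show "ps_coeff (ps_X * c) i j l = 0" if "1 * i + (1 + e) * j + 2 * l < d + k"
      using that by (auto simp: c intro!: wtD[OF f2])
  qed
  consider "e = 0" | "e = 1" using assms(2) by linarith
  then show thesis
  proof cases
    case 1
    have "b \<in> jet e d k"
      unfolding jet_def
    proof (intro IntI wtI)
      fix i j l :: nat
      show "ps_coeff (b) i j l = 0" if "1 * i + e * j + 1 * l < d"
        using that by (auto simp: b 1 intro!: wtD[OF f1])
      show "ps_coeff (b) i j l = 0" if "1 * i + (1 + e) * j + 2 * l < d + k"
        using that by (auto simp: b 1 intro!: wtD[OF f2])
    qed
    moreover have "ps_X * f = ps_X * ps_X * a + (ps_X * ps_Y) * b + ps_Z * (ps_X * c)"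
      by (subst f') (simp add: algebra_simps)
    ultimately show thesis using that[of a b "ps_X * c"] a' c' 1 by simp
  next
    case 2
    have "ps_X * b \<in> jet e d k"
      unfolding jet_def
    proof (intro IntI wtI)
      fix i j l :: nat
      show "ps_coeff (ps_X * b) i j l = 0" if "1 * i + e * j + 1 * l < d"
        using that by (auto simp: b 2 intro!: wtD[OF f1])
      show "ps_coeff (ps_X * b) i j l = 0" if "1 * i + (1 + e) * j + 2 * l < d + k"
        using that by (auto simp: b 2 intro!: wtD[OF f2])
    qed
    moreover have "ps_X * f = ps_X * ps_X * a + ps_Y * (ps_X * b) + ps_Z * (ps_X * c)"
      by (subst f') (simp add: algebra_simps)
    ultimately show thesis using that[of a "ps_X * b" "ps_X * c"] a' c' 2 by simp
  qed
qed

text \<open>The substitution does not change the degree in Z, so the remainder of \<open>f\<close>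
  becomes a remainder divisible by the strict transform. It is zero, and \<open>blow e\<close> is
  injective.\<close>

lemma blow_cubic_kernel:
  fixes f :: "'a::idom ps3"
  assumes m: "m \<ge> 4" and r: "r + 4 * e \<ge> 3" and dvd: "cubic (m - 2) (r + 4 * e - 3) dvd blow e f"
  shows "cubic m r dvd f"
proof -
  obtain q where q: "nf (f - cubic m r * q)" using weierstrass_division[of m f r] m by auto
  have "cubic (m - 2) (r + 4 * e - 3) dvd blow e (f - cubic m r * q)"
    using dvd m r by (simp add: rhom_simps[OF rhom_blow] blow_cubic mult.left_commute)
  then have "blow e (f - cubic m r * q) = 0"
    using nf_dvd_eq_0[OF blow_nf[OF q]] m by simp
  then have "f - cubic m r * q = 0" by (rule blow_eq_0)
  then show ?thesis by simp
qed

text \<open>The jet is the remainder \<open>p\<close> of \<open>f\<close>. Its transform divided by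
  X^d is again a remainder and is congruent to \<open>h\<close>, so \<open>nf_order\<close> for the
  new equation bounds its order; pulled back monomial by monomial, this is the second weight
  condition on \<open>p\<close>.\<close>

lemma blow_cubic_jet:
  fixes f :: "'a::idom ps3"
  assumes m: "m \<ge> 5" and r: "r + 4 * e \<ge> 3" and f: "f \<in> wt 1 e 1 d"
    and dvd: "cubic (m - 2) (r + 4 * e - 3) dvd blow e f - ps_X ^ d * h"
    and h: "h \<in> wt 1 1 1 k"
  obtains f0 where "f0 \<in> jet e d k" "cubic m r dvd f - f0"
proof -
  let ?G = "cubic (m - 2) (r + 4 * e - 3) :: 'a ps3"
  obtain q where q: "nf (f - cubic m r * q)" using weierstrass_division[of m f r] m by auto
  define p where "p = f - cubic m r * q"
  have p1: "p \<in> wt 1 e 1 d"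
    using q f m r unfolding p_def[symmetric] by (intro nf_order[of p m r "- q"]) (auto simp: p_def)
  obtain p' where p': "blow e p = ps_X ^ d * p'" using blow_divisible[OF p1] .
  have nf': "nf p'" using X_power_nf[of d p'] blow_nf[of p e] q by (simp add: p'[symmetric] p_def)
  have "ps_X ^ d * (p' - h) = (blow e f - ps_X ^ d * h) - ps_X ^ 3 * ?G * blow e q"
    using m r by (simp add: right_diff_distrib p'[symmetric])
      (simp add: p_def rhom_simps[OF rhom_blow] blow_cubic)
  then have "?G dvd ps_X ^ d * (p' - h)" using dvd by (simp add: mult.left_commute dvd_diff)
  then have "?G dvd p' - h" by (rule cubic_dvd_X_power_cancel) (use m in simp)
  then obtain q' where "p' - h = ?G * q'" by (auto simp: dvd_def)
  then have "p' - ?G * q' = h" by (simp add: algebra_simps)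
  then have p'k: "p' \<in> wt 1 1 1 k" using h m by (intro nf_order[OF nf', of "m - 2" "r + 4 * e - 3" q']) auto
  have "p \<in> wt 1 (1 + e) 2 (d + k)"
  proof (rule wtI)
    fix i j l assume "1 * i + (1 + e) * j + 2 * l < d + k"
    then have lt: "i + e * j + l + j + l < d + k" by (simp add: algebra_simps)
    have "ps_coeff p i j l = ps_coeff (ps_X ^ d * p') (i + e * j + l) j l"
      by (metis p' ps_coeff_blow_shift)
    also have "\<dots> = 0" using lt wtD[OF p'k, of "i + e * j + l - d" j l] by auto
    finally show "ps_coeff p i j l = 0" .
  qed
  with p1 have "p \<in> jet e d k" by (simp add: jet_def)
  with that[of p] show thesis by (simp add: p_def)
qed

text \<open>Truncate \<open>h\<close> below order \<open>k\<close> and multiply by X^k. Every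
  remaining monomial has an exponent of X that exceeds j + l, hence is at least e j + l because
  \<open>e <= 1\<close>, and so it comes from a monomial under \<open>blow e\<close>. The degree
  \<open>d\<close> is \<open>k\<close> itself.\<close>

lemma blow_dense:
  fixes h :: "'a::comm_ring_1 ps3"
  assumes "e \<le> 1"
  obtains d f h' where "f \<in> wt 1 e 1 d" "blow e f = ps_X ^ d * h'" "h' - h \<in> wt 1 1 1 k"
proof -
  let ?h = "Abs_fps (\<lambda>l. Abs_fps (\<lambda>j. Abs_fps (\<lambda>i. if i + j + l < k then ps_coeff h i j l else 0)))"
  have h: "ps_coeff ?h i j l = (if i + j + l < k then ps_coeff h i j l else 0)" for i j l
    by (simp add: ps_coeff_def)
  let ?f = "Abs_fps (\<lambda>l. Abs_fps (\<lambda>j. Abs_fps (\<lambda>i.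
      if i + e * j + l < k then 0 else ps_coeff ?h (i + e * j + l - k) j l)))"
  have f: "ps_coeff ?f i j l = (if i + e * j + l < k then 0 else ps_coeff ?h (i + e * j + l - k) j l)" for i j l
    by (simp add: ps_coeff_def)
  have "blow e ?f = ps_X ^ k * ?h"
  proof (rule ps_eqI)
    fix i j l
    have "e = 0 \<or> e = 1" using assms by linarith
    then show "ps_coeff (blow e ?f) i j l = ps_coeff (ps_X ^ k * ?h) i j l"
      by (auto simp: ps_coeff_blow f h)
  qed
  moreover have "?f \<in> wt 1 e 1 k" by (intro wtI) (simp add: f)
  moreover have "?h - h \<in> wt 1 1 1 k" by (intro wtI) (simp add: h)
  ultimately show thesis using that by blast
qed

section \<open>The reflection \<open>Y \<mapsto> X - Y\<close>\<close>

text \<open>Putting \<open>f(X, TX)\<close> in place of \<open>f(X, Y)\<close> turns the reflection into \<open>T \<mapsto> 1 - T\<close>, which acts on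
  polynomials.\<close>

definition polar :: "'a::comm_ring_1 fps fps \<Rightarrow> 'a poly fps"
  where "polar f = Abs_fps (\<lambda>n. \<Sum>b\<le>n. Polynomial.monom (fps_nth (fps_nth f b) (n - b)) b)"

lemma coeff_polar:
  "poly.coeff (fps_nth (polar f) n) b = (if b \<le> n then fps_nth (fps_nth f b) (n - b) else 0)"
  by (auto simp: polar_def coeff_sum)

lemma polar_inject: "polar f = polar g \<Longrightarrow> f = g"
proof (intro fps_ext)
  fix i j assume "polar f = polar g"
  then have "poly.coeff (fps_nth (polar f) (i + j)) i = poly.coeff (fps_nth (polar g) (i + j)) i" by simp
  then show "fps_nth (fps_nth f i) j = fps_nth (fps_nth g i) j" by (simp add: coeff_polar)
qed

lemma rhom_polar: "rhom polar"
proof (intro rhomI fps_ext poly_eqI)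
  fix f g :: "'a fps fps" and n b
  let ?u = "\<lambda>k c. poly.coeff (fps_nth (polar f) k) c * poly.coeff (fps_nth (polar g) (n - k)) (b - c)"
  have "poly.coeff (fps_nth (polar f * polar g) n) b = (\<Sum>k\<le>n. \<Sum>c\<le>b. ?u k c)"
    by (simp add: fps_mult_nth coeff_sum coeff_mult atLeast0AtMost)
  also have "\<dots> = (\<Sum>c\<le>b. \<Sum>k\<le>n. ?u k c)" by (rule sum.swap)
  also have "\<dots> = poly.coeff (fps_nth (polar (f * g)) n) b"
  proof (cases "b \<le> n")
    case False
    then have "?u k c = 0" if "k \<le> n" "c \<le> b" for k c using that by (auto simp: coeff_polar)
    then show ?thesis using False by (simp add: coeff_polar)
  next
    case True
    have "(\<Sum>k\<le>n. ?u k c) = (\<Sum>a\<le>n-b. fps_nth (fps_nth f c) a * fps_nth (fps_nth g (b - c)) (n - b - a))"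
      if "c \<le> b" for c
    proof -
      \<comment> \<open>Only c <= k <= c + (n - b) contributes, since the coefficient of X^k in a
        polar form has degree at most k in T.\<close>
      have "(\<Sum>k\<le>n. ?u k c) = (\<Sum>k\<in>{c..c+(n-b)}. ?u k c)"
        using True that by (intro sum.mono_neutral_right) (auto simp: coeff_polar)
      also have "\<dots> = (\<Sum>a\<in>{0..n-b}. ?u (a + c) c)"
        using sum.shift_bounds_cl_nat_ivl[of "\<lambda>k. ?u k c" 0 c "n-b"] by (simp add: add.commute)
      also have "\<dots> = (\<Sum>a\<in>{0..n-b}. fps_nth (fps_nth f c) a * fps_nth (fps_nth g (b - c)) (n - b - a))"
      proof (intro sum.cong refl)
        fix a assume "a \<in> {0..n-b}"
        then have "b - c \<le> n - (a + c)" "n - (a + c) - (b - c) = n - b - a" using True that by auto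
        then show "?u (a + c) c = fps_nth (fps_nth f c) a * fps_nth (fps_nth g (b - c)) (n - b - a)"
          by (simp add: coeff_polar)
      qed
      finally show ?thesis by (simp add: atLeast0AtMost)
    qed
    then show ?thesis using True by (simp add: coeff_polar fps_mult_nth fps_sum_nth atLeast0AtMost)
  qed
  finally show "poly.coeff (fps_nth (polar (f * g)) n) b = poly.coeff (fps_nth (polar f * polar g) n) b" ..
qed (auto simp: coeff_polar)

definition reflB :: "'a::comm_ring_1 fps fps \<Rightarrow> 'a fps fps"
  where "reflB f = Abs_fps (\<lambda>j. Abs_fps (\<lambda>i. poly.coeff (pcompose (fps_nth (polar f) (i + j)) [:1, -1:]) j))"

text \<open>A series in X over the polynomials in T is a polar form as soon as the coefficient of
  X^n has degree at most n in T. The affine substitution preserves this bound, so no coefficient is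
  lost when \<open>reflB\<close> reads the series back.\<close>

lemma polar_reflB: "polar (reflB f) = fmap (\<lambda>p. pcompose p [:1, -1:]) (polar f)"
proof (intro fps_ext poly_eqI)
  fix n b
  have "Polynomial.degree (fps_nth (polar f) n) \<le> n" by (intro degree_le) (simp add: coeff_polar)
  moreover have "Polynomial.degree (pcompose (fps_nth (polar f) n) [:1, -1:]) \<le> Polynomial.degree (fps_nth (polar f) n) * Polynomial.degree [:1, -1 :: 'a:]"
    by (rule degree_pcompose_le)
  ultimately have "Polynomial.degree (pcompose (fps_nth (polar f) n) [:1, -1:]) \<le> n"
    by (auto split: if_splits)
  then have "b > n \<Longrightarrow> poly.coeff (pcompose (fps_nth (polar f) n) [:1, -1:]) b = 0"
    by (intro coeff_eq_0) simp
  then show "poly.coeff (fps_nth (polar (reflB f)) n) b =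
     poly.coeff (fps_nth (fmap (\<lambda>p. pcompose p [:1, -1:]) (polar f)) n) b"
    by (auto simp: coeff_polar reflB_def)
qed

lemma rhom_pcompose: "rhom (\<lambda>p. pcompose p q)"
  by (intro rhomI) (simp_all add: pcompose_add pcompose_mult pcompose_1)

lemma rhom_reflB: "rhom reflB"
  by (intro rhomI polar_inject)
    (simp_all add: polar_reflB rhom_simps[OF rhom_polar] rhom_simps[OF rhom_fmap[OF rhom_pcompose]])

lemma reflB_reflB: "reflB (reflB f) = f"
proof (intro polar_inject fps_ext)
  fix n
  have "pcompose [:1, -1:] [:1, -1:] = [:0, 1 :: 'a:]" by (simp add: pcompose_pCons)
  then show "fps_nth (polar (reflB (reflB f))) n = fps_nth (polar f) n"
    by (simp add: polar_reflB pcompose_assoc[symmetric])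
qed

definition reflect :: "'a::comm_ring_1 ps3 \<Rightarrow> 'a ps3"
  where "reflect = fmap reflB"

lemma rhom_reflect: "rhom reflect"
  unfolding reflect_def by (intro rhom_fmap rhom_reflB)

lemma reflect_reflect [simp]: "reflect (reflect f) = f"
  by (intro fps_ext) (simp add: reflect_def reflB_reflB)

lemma reflect_gens:
  "reflect (ps_X :: 'a::comm_ring_1 ps3) = ps_X"
  "reflect (ps_Y :: 'a ps3) = ps_X - ps_Y"
  "reflect (ps_Z :: 'a ps3) = ps_Z"
  "reflect (ps_const c :: 'a ps3) = ps_const c"
proof -
  note B0 = rhom_0[OF rhom_reflB] and B1 = rhom_1[OF rhom_reflB]
  have "polar (fps_const fps_X :: 'a fps fps) = fps_X"
    by (intro fps_ext poly_eqI) (auto simp: coeff_polar coeff_eq_0)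
  then have "reflB (fps_const fps_X :: 'a fps fps) = fps_const fps_X"
    by (intro polar_inject fps_ext) (auto simp: polar_reflB pcompose_1)
  moreover have pY: "fps_nth (polar (fps_X :: 'a fps fps)) n = (if n = 1 then [:0, 1:] else 0)" for n
    by (intro poly_eqI) (auto simp: coeff_polar coeff_pCons split: nat.splits)
  have "reflB (fps_X :: 'a fps fps) = fps_const fps_X - fps_X"
    using \<open>polar (fps_const fps_X :: 'a fps fps) = fps_X\<close>
    by (intro polar_inject fps_ext) (auto simp: polar_reflB rhom_diff[OF rhom_polar] pY pcompose_pCons one_pCons)
  moreover have "polar (fps_const (fps_const c) :: 'a fps fps) = fps_const [:c:]"
    by (intro fps_ext poly_eqI) (auto simp: coeff_polar coeff_pCons split: nat.splits)
  then have "reflB (fps_const (fps_const c) :: 'a fps fps) = fps_const (fps_const c)"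
    by (intro polar_inject fps_ext) (auto simp: polar_reflB)
  ultimately show "reflect (ps_X :: 'a ps3) = ps_X" "reflect (ps_Y :: 'a ps3) = ps_X - ps_Y"
    "reflect (ps_Z :: 'a ps3) = ps_Z" "reflect (ps_const c :: 'a ps3) = ps_const c"
    by (auto simp: reflect_def ps_X_def ps_Y_def ps_const_def ps_Z_def fmap_const B0 B1 fps_eq_iff)
qed

text \<open>The reflection mixes only monomials of equal degree in X and Y: order at least
  \<open>k\<close> means that the polar coefficients of low degree vanish, and composition keeps
  them zero.\<close>

lemma reflect_wt: "f \<in> wt 1 1 1 k \<Longrightarrow> reflect f \<in> wt 1 1 1 k"
proof (rule wtI)
  fix i j l assume f: "f \<in> wt 1 1 1 k" and lt: "1 * i + 1 * j + 1 * l < k"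
  have "ps_coeff f (i + j - b) b l = 0" if "b \<le> i + j" for b
    using lt that by (intro wtD[OF f]) simp
  then have "fps_nth (polar (fps_nth f l)) (i + j) = 0"
    by (intro poly_eqI) (auto simp: coeff_polar ps_coeff_def)
  then show "ps_coeff (reflect f) i j l = 0"
    by (simp add: reflect_def ps_coeff_def reflB_def)
qed

lemma F_eq_reflect: "F_eq m = reflect (cubic m 0)"
  by (simp add: F_eq_def cubic_def rhom_simps[OF rhom_reflect] reflect_gens)

section \<open>Ideals of a commutative ring and lengths\<close>

text \<open>Ideals of a type-class ring. Ideals of the surface rings and their localizations are
  studied through their preimages in K[[X,Y,Z]], which avoids cosets and carriers.\<close>

definition tideal :: "'r::comm_ring_1 set \<Rightarrow> bool"
  where "tideal N \<longleftrightarrow> 0 \<in> N \<and> (\<forall>a\<in>N. \<forall>b\<in>N. a + b \<in> N) \<and> (\<forall>a\<in>N. \<forall>s. s * a \<in> N)"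

definition tprime :: "'r::comm_ring_1 set \<Rightarrow> bool"
  where "tprime P \<longleftrightarrow> tideal P \<and> 1 \<notin> P \<and> (\<forall>a b. a * b \<in> P \<longrightarrow> a \<in> P \<or> b \<in> P)"

lemma
  assumes "tideal N"
  shows tideal_0: "0 \<in> N" and tideal_add: "a \<in> N \<Longrightarrow> b \<in> N \<Longrightarrow> a + b \<in> N"
    and tideal_mult: "a \<in> N \<Longrightarrow> s * a \<in> N" and tideal_mult_right: "a \<in> N \<Longrightarrow> a * s \<in> N"
  using assms by (auto simp: tideal_def mult.commute[of a s])

lemma tideal_minus: "tideal N \<Longrightarrow> a \<in> N \<Longrightarrow> - a \<in> N"
  using tideal_mult[of N a "- 1"] by simp

lemma tideal_diff: "tideal N \<Longrightarrow> a \<in> N \<Longrightarrow> b \<in> N \<Longrightarrow> a - b \<in> N"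
  using tideal_add[of N a "- b"] tideal_minus by fastforce

lemma tideal_dvd: "tideal N \<Longrightarrow> a \<in> N \<Longrightarrow> a dvd b \<Longrightarrow> b \<in> N"
  by (auto simp: dvd_def tideal_mult_right)

lemma tideal_cong: "tideal N \<Longrightarrow> a - b \<in> N \<Longrightarrow> a \<in> N \<longleftrightarrow> b \<in> N"
  using tideal_add[of N "a - b" b] tideal_diff[of N a "a - b"] by auto

lemma tprime_tideal: "tprime P \<Longrightarrow> tideal P"
  by (simp add: tprime_def)

lemma tprime_mult_iff: "tprime P \<Longrightarrow> a * b \<in> P \<longleftrightarrow> a \<in> P \<or> b \<in> P"
  using tideal_mult tideal_mult_right by (fastforce simp: tprime_def)

lemma tprime_1: "tprime P \<Longrightarrow> 1 \<notin> P"
  by (simp add: tprime_def)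

lemma tprime_power: "tprime P \<Longrightarrow> a ^ n \<in> P \<Longrightarrow> a \<in> P"
  by (induction n) (auto simp: tprime_mult_iff tprime_1)

lemma tprime_not_mult: "tprime P \<Longrightarrow> a \<notin> P \<Longrightarrow> b \<notin> P \<Longrightarrow> a * b \<notin> P"
  by (simp add: tprime_mult_iff)

text \<open>For prime \<open>P\<close> these are the contractions of the ideals of the localization
  at \<open>P\<close>, and \<open>sat\<close> is extension followed by contraction.\<close>

definition satideal :: "'r::comm_ring_1 set \<Rightarrow> 'r set \<Rightarrow> bool"
  where "satideal P C \<longleftrightarrow> tideal C \<and> (\<forall>s f. s \<notin> P \<longrightarrow> s * f \<in> C \<longrightarrow> f \<in> C)"

definition sat :: "'r::comm_ring_1 set \<Rightarrow> 'r set \<Rightarrow> 'r set"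
  where "sat P N = {f. \<exists>s. s \<notin> P \<and> s * f \<in> N}"

lemma satD: "satideal P C \<Longrightarrow> s \<notin> P \<Longrightarrow> s * f \<in> C \<Longrightarrow> f \<in> C"
  by (auto simp: satideal_def)

lemma satideal_tideal: "satideal P C \<Longrightarrow> tideal C"
  by (simp add: satideal_def)

lemma sat_incl: "tprime P \<Longrightarrow> N \<subseteq> sat P N"
  by (auto simp: sat_def intro!: exI[of _ 1] tprime_1)

lemma satideal_sat:
  assumes "tprime P" "tideal N" shows "satideal P (sat P N)"
  unfolding satideal_def
proof (intro conjI allI impI)
  show "tideal (sat P N)" unfolding tideal_def
  proof (intro conjI ballI allI)
    show "0 \<in> sat P N" using sat_incl[OF assms(1)] tideal_0[OF assms(2)] by blast
    fix a assume "a \<in> sat P N"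
    then obtain s where s: "s \<notin> P" "s * a \<in> N" by (auto simp: sat_def)
    show "x * a \<in> sat P N" for x
      using s tideal_mult[OF assms(2) s(2), of x] by (auto simp: sat_def mult.left_commute)
    fix b assume "b \<in> sat P N"
    then obtain t where t: "t \<notin> P" "t * b \<in> N" by (auto simp: sat_def)
    have "t * (s * a) + s * (t * b) \<in> N"
      by (intro tideal_add[OF assms(2)] tideal_mult[OF assms(2)] s t)
    then have "(s * t) * (a + b) \<in> N" by (simp add: algebra_simps)
    then show "a + b \<in> sat P N"
      using tprime_not_mult[OF assms(1) s(1) t(1)] by (auto simp: sat_def)
  qed
next
  fix s f assume "s \<notin> P" "s * f \<in> sat P N"
  then obtain t where "t \<notin> P" "t * (s * f) \<in> N" by (auto simp: sat_def)
  then show "f \<in> sat P N"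
    using \<open>s \<notin> P\<close> tprime_not_mult[OF assms(1), of t s] by (auto simp: sat_def mult.assoc)
qed

lemma sat_least: "satideal P C \<Longrightarrow> N \<subseteq> C \<Longrightarrow> sat P N \<subseteq> C"
  by (auto simp: sat_def satideal_def)

lemma satideal_UNIV: "satideal P UNIV"
  by (auto simp: satideal_def tideal_def)

definition satchain :: "'r::comm_ring_1 set \<Rightarrow> 'r set \<Rightarrow> nat \<Rightarrow> (nat \<Rightarrow> 'r set) \<Rightarrow> bool"
  where "satchain P N n C \<longleftrightarrow> (\<forall>i\<le>n. satideal P (C i) \<and> N \<subseteq> C i) \<and> (\<forall>i<n. C i \<subset> C (Suc i))"

text \<open>The length of the module \<open>S_P / N S_P\<close>, expressed through ideals of \<open>S\<close>.\<close>

definition slen :: "'r::comm_ring_1 set \<Rightarrow> 'r set \<Rightarrow> enat"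
  where "slen P N = Sup {enat n | n. \<exists>C. satchain P N n C}"

lemma slen_ge: "satchain P N n C \<Longrightarrow> enat n \<le> slen P N"
  unfolding slen_def by (intro Sup_upper) auto

lemma slen_le: "(\<And>n C. satchain P N n C \<Longrightarrow> n \<le> L) \<Longrightarrow> slen P N \<le> enat L"
  unfolding slen_def by (intro Sup_least) auto

text \<open>After localization at \<open>P\<close>, the quotient of \<open>D n\<close> by
  \<open>D (Suc n)\<close> is generated by the class of \<open>e n\<close> and killed by
  \<open>P\<close> if \<open>n\<close> is in \<open>I\<close>, and is zero otherwise. Lengths thus
  become numbers of elements of \<open>I\<close>.\<close>

locale filtration =
  fixes P :: "'r::comm_ring_1 set" and D :: "nat \<Rightarrow> 'r set" and e :: "nat \<Rightarrow> 'r" and I :: "nat set"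
  assumes prime: "tprime P" and D0: "D 0 = UNIV" and D_sat: "\<And>n. satideal P (D n)"
    and D_Suc: "\<And>n. D (Suc n) \<subseteq> D n"
    and step: "\<And>n f. n \<in> I \<Longrightarrow> f \<in> D n \<Longrightarrow> \<exists>s a. s \<notin> P \<and> s * f - a * e n \<in> D (Suc n)"
    and kill: "\<And>n p. n \<in> I \<Longrightarrow> p \<in> P \<Longrightarrow> p * e n \<in> D (Suc n)"
    and const: "\<And>n. n \<notin> I \<Longrightarrow> D n \<subseteq> D (Suc n)"
begin

definition jumps :: "nat \<Rightarrow> 'r set \<Rightarrow> nat set"
  where "jumps L C = {n\<in>I. n < L \<and> (\<exists>c\<in>C \<inter> D n. c \<notin> D (Suc n))}"

text \<open>Each step of the filtration is simple, so an ideal is determined by its jumps among the ideals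
  comparable with it.\<close>

lemma jumps_strict:
  assumes C: "satideal P C" and C': "satideal P C'" and L: "D L \<subseteq> C" and lt: "C \<subset> C'"
  shows "jumps L C \<subset> jumps L C'"
proof -
  have "C' \<subseteq> C" if eq: "jumps L C = jumps L C'"
  proof -
    have "C' \<inter> D (L - i) \<subseteq> C" if "i \<le> L" for i
      using that
    proof (induction i)
      case (Suc i)
      define n where "n = L - Suc i"
      have n: "L - i = Suc n" "n < L" using Suc.prems by (auto simp: n_def)
      have IH: "C' \<inter> D (Suc n) \<subseteq> C" using Suc n by simp
      show ?case unfolding n_def[symmetric]
      proof
        fix x assume x: "x \<in> C' \<inter> D n"
        show "x \<in> C"
        proof (cases "x \<in> D (Suc n)")
          case True then show ?thesis using IH x by blast
        next
          case False
          then have nI: "n \<in> I" using const x by blast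
          with False x n(2) have "n \<in> jumps L C'" by (auto simp: jumps_def)
          then obtain c where c: "c \<in> C" "c \<in> D n" "c \<notin> D (Suc n)"
            using eq by (auto simp: jumps_def)
          obtain s a where s: "s \<notin> P" "s * c - a * e n \<in> D (Suc n)" using step nI c by blast
          obtain t b where t: "t \<notin> P" "t * x - b * e n \<in> D (Suc n)" using step nI x by blast
          note idD = satideal_tideal[OF D_sat]
          have a: "a \<notin> P"
          proof
            assume "a \<in> P"
            then have "s * c \<in> D (Suc n)" using tideal_add[OF idD s(2) kill[OF nI, of a]] by simp
            then show False using satD[OF D_sat s(1)] c by blast
          qed
          \<comment> \<open>Both \<open>x\<close> and \<open>c\<close> are multiples of
            \<open>e n\<close> modulo \<open>D (Suc n)\<close> up to units at \<open>P\<close>, and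
            \<open>a\<close> is such a unit. Cancelling the leading terms moves the combination one
            step down, where the induction hypothesis applies.\<close>
          have "a * (t * x - b * e n) - b * (s * c - a * e n) \<in> D (Suc n)"
            by (intro tideal_diff[OF idD] tideal_mult[OF idD] s t)
          then have "(a * t) * x - (b * s) * c \<in> D (Suc n)" by (simp add: algebra_simps)
          moreover have "(a * t) * x - (b * s) * c \<in> C'"
            using x c lt by (intro tideal_diff tideal_mult satideal_tideal[OF C']) auto
          ultimately have "(a * t) * x - (b * s) * c \<in> C" using IH by blast
          then have "(a * t) * x \<in> C"
            using tideal_mult[OF satideal_tideal[OF C] c(1)] tideal_cong[OF satideal_tideal[OF C]] by blast
          then show ?thesis using satD[OF C tprime_not_mult[OF prime a t(1)]] by blast
        qed
      qed
    qed (use L in auto)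
    from this[of L] show ?thesis by (simp add: D0)
  qed
  moreover have "jumps L C \<subseteq> jumps L C'" using lt by (auto simp: jumps_def)
  ultimately show ?thesis using lt by blast
qed

text \<open>Along a strict chain of ideals the sets of jumps grow strictly, and all of them lie in
  \<open>I\<close> below \<open>L\<close>.\<close>

lemma slen_upper:
  assumes "D L \<subseteq> N" shows "slen P N \<le> enat (card (I \<inter> {..<L}))"
proof (rule slen_le)
  fix n C assume C: "satchain P N n C"
  have fin: "finite (jumps L C')" for C' by (rule finite_subset[of _ "{..<L}"]) (auto simp: jumps_def)
  have "i \<le> card (jumps L (C i))" if "i \<le> n" for i
    using that
  proof (induction i)
    case (Suc i)
    have "jumps L (C i) \<subset> jumps L (C (Suc i))"
    proof (intro jumps_strict)
      have "N \<subseteq> C i" using C Suc.prems by (simp add: satchain_def)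
      then show "D L \<subseteq> C i" using assms by blast
    qed (use C Suc.prems in \<open>simp_all add: satchain_def Suc_le_eq\<close>)
    then have "card (jumps L (C i)) < card (jumps L (C (Suc i)))" by (intro psubset_card_mono fin)
    then show ?case using Suc by simp
  qed simp
  from this[of n] have "n \<le> card (jumps L (C n))" by simp
  also have "\<dots> \<le> card (I \<inter> {..<L})" by (intro card_mono) (auto simp: jumps_def)
  finally show "n \<le> card (I \<inter> {..<L})" .
qed

text \<open>The bound is attained by the filtration itself, reversed and with the steps outside
  \<open>I\<close> omitted.\<close>

lemma slen_eq:
  assumes strict: "\<And>n. n \<in> I \<Longrightarrow> e n \<in> D n \<and> e n \<notin> D (Suc n)"
  shows "slen P (D L) = enat (card (I \<inter> {..<L}))"
proof (rule antisym)
  have "\<exists>C. satchain P (D n) (card (I \<inter> {..<n})) C \<and> C 0 = D n" for n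
  proof (induction n)
    case 0
    show ?case by (rule exI[of _ "\<lambda>_. UNIV"]) (simp add: satchain_def D0 satideal_UNIV)
  next
    case (Suc n)
    then obtain C where C: "satchain P (D n) (card (I \<inter> {..<n})) C" "C 0 = D n" by blast
    show ?case
    proof (cases "n \<in> I")
      case False
      then have "I \<inter> {..<Suc n} = I \<inter> {..<n}" by (auto simp: less_Suc_eq)
      moreover have "D (Suc n) = D n" using False D_Suc const by blast
      ultimately show ?thesis using C by auto
    next
      case True
      then have "I \<inter> {..<Suc n} = insert n (I \<inter> {..<n})" by auto
      then have card: "card (I \<inter> {..<Suc n}) = Suc (card (I \<inter> {..<n}))" by simp
      have "D (Suc n) \<subset> D n" using D_Suc strict[OF True] by blast
      then have "satchain P (D (Suc n)) (Suc (card (I \<inter> {..<n}))) (case_nat (D (Suc n)) C)"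
        using C D_sat unfolding satchain_def
        by (fastforce split: nat.splits simp: less_Suc_eq_0_disj)
      then show ?thesis using card by (intro exI[of _ "case_nat (D (Suc n)) C"]) auto
    qed
  qed
  then show "enat (card (I \<inter> {..<L})) \<le> slen P (D L)" using slen_ge by blast
qed (rule slen_upper, simp)

end

section \<open>Powers of the maximal ideal of a localization of a hypersurface\<close>

text \<open>\<open>W k\<close> stands for the preimage in \<open>S\<close> of the \<open>k\<close>-th power of the maximal ideal of the
  localization of \<open>S/(F)\<close> at \<open>P\<close>.\<close>

locale local_powers =
  fixes P :: "'r::comm_ring_1 set" and F :: 'r and W :: "nat \<Rightarrow> 'r set"
  assumes prime: "tprime P" and F_in_P: "F \<in> P" and W_0: "W 0 = UNIV"
    and W_sat: "\<And>k. satideal P (W k)" and F_in_W: "\<And>k. F \<in> W k"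
    and W_mult: "\<And>k p f. p \<in> P \<Longrightarrow> f \<in> W k \<Longrightarrow> p * f \<in> W (Suc k)"
    and W_least: "\<And>k C. satideal P C \<Longrightarrow> F \<in> C \<Longrightarrow> (\<And>p f. p \<in> P \<Longrightarrow> f \<in> W k \<Longrightarrow> p * f \<in> C)
      \<Longrightarrow> W (Suc k) \<subseteq> C"
begin

lemmas idP = tprime_tideal[OF prime]
lemmas idW = satideal_tideal[OF W_sat]

lemma W_Suc: "W (Suc k) \<subseteq> W k"
  by (intro W_least W_sat F_in_W tideal_mult idW)

lemma W_power: "p \<in> P \<Longrightarrow> p ^ k \<in> W k"
  by (induction k) (simp_all add: W_0 W_mult)

definition hs_mult :: "nat \<Rightarrow> bool"
  where "hs_mult d \<longleftrightarrow> (\<exists>p :: real Polynomial.poly.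
    (\<forall>\<^sub>F k in sequentially. \<exists>l. slen P (W k) = enat l \<and> real l = poly p (real k)) \<and>
    real d = fact (Polynomial.degree p) * Polynomial.lead_coeff p)"

end

text \<open>A constant is eventually below k, a polynomial of degree at least two with positive
  leading coefficient is eventually above 2 k, and in degree one the value 3 would be the slope,
  again above 2.\<close>

lemma poly_linear_bounds:
  fixes p :: "real Polynomial.poly"
  assumes ev: "\<forall>\<^sub>F k in sequentially. real k \<le> poly p (real k) \<and> poly p (real k) \<le> 2 * real k"
  shows "3 \<noteq> fact (Polynomial.degree p) * Polynomial.lead_coeff p"
proof
  assume 3: "3 = fact (Polynomial.degree p) * Polynomial.lead_coeff p"
  have lc: "Polynomial.lead_coeff p > 0"
    using 3 by (metis fact_gt_zero zero_less_mult_pos zero_less_numeral)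
  from ev obtain K where K: "\<And>k. k \<ge> K \<Longrightarrow> real k \<le> poly p (real k) \<and> poly p (real k) \<le> 2 * real k"
    by (auto simp: eventually_sequentially)
  consider "Polynomial.degree p = 0" | "Polynomial.degree p = 1" | "Polynomial.degree p \<ge> 2" by linarith
  then show False
  proof cases
    case 1
    then obtain c where "p = [:c:]" by (rule degree_eq_zeroE)
    with K[of "max K (nat \<lceil>c\<rceil> + 1)"] show False by simp linarith
  next
    case 2
    then obtain c d where p: "p = [:c, d:]" "d \<noteq> 0" by (metis degree1_coeffs)
    with 3 have "p = [:c, 3:]" by simp
    with K[of "max K (nat \<lceil>- c\<rceil> + 1)"] show False by simp linarith
  next
    case 3
    define q where "q = p - [:0, 2:]"
    have "Polynomial.degree [:0, 2::real:] < Polynomial.degree p" using 3 by simp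
    then have "Polynomial.lead_coeff q > 0"
      using lc lead_coeff_add_le[of "- [:0, 2::real:]" p]
      by (simp only: q_def diff_conv_add_uminus add.commute[of p] degree_minus)
    then obtain n where n: "\<And>x. x \<ge> n \<Longrightarrow> poly q x > 0"
      using poly_pinfty_gt_lc[of q] by (meson less_le_trans)
    define k where "k = max K (nat \<lceil>n\<rceil>)"
    have "k \<ge> K" "real k \<ge> n" by (auto simp: k_def) linarith
    with n[of "real k"] K[of k] show False by (simp add: q_def mult.commute)
  qed
qed

text \<open>If the square of one of two generators of the maximal ideal is a multiple of the other, the
  Hilbert function grows by at most two at each step.\<close>

theorem (in local_powers) not_hs_mult_3:
  assumes uv: "u \<in> P" "v \<in> P" "\<And>p. p \<in> P \<Longrightarrow> \<exists>a c. p = u * a + v * c"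
    and s: "s \<notin> P" "s * u\<^sup>2 = v * w + F * q" "w \<in> P"
    and b: "b \<in> P" "\<And>k f. F dvd b ^ k * f \<Longrightarrow> F dvd f"
  shows "\<not> hs_mult 3"
proof
  define A where "A i = {f. \<exists>p q. p \<in> P \<and> f = v ^ i * p + F * q}" for i
  define B where "B i = {f. \<exists>p q. f = v ^ Suc i * p + F * q}" for i
  have idA: "tideal (A i)" for i unfolding tideal_def
  proof (intro conjI ballI allI)
    show "0 \<in> A i" using tideal_0[OF idP] by (auto simp: A_def intro!: exI[of _ 0])
    fix x y z assume "x \<in> A i"
    then obtain p q where x: "p \<in> P" "x = v ^ i * p + F * q" by (auto simp: A_def)
    have "z * x = v ^ i * (z * p) + F * (z * q)" by (simp add: x algebra_simps)
    then show "z * x \<in> A i" using tideal_mult[OF idP x(1)] by (auto simp: A_def)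
    assume "y \<in> A i"
    then obtain p' q' where y: "p' \<in> P" "y = v ^ i * p' + F * q'" by (auto simp: A_def)
    have "x + y = v ^ i * (p + p') + F * (q + q')" by (simp add: x y algebra_simps)
    then show "x + y \<in> A i" using tideal_add[OF idP x(1) y(1)] by (auto simp: A_def)
  qed
  have idB: "tideal (B i)" for i unfolding tideal_def
  proof (intro conjI ballI allI)
    show "0 \<in> B i" by (auto simp: B_def intro!: exI[of _ 0])
    fix x y z assume "x \<in> B i"
    then obtain p q where x: "x = v ^ Suc i * p + F * q" by (auto simp: B_def)
    have "z * x = v ^ Suc i * (z * p) + F * (z * q)" by (simp add: x algebra_simps)
    then show "z * x \<in> B i" unfolding B_def by blast
    assume "y \<in> B i"
    then obtain p' q' where y: "y = v ^ Suc i * p' + F * q'" by (auto simp: B_def)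
    have "x + y = v ^ Suc i * (p + p') + F * (q + q')" by (simp add: x y algebra_simps)
    then show "x + y \<in> B i" unfolding B_def by blast
  qed
  note satA = satideal_sat[OF prime idA] and satB = satideal_sat[OF prime idB]
  have AB: "B i \<subseteq> A i" "A (Suc i) \<subseteq> B i" for i
  proof -
    show "B i \<subseteq> A i"
    proof
      fix x assume "x \<in> B i"
      then obtain p q where x: "x = v ^ Suc i * p + F * q" by (auto simp: B_def)
      have "x = v ^ i * (v * p) + F * q" by (simp add: x algebra_simps)
      then show "x \<in> A i" using tideal_mult_right[OF idP uv(2)] by (auto simp: A_def)
    qed
    show "A (Suc i) \<subseteq> B i" by (auto simp: A_def B_def)
  qed
  have sat_mono: "C \<subseteq> C' \<Longrightarrow> sat P C \<subseteq> sat P C'" for C C'  by (auto simp: sat_def)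
  \<comment> \<open>The relation for \<open>u\<close> squared says that P^2 equals v P modulo F
    after inverting \<open>s\<close>; this gives the recursion for the powers.\<close>
  have PP: "s * (p * p') \<in> A 1" if pP: "p \<in> P" "p' \<in> P" for p p'
  proof -
    obtain a c where p1: "p = u * a + v * c" using uv(3) pP(1) by blast
    obtain a' c' where p2: "p' = u * a' + v * c'" using uv(3) pP(2) by blast
    note p = p1 p2
    have "s * (p * p') = a * a' * (s * u\<^sup>2) + v * (s * (u * a * c' + c * p'))"
      by (simp add: p power2_eq_square algebra_simps)
    also have "\<dots> = v ^ 1 * (a * a' * w + s * (u * a * c' + c * p')) + F * (a * a' * q)"
      by (simp add: s(2) algebra_simps)
    finally have "s * (p * p') = v ^ 1 * (a * a' * w + s * (u * a * c' + c * p')) + F * (a * a' * q)" .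
    moreover have "a * a' * w + s * (u * a * c' + c * p') \<in> P"
      by (intro tideal_add[OF idP] tideal_mult[OF idP] tideal_mult_right[OF idP] pP s(3) uv)
    ultimately show ?thesis unfolding A_def by blast
  qed
  have P_A0: "P \<subseteq> A 0"
  proof
    fix x assume "x \<in> P"
    moreover have "x = v ^ 0 * x + F * 0" by simp
    ultimately show "x \<in> A 0" unfolding A_def by blast
  qed
  have W_sub: "W (Suc i) \<subseteq> sat P (A i)" for i
  proof (induction i)
    case 0
    have "P \<subseteq> sat P (A 0)" using sat_incl[OF prime] P_A0 by blast
    then show ?case using F_in_P by (intro W_least satA) (auto intro: tideal_mult_right[OF idP])
  next
    case (Suc i)
    show ?case
    proof (intro W_least satA)
      show "F \<in> sat P (A (Suc i))"
      proof -
        have "F = v ^ Suc i * 0 + F * 1" by simp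
        then have "F \<in> A (Suc i)" using tideal_0[OF idP] unfolding A_def by blast
        then show ?thesis using sat_incl[OF prime] by blast
      qed
      fix p f assume pf: "p \<in> P" "f \<in> W (Suc i)"
      then obtain t p' q' where t: "t \<notin> P" "p' \<in> P" "t * f = v ^ i * p' + F * q'"
        using Suc by (auto simp: sat_def A_def)
      obtain p2 q2 where p2: "p2 \<in> P" "s * (p * p') = v ^ 1 * p2 + F * q2"
        using PP[OF pf(1) t(2)] by (auto simp: A_def)
      have "(s * t) * (p * f) = s * p * (t * f)" by (simp add: algebra_simps)
      also have "\<dots> = v ^ i * (s * (p * p')) + F * (s * p * q')" by (simp only: t) (simp add: algebra_simps)
      also have "\<dots> = v ^ Suc i * p2 + F * (v ^ i * q2 + s * p * q')" by (simp only: p2) (simp add: algebra_simps)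
      finally have "(s * t) * (p * f) \<in> A (Suc i)" using p2 by (auto simp: A_def)
      then show "p * f \<in> sat P (A (Suc i))"
        using tprime_not_mult[OF prime s(1) t(1)] by (auto simp: sat_def)
    qed
  qed
  have W_sup: "sat P (A i) \<subseteq> W (Suc i)" for i
  proof (intro sat_least W_sat subsetI)
    fix x assume "x \<in> A i"
    then obtain p q where x: "p \<in> P" "x = v ^ i * p + F * q" by (auto simp: A_def)
    show "x \<in> W (Suc i)" unfolding x
      using tideal_add[OF idW W_mult[OF x(1) W_power[OF uv(2)], of i] tideal_mult_right[OF idW F_in_W, where s = q]]
      by (simp add: mult.commute)
  qed
  \<comment> \<open>The filtration is 1, P, B 0, A 1, B 1, A 2, ... with generators 1, u, v, v u,
    v^2, ... of the successive quotients; each increase of \<open>k\<close> by one costs two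
    steps.\<close>
  define D where "D n = (if n = 0 then UNIV else if odd n then sat P (A (n div 2)) else sat P (B (n div 2 - 1)))" for n
  define e where "e n = (if odd n then v ^ (n div 2) * u else v ^ (n div 2))" for n
  have ncases: "n = 0 \<or> (\<exists>i. n = Suc (2 * i)) \<or> (\<exists>i. n = Suc (Suc (2 * i)))" for n :: nat
    by presburger
  have D_simps: "D 0 = UNIV" "D (Suc (2 * i)) = sat P (A i)" "D (Suc (Suc (2 * i))) = sat P (B i)"
    "D (Suc (Suc (Suc (2 * i)))) = sat P (A (Suc i))" for i by (auto simp: D_def)
  have e_simps: "e 0 = 1" "e (Suc (2 * i)) = v ^ i * u" "e (Suc (Suc (2 * i))) = v ^ Suc i" for i
    by (auto simp: e_def)
  have B_kill: "p * (v ^ i * u) \<in> sat P (B i)" if pP: "p \<in> P" for p i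
  proof -
    obtain p2 q2 where p2: "p2 \<in> P" "s * (p * u) = v ^ 1 * p2 + F * q2"
      using PP[OF pP uv(1)] by (auto simp: A_def)
    have "s * (p * (v ^ i * u)) = v ^ i * (s * (p * u))" by (simp add: algebra_simps)
    also have "\<dots> = v ^ Suc i * p2 + F * (v ^ i * q2)" by (simp only: p2) (simp add: algebra_simps)
    finally show ?thesis using s(1) by (auto simp: sat_def B_def)
  qed
  interpret filtration P D e UNIV
  proof
    show "satideal P (D n)" for n
      using ncases[of n] satA satB satideal_UNIV by (auto simp: D_simps)
    show "D (Suc n) \<subseteq> D n" for n
      using ncases[of n]
      by (elim disjE exE) (simp_all only: D_simps subset_UNIV sat_mono[OF AB(1)] sat_mono[OF AB(2)])
    show "p * e n \<in> D (Suc n)" if p: "p \<in> P" for n p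
      using ncases[of n]
    proof (elim disjE exE)
      assume "n = 0"
      moreover have "p \<in> A 0" using p P_A0 by blast
      ultimately show ?thesis using sat_incl[OF prime, of "A 0"] by (auto simp: D_simps(2)[of 0, simplified] e_simps)
    next
      fix i assume "n = Suc (2 * i)"
      then show ?thesis using B_kill[OF p, of i] by (simp only: D_simps e_simps)
    next
      fix i assume n: "n = Suc (Suc (2 * i))"
      have "p * v ^ Suc i = v ^ Suc i * p + F * 0" by (simp add: algebra_simps)
      then have "p * v ^ Suc i \<in> A (Suc i)" using p unfolding A_def by blast
      then show ?thesis using sat_incl[OF prime] unfolding n D_simps e_simps by blast
    qed
    show "\<exists>s a. s \<notin> P \<and> s * f - a * e n \<in> D (Suc n)" if f: "f \<in> D n" for n f
      using ncases[of n]
    proof (elim disjE exE)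
      assume "n = 0"
      then show ?thesis using tprime_1[OF prime] tideal_0[OF satideal_tideal[OF satA]]
        by (intro exI[of _ 1] exI[of _ f]) (auto simp: D_simps(2)[of 0, simplified] e_simps)
    next
      fix i assume n: "n = Suc (2 * i)"
      then obtain t p q where t: "t \<notin> P" "p \<in> P" "t * f = v ^ i * p + F * q"
        using f by (auto simp: D_simps sat_def A_def)
      obtain a c where "p = u * a + v * c" using uv(3) t(2) by blast
      then have "t * f - a * (v ^ i * u) = v ^ Suc i * c + F * q" by (simp only: t) (simp add: algebra_simps)
      then have "t * f - a * (v ^ i * u) \<in> B i" unfolding B_def by blast
      then show ?thesis using t(1) sat_incl[OF prime] unfolding n D_simps e_simps by blast
    next
      fix i assume n: "n = Suc (Suc (2 * i))"
      then obtain t a q where t: "t \<notin> P" "t * f = v ^ Suc i * a + F * q"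
        using f unfolding n D_simps sat_def B_def by blast
      then have "t * f - a * v ^ Suc i = v ^ Suc i * 0 + F * q" by (simp add: algebra_simps)
      then have "t * f - a * v ^ Suc i \<in> A (Suc i)" using tideal_0[OF idP] unfolding A_def by blast
      then show ?thesis using t(1) sat_incl[OF prime] unfolding n D_simps e_simps by blast
    qed
  qed (simp_all add: prime D_simps)
  have upper: "slen P (W k) \<le> enat (2 * k)" for k
  proof (cases k)
    case 0
    have "slen P (W k) \<le> enat (card (UNIV \<inter> {..<0::nat}))" by (rule slen_upper) (simp add: 0 W_0)
    then show ?thesis by (simp add: 0)
  next
    case (Suc i)
    have "slen P (W k) \<le> enat (card (UNIV \<inter> {..<Suc (2 * i)}))"
      by (rule slen_upper) (use W_sup in \<open>simp only: Suc D_simps\<close>)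
    also have "\<dots> \<le> enat (2 * k)" by (simp add: Suc)
    finally show ?thesis .
  qed
  \<comment> \<open>A Nakayama argument: if v^k lay in \<open>W (Suc k)\<close>, it would be
    annihilated modulo F by the local unit \<open>t - p\<close>. Since b^(k+1) is locally a multiple
    of v^k, a local unit would annihilate it too, although \<open>b\<close> is a nonzerodivisor
    modulo F.\<close>
  have strict: "W (Suc k) \<subset> W k" for k
  proof -
    have "v ^ k \<notin> W (Suc k)"
    proof
      assume "v ^ k \<in> W (Suc k)"
      then obtain t p q where t: "t \<notin> P" "p \<in> P" "t * v ^ k = v ^ k * p + F * q"
        using W_sub by (fastforce simp: sat_def A_def)
      have "b ^ Suc k \<in> W (Suc k)" using W_power[OF b(1)] .
      then obtain t' p' q' where t': "t' \<notin> P" "p' \<in> P" "t' * b ^ Suc k = v ^ k * p' + F * q'"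
        using W_sub by (fastforce simp: sat_def A_def)
      have "b ^ Suc k * ((t - p) * t') = (t - p) * (t' * b ^ Suc k)" by (simp add: algebra_simps)
      also have "\<dots> = p' * (t * v ^ k - v ^ k * p) + F * ((t - p) * q')" by (simp only: t') (simp add: algebra_simps)
      also have "\<dots> = F * (p' * q + (t - p) * q')" by (simp only: t) (simp add: algebra_simps)
      finally have "F dvd b ^ Suc k * ((t - p) * t')" by simp
      then have "F dvd (t - p) * t'" by (rule b(2))
      then have "(t - p) * t' \<in> P" using tideal_dvd[OF idP F_in_P] by blast
      moreover have "t - p \<notin> P" using t tideal_add[OF idP, of "t - p" p] by auto
      ultimately show False using t' prime tprime_mult_iff by blast
    qed
    then show ?thesis using W_Suc W_power[OF uv(2)] by blast
  qed
  have lower: "enat k \<le> slen P (W k)" for k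
  proof (rule slen_ge)
    have dec: "W j \<subseteq> W i" if "i \<le> j" for i j
      using that by (induction rule: dec_induct) (use W_Suc in auto)
    show "satchain P (W k) k (\<lambda>i. W (k - i))" unfolding satchain_def
    proof (intro conjI allI impI W_sat dec)
      fix i assume "i < k"
      then have "k - i = Suc (k - Suc i)" by simp
      then show "W (k - i) \<subset> W (k - Suc i)" using strict[of "k - Suc i"] by simp
    qed simp
  qed
  assume "hs_mult 3"
  then obtain p :: "real Polynomial.poly" where
    ev: "\<forall>\<^sub>F k in sequentially. \<exists>l. slen P (W k) = enat l \<and> real l = poly p (real k)"
    and 3: "3 = fact (Polynomial.degree p) * Polynomial.lead_coeff p"
    by (auto simp: hs_mult_def)
  have "\<forall>\<^sub>F k in sequentially. real k \<le> poly p (real k) \<and> poly p (real k) \<le> 2 * real k"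
    using ev
  proof eventually_elim
    case (elim k)
    then obtain l where "slen P (W k) = enat l" "real l = poly p (real k)" by blast
    moreover from this(1) have "k \<le> l" "l \<le> 2 * k" using lower[of k] upper[of k] by auto
    ultimately show ?case by (metis of_nat_le_iff of_nat_mult of_nat_numeral)
  qed
  from poly_linear_bounds[OF this] 3 show False by simp
qed

section \<open>Smooth curves on the surfaces\<close>

definition mm :: "'a::comm_ring_1 ps3 set" where "mm = {f. ps_coeff f 0 0 0 = 0}"

lemma in_mm_iff: "f \<in> mm \<longleftrightarrow> ps_coeff f 0 0 0 = 0"
  by (simp add: mm_def)

lemma mm_eq_wt: "mm = wt 1 1 1 1"
  by (auto simp: wt_def in_mm_iff)

lemma tideal_wt: "tideal (wt p q r k)"
  by (auto simp: tideal_def wt_add wt_mult_left)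

lemma tideal_mm: "tideal mm"
  unfolding mm_eq_wt by (rule tideal_wt)

lemma ps_decompose_ex:
  fixes f :: "'a::comm_ring_1 ps3"
  shows "\<exists>a b c. f = ps_const (ps_coeff f 0 0 0) + ps_X * a + ps_Y * b + ps_Z * c"
  using ps_decompose[of f] by metis

lemma ps_unit:
  fixes f :: "'a::field ps3"
  assumes "f \<notin> mm" obtains g where "f * g = 1"
proof -
  have "fps_nth (fps_nth (fps_nth f 0) 0) 0 * inverse (fps_nth (fps_nth (fps_nth f 0) 0) 0) = 1"
    using assms by (simp add: in_mm_iff ps_coeff_def)
  then obtain c where "fps_nth (fps_nth f 0) 0 * c = 1" using fps_right_inverse by metis
  then obtain b where "fps_nth f 0 * b = 1" using fps_right_inverse by metis
  then obtain g where "f * g = 1" using fps_right_inverse by metis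
  with that show thesis .
qed

lemma proper_in_mm:
  fixes P :: "'a::field ps3 set"
  assumes "tideal P" "1 \<notin> P" "f \<in> P" shows "f \<in> mm"
  using assms by (metis ps_unit tideal_mult_right)

lemma gens_in_mm:
  "(ps_X :: 'a::comm_ring_1 ps3) \<in> mm" "(ps_Y :: 'a ps3) \<in> mm" "(ps_Z :: 'a ps3) \<in> mm"
  by (simp_all add: in_mm_iff ps_coeff_def ps_X_def ps_Y_def ps_Z_def)

lemma tprime_mm: "tprime (mm :: 'a::idom ps3 set)"
  by (auto simp: tprime_def tideal_mm in_mm_iff ps_coeff_1 ps_coeff_mult)

text \<open>\<open>t\<close> is one of \<open>X\<close>, \<open>Y\<close> and \<open>y\<close> is the other one; \<open>\<iota>\<close> is the inclusion of \<open>K[[t]]\<close>.\<close>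

locale curve_param =
  fixes t y :: "'a::field ps3" and \<iota> :: "'a fps \<Rightarrow> 'a ps3"
  assumes t_mm: "t \<in> mm" and hom: "rhom \<iota>" and \<iota>_X: "\<iota> fps_X = t" and \<iota>_const: "\<iota> (fps_const c) = ps_const c"
    and \<iota>_nth: "l > 0 \<Longrightarrow> fps_nth (\<iota> g) l = 0" and y_nth: "l > 0 \<Longrightarrow> fps_nth y l = 0"
    and y_range: "y \<notin> range \<iota>"
    and decompose: "\<exists>a b c. f = ps_const (ps_coeff f 0 0 0) + t * a + y * b + ps_Z * c"
    and XY: "(t = ps_X \<and> y = ps_Y) \<or> (t = ps_Y \<and> y = ps_X)"
begin

lemma \<iota>_shift: "\<iota> g = ps_const (fps_nth g 0) + t * \<iota> (fps_shift 1 g)"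
proof -
  have "g = fps_const (fps_nth g 0) + fps_X * fps_shift 1 g"
    by (intro fps_ext) auto
  then have "\<iota> g = \<iota> (fps_const (fps_nth g 0) + fps_X * fps_shift 1 g)" by simp
  then show ?thesis by (simp only: rhom_add[OF hom] rhom_mult[OF hom] \<iota>_X \<iota>_const)
qed

lemma \<iota>_in_mm: "\<iota> g \<in> mm \<longleftrightarrow> fps_nth g 0 = 0"
  using tideal_mult_right[OF tideal_mm t_mm, of "\<iota> (fps_shift 1 g)"]
  by (subst \<iota>_shift) (simp add: in_mm_iff ps_coeff_const)

lemma \<iota>_expand: "\<iota> g = (\<Sum>n<k. t ^ n * ps_const (fps_nth g n)) + t ^ k * \<iota> (fps_shift k g)"
proof (induction k)
  case (Suc k)
  have "\<iota> (fps_shift k g) = ps_const (fps_nth g k) + t * \<iota> (fps_shift (Suc k) g)"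
  proof -
    have "fps_shift 1 (fps_shift k g) = fps_shift (Suc k) g" by (intro fps_ext) simp
    with \<iota>_shift[of "fps_shift k g"] show ?thesis by simp
  qed
  with Suc show ?case by (simp add: algebra_simps)
qed simp

text \<open>Replacing y by t \<beta> and Z by t \<alpha> in the decomposition gives f = constant + t
  (N f) modulo the two elements. Iterating \<open>N\<close> produces the coefficients of
  \<open>g\<close>, and the quotients converge because the n-th contribution carries t^n. Here
  \<alpha> and \<beta> may involve all variables.\<close>

lemma division:
  "\<exists>g a b. f = \<iota> g + (ps_Z - t * \<alpha>) * a + (y - t * \<beta>) * b"
proof -
  obtain A B C where ABC: "\<And>f. f = ps_const (ps_coeff f 0 0 0) + t * A f + y * B f + ps_Z * C f"
    using decompose by metis
  define N where "N f = A f + \<beta> * B f + \<alpha> * C f" for f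
  define fn where "fn n = (N ^^ n) f" for n
  let ?u = "ps_Z - t * \<alpha>" and ?v = "y - t * \<beta>"
  define cn where "cn n = ps_coeff (fn n) 0 0 0" for n
  have fn_Suc: "fn n = ps_const (cn n) + t * fn (Suc n) + ?v * B (fn n) + ?u * C (fn n)" for n
    using ABC[of "fn n"] by (simp add: fn_def N_def cn_def algebra_simps)
  have tn: "t ^ n * h \<in> wt 1 1 1 n" for n h
    using wt_mult_right[OF wt_power[OF t_mm[unfolded mm_eq_wt], of n], of h] by simp
  obtain b where b: "\<And>k. b - (\<Sum>n<k. t ^ n * B (fn n)) \<in> wt 1 1 1 k"
    using ps_complete[of "\<lambda>n. t ^ n * B (fn n)"] tn by blast
  obtain c where c: "\<And>k. c - (\<Sum>n<k. t ^ n * C (fn n)) \<in> wt 1 1 1 k"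
    using ps_complete[of "\<lambda>n. t ^ n * C (fn n)"] tn by blast
  define g where "g = Abs_fps cn"
  have f: "f = (\<Sum>n<k. t ^ n * ps_const (cn n)) + ?v * (\<Sum>n<k. t ^ n * B (fn n))
      + ?u * (\<Sum>n<k. t ^ n * C (fn n)) + t ^ k * fn k" for k
  proof (induction k)
    case 0 then show ?case by (simp add: fn_def)
  next
    case (Suc k)
    have "t ^ k * fn k = t ^ k * ps_const (cn k) + t ^ Suc k * fn (Suc k) + ?v * (t ^ k * B (fn k))
        + ?u * (t ^ k * C (fn k))"
      using arg_cong[OF fn_Suc[of k], of "\<lambda>x. t ^ k * x"] by (simp add: algebra_simps)
    from Suc[unfolded this] show ?case by (simp add: algebra_simps)
  qed
  have "f - (\<iota> g + ?u * c + ?v * b) \<in> wt 1 1 1 k" for k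
  proof -
    have "f - (\<iota> g + ?u * c + ?v * b) = t ^ k * fn k - t ^ k * \<iota> (fps_shift k g)
       - ?v * (b - (\<Sum>n<k. t ^ n * B (fn n))) - ?u * (c - (\<Sum>n<k. t ^ n * C (fn n)))"
      using f[of k] \<iota>_expand[of g k] by (simp add: g_def algebra_simps)
    also have "\<dots> \<in> wt 1 1 1 k" by (intro wt_diff tn wt_mult_left b c)
    finally show ?thesis .
  qed
  then have "f - (\<iota> g + ?u * c + ?v * b) = 0" using wt_all_eq_0[of _ 1] by blast
  then have "f = \<iota> g + ?u * c + ?v * b" by (simp add: algebra_simps)
  then show ?thesis by blast
qed

context
  fixes P assumes prime: "tprime P" and tP: "t \<notin> P"
begin

text \<open>A nonzero \<open>g\<close> is a power of the variable times a unit, and neither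
  \<open>t\<close> nor a unit lies in \<open>P\<close>.\<close>

lemma \<iota>_in_P: "\<iota> g \<in> P \<longleftrightarrow> g = 0"
proof
  assume *: "\<iota> g \<in> P"
  show "g = 0"
  proof (rule ccontr)
    assume "g \<noteq> 0"
    define n where "n = subdegree g"
    have "g = fps_shift n g * fps_X ^ n" by (simp add: n_def subdegree_decompose[symmetric])
    then have "\<iota> g = \<iota> (fps_shift n g) * t ^ n"
      using rhom_mult[OF hom] rhom_power[OF hom] \<iota>_X by metis
    moreover have "fps_nth (fps_shift n g) 0 \<noteq> 0" using \<open>g \<noteq> 0\<close> by (simp add: n_def)
    then have "\<iota> (fps_shift n g) \<notin> P"
      using \<iota>_in_mm proper_in_mm[OF tprime_tideal[OF prime] tprime_1[OF prime]] by blast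
    ultimately show False using * tP prime tprime_mult_iff tprime_power by metis
  qed
qed (use tideal_0[OF tprime_tideal[OF prime]] rhom_0[OF hom] in simp)

text \<open>Dividing Z and y themselves replaces the coefficients \<open>\<alpha>\<^sub>0\<close>,
  \<open>\<beta>\<^sub>0\<close> by series in \<open>t\<close> alone. Division by the new elements
  leaves for a member of \<open>P\<close> a remainder in K[[t]] that lies in \<open>P\<close>, hence
  zero.\<close>

lemma generators:
  assumes "ps_Z - t * \<alpha>\<^sub>0 \<in> P" "y - t * \<beta>\<^sub>0 \<in> P"
  obtains \<alpha> \<beta> where "ps_Z - \<iota> \<alpha> \<in> P" "y - \<iota> \<beta> \<in> P"
    "\<And>p. p \<in> P \<Longrightarrow> \<exists>a b. p = (ps_Z - \<iota> \<alpha>) * a + (y - \<iota> \<beta>) * b"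
proof -
  note id = tprime_tideal[OF prime]
  \<comment> \<open>Divisibility of \<iota> g by \<open>t\<close> is recorded because
    \<open>division\<close> requires divisors of the form Z - t \<alpha> and y - t \<beta>.\<close>
  have *: "\<exists>g. f - \<iota> g \<in> P \<and> (f \<in> mm \<longrightarrow> (\<exists>h. \<iota> g = t * h))" for f
  proof -
    obtain g a b where f: "f = \<iota> g + (ps_Z - t * \<alpha>\<^sub>0) * a + (y - t * \<beta>\<^sub>0) * b" using division by blast
    then have "f - \<iota> g = (ps_Z - t * \<alpha>\<^sub>0) * a + (y - t * \<beta>\<^sub>0) * b" by (simp add: algebra_simps)
    then have fg: "f - \<iota> g \<in> P"
      using tideal_add[OF id tideal_mult_right[OF id assms(1), of a] tideal_mult_right[OF id assms(2), of b]] by simp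
    moreover have "\<exists>h. \<iota> g = t * h" if "f \<in> mm"
    proof -
      have "f - \<iota> g \<in> mm" using proper_in_mm[OF id tprime_1[OF prime]] fg by blast
      then have "\<iota> g \<in> mm" using that tideal_cong[OF tideal_mm] by blast
      then have "ps_const (fps_nth g 0) = 0" by (simp add: \<iota>_in_mm ps_const_def)
      then show ?thesis using \<iota>_shift[of g] by auto
    qed
    ultimately show ?thesis by blast
  qed
  have y_mm: "y \<in> mm" using XY gens_in_mm by auto
  obtain \<alpha> \<alpha>' where \<alpha>: "ps_Z - \<iota> \<alpha> \<in> P" "\<iota> \<alpha> = t * \<alpha>'" using *[of ps_Z] gens_in_mm by blast
  obtain \<beta> \<beta>' where \<beta>: "y - \<iota> \<beta> \<in> P" "\<iota> \<beta> = t * \<beta>'" using *[of y] y_mm by blast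
  have "\<exists>a b. p = (ps_Z - \<iota> \<alpha>) * a + (y - \<iota> \<beta>) * b" if p: "p \<in> P" for p
  proof -
    obtain g a b where f: "p = \<iota> g + (ps_Z - \<iota> \<alpha>) * a + (y - \<iota> \<beta>) * b"
      using division[of p \<alpha>' \<beta>'] \<alpha>(2) \<beta>(2) by auto
    then have "\<iota> g = p - (ps_Z - \<iota> \<alpha>) * a - (y - \<iota> \<beta>) * b" by (simp add: algebra_simps)
    then have "\<iota> g \<in> P" using p \<alpha>(1) \<beta>(1)
      by (simp add: tideal_diff[OF id] tideal_mult_right[OF id])
    then have "\<iota> g = 0" using \<iota>_in_P rhom_0[OF hom] by auto
    with f show ?thesis by auto
  qed
  with \<alpha> \<beta> that show thesis by blast
qed

text \<open>Expanding the equation at \<open>u = Z - \<alpha>(t)\<close>, \<open>v = y - \<beta>(t)\<close> gives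
  \<open>F = u^2 (3 \<alpha> + u) + (B + v q) u + v C\<close> with \<open>B\<close> in \<open>K[[t]]\<close>, and it remains to see which
  coefficient is a unit at \<open>P\<close>.\<close>

lemma square_relation:
  assumes F: "cubic m r \<in> P" and r: "r \<le> 2" and m: "m \<ge> 3" and three: "(3 :: 'a) \<noteq> 0"
    and Z: "ps_Z - t * \<alpha>\<^sub>0 \<in> P" and y: "y - t * \<beta>\<^sub>0 \<in> P"
  shows "\<exists>u v w q s b. u \<in> P \<and> v \<in> P \<and> w \<in> P \<and> s \<notin> P \<and> b \<in> P \<and>
    (\<forall>p\<in>P. \<exists>a c. p = u * a + v * c) \<and> s * u\<^sup>2 = v * w + cubic m r * q \<and>
    (\<forall>k f. cubic m r dvd b ^ k * f \<longrightarrow> cubic m r dvd f)"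
proof -
  note id = tprime_tideal[OF prime]
  let ?F = "cubic m r :: 'a ps3"
  obtain \<alpha> \<beta> where u: "ps_Z - \<iota> \<alpha> \<in> P" and v: "y - \<iota> \<beta> \<in> P"
    and gen: "\<And>p. p \<in> P \<Longrightarrow> \<exists>a b. p = (ps_Z - \<iota> \<alpha>) * a + (y - \<iota> \<beta>) * b"
    using generators[OF Z y] by blast
  define u where "u = ps_Z - \<iota> \<alpha>"
  define v where "v = y - \<iota> \<beta>"
  note uP = u[folded u_def] and vP = v[folded v_def]
  have v0: "v \<noteq> 0" using y_range by (auto simp: v_def)
  have "fps_nth (v ^ k) l = 0" if "l > 0" for k l
  proof -
    have "v = fps_const (fps_nth v 0)" using y_nth \<iota>_nth by (intro fps_ext) (auto simp: v_def)
    then have "v ^ k = fps_const (fps_nth v 0 ^ k)" by (metis fps_const_power)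
    then show ?thesis using that by simp
  qed
  then have nzd: "\<forall>k f. ?F dvd v ^ k * f \<longrightarrow> ?F dvd f"
    using cubic_dvd_cancel[of "v ^ _" m r] v0 m by (metis power_not_zero)
  have gen1: "\<forall>p\<in>P. \<exists>a c. p = u * a + v * c" using gen by (auto simp: u_def v_def)
  have gen2: "\<forall>p\<in>P. \<exists>a c. p = v * a + u * c"
    using gen1 by (metis add.commute)
  \<comment> \<open>Both choices of \<open>t\<close> are treated together by writing X and Y as
    their restrictions to the curve plus multiples of \<open>v\<close>. The restriction of X
    vanishes only if t = Y and the curve lies in X = 0.\<close>
  obtain X0 Y0 \<xi> \<eta> where XY0: "ps_X = \<iota> X0 + v * \<xi>" "ps_Y = \<iota> Y0 + v * \<eta>" "X0 = 0 \<longrightarrow> v = ps_X \<and> t = ps_Y \<and> Y0 = fps_X"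
    using XY
  proof (elim disjE conjE)
    assume "t = ps_X" "y = ps_Y"
    then show thesis using that[of fps_X 0 \<beta> 1] by (simp add: \<iota>_X v_def)
  next
    assume "t = ps_Y" "y = ps_X"
    then show thesis using that[of \<beta> 1 fps_X 0] by (simp add: \<iota>_X v_def rhom_0[OF hom])
  qed
  have pow: "\<exists>q. (c + v * d) ^ n = c ^ n + v * q" for c d :: "'a ps3" and n
  proof -
    have "(c + v * d) - c dvd (c + v * d) ^ n - c ^ n" unfolding power_diff_sumr2 by (rule dvd_triv_left)
    then have "v dvd (c + v * d) ^ n - c ^ n" by (simp add: dvd_mult_left)
    then obtain q where "(c + v * d) ^ n - c ^ n = v * q" by (auto simp: dvd_def)
    then have "(c + v * d) ^ n = c ^ n + v * q" by (simp add: algebra_simps)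
    then show ?thesis by blast
  qed
  obtain q1 where q1: "ps_X ^ m = \<iota> (X0 ^ m) + v * q1"
    using pow[of "\<iota> X0" \<xi> m] by (auto simp: XY0 rhom_power[OF hom])
  obtain q2 where q2: "ps_X ^ r = \<iota> (X0 ^ r) + v * q2"
    using pow[of "\<iota> X0" \<xi> r] by (auto simp: XY0 rhom_power[OF hom])
  obtain q3 where q3: "ps_Y ^ 4 = \<iota> (Y0 ^ 4) + v * q3"
    using pow[of "\<iota> Y0" \<eta> 4] by (auto simp: XY0 rhom_power[OF hom])
  define B where "B = 3 * \<alpha>\<^sup>2 + X0 ^ m"
  define C0 where "C0 = \<alpha> ^ 3 + X0 ^ m * \<alpha> + X0 ^ r * Y0 ^ 4"
  define C1 where "C1 = q1 * \<iota> \<alpha> + \<iota> (X0 ^ r) * q3 + q2 * ps_Y ^ 4"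
  have \<iota>3: "\<iota> 3 = 3" using rhom_add[OF hom, of 1 2] rhom_add[OF hom, of 1 1] rhom_1[OF hom] by simp
  have C: "\<iota> \<alpha> ^ 3 + ps_X ^ m * \<iota> \<alpha> + ps_X ^ r * ps_Y ^ 4 = \<iota> C0 + v * C1"
    by (simp add: C0_def C1_def rhom_simps[OF hom] q1 q2 q3 algebra_simps)
  have FC: "?F = u\<^sup>2 * (3 * \<iota> \<alpha> + u) + (3 * \<iota> \<alpha> ^ 2 + ps_X ^ m) * u + (\<iota> \<alpha> ^ 3 + ps_X ^ m * \<iota> \<alpha> + ps_X ^ r * ps_Y ^ 4)"
  proof -
    have Z: "ps_Z = u + \<iota> \<alpha>" by (simp add: u_def)
    show ?thesis unfolding cubic_def Z by (simp add: power2_eq_square power3_eq_cube algebra_simps)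
  qed
  then have F0: "?F = u\<^sup>2 * (3 * \<iota> \<alpha> + u) + (\<iota> B + v * q1) * u + (\<iota> C0 + v * C1)"
    unfolding C by (simp add: B_def rhom_simps[OF hom] \<iota>3 q1 algebra_simps)
  \<comment> \<open>The constant term of the expansion is the equation restricted to the curve, and
    the curve lies on the surface.\<close>
  have "\<iota> C0 = ?F - (u * (u * (3 * \<iota> \<alpha> + u) + \<iota> B + v * q1) + v * C1)"
    by (simp add: F0 power2_eq_square algebra_simps)
  also have "\<dots> \<in> P"
    by (intro tideal_diff[OF id] F tideal_add[OF id] tideal_mult_right[OF id] uP vP)
  finally have C0: "C0 = 0" by (simp add: \<iota>_in_P)
  have F1: "?F = u\<^sup>2 * (3 * \<iota> \<alpha> + u) + (\<iota> B + v * q1) * u + v * C1"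
    by (simp add: F0 C0 rhom_0[OF hom])
  have result: ?thesis if "w \<in> P" "s \<notin> P" "s * u\<^sup>2 = v * w + ?F * q" for w s q
    using that uP vP gen1 nzd by blast
  have result': ?thesis if "w \<in> P" "s \<notin> P" "s * v\<^sup>2 = u * w + ?F * q" for w s q
    using that uP vP gen2 nzd by blast
  show ?thesis
  proof (cases "B = 0")
    case False
    \<comment> \<open>The linear coefficient is a unit at \<open>P\<close>: multiplying the equation
      by \<open>u\<close> isolates u^2 as a multiple of v u.\<close>
    let ?s = "\<iota> B + (u * (3 * \<iota> \<alpha> + u) + v * q1)"
    show ?thesis
    proof (rule result)
      show "?s * u\<^sup>2 = v * (- (u * C1)) + ?F * u"
        by (simp add: F1 power2_eq_square algebra_simps)
      show "- (u * C1) \<in> P" by (intro tideal_minus[OF id] tideal_mult_right[OF id] uP)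
      have "u * (3 * \<iota> \<alpha> + u) + v * q1 \<in> P"
        by (intro tideal_add[OF id] tideal_mult_right[OF id] uP vP)
      moreover have "\<iota> B \<notin> P" using False by (simp add: \<iota>_in_P)
      ultimately show "?s \<notin> P" using tideal_cong[OF id, of ?s "\<iota> B"] by simp
    qed
  next
    case True
    have F2: "?F = u\<^sup>2 * (3 * \<iota> \<alpha> + u) + v * (q1 * u + C1)"
      by (simp add: F1 True rhom_0[OF hom] algebra_simps)
    show ?thesis
    proof (cases "C1 \<in> P")
      \<comment> \<open>Now the coefficient of \<open>v\<close> is a unit at \<open>P\<close>, so
        the equation is multiplied by \<open>v\<close> and the two generators exchange their
        roles.\<close>
      case False
      show ?thesis
      proof (rule result')
        show "C1 * v\<^sup>2 = u * (- (v * (u * (3 * \<iota> \<alpha> + u) + v * q1))) + ?F * v"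
          by (simp add: F2 power2_eq_square algebra_simps)
        show "- (v * (u * (3 * \<iota> \<alpha> + u) + v * q1)) \<in> P"
          by (intro tideal_minus[OF id] tideal_mult_right[OF id] vP)
      qed (rule False)
    next
      case C1: True
      show ?thesis
      proof (cases "\<alpha> = 0")
        \<comment> \<open>This is where the characteristic enters: the coefficient 3 \<alpha> + u of
          u^2 is a unit at \<open>P\<close>.\<close>
        case False
        have "3 * \<alpha> \<noteq> 0" using three False
          by (simp add: numeral_fps_const)
        show ?thesis
        proof (rule result)
          show "(3 * \<iota> \<alpha> + u) * u\<^sup>2 = v * (- (q1 * u + C1)) + ?F * 1"
            by (simp add: F2 power2_eq_square algebra_simps)
          show "- (q1 * u + C1) \<in> P"
            by (intro tideal_minus[OF id] tideal_add[OF id] tideal_mult[OF id] uP C1)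
          have "3 * \<iota> \<alpha> \<notin> P" using \<open>3 * \<alpha> \<noteq> 0\<close> \<iota>_in_P[of "3 * \<alpha>"]
            by (simp add: rhom_mult[OF hom] \<iota>3)
          then show "3 * \<iota> \<alpha> + u \<notin> P" using tideal_cong[OF id, of "3 * \<iota> \<alpha> + u" "3 * \<iota> \<alpha>"] uP by simp
        qed
      next
        case \<alpha>0: True
        \<comment> \<open>The curve is now X = Z = 0. It does not lie on the surface for r = 0, the
          coefficient of \<open>v\<close> is the unit Y^4 for r = 1, and for r = 2 the equation
          itself presents Y^4 X^2 as a multiple of Z.\<close>
        then have "X0 = 0" using True m by (simp add: B_def)
        then have vX: "v = ps_X" and tY: "t = ps_Y" and Y0: "Y0 = fps_X" using XY0(3) by auto
        have uZ: "u = ps_Z" by (simp add: u_def \<alpha>0 rhom_0[OF hom])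
        have Yk: "ps_Y ^ 4 \<notin> P" using tP tprime_power[OF prime] tY by blast
        have Xr: "ps_X ^ r * ps_Y ^ 4 = v * C1"
          using C by (simp add: \<alpha>0 C0 rhom_0[OF hom])
        consider "r = 0" | "r = 1" | "r = 2" using r by linarith
        then show ?thesis
        proof cases
          case 1
          then have "C0 \<noteq> 0" by (simp add: C0_def \<alpha>0 Y0)
          with C0 show ?thesis by simp
        next
          case 2
          then have "C1 = ps_Y ^ 4" using Xr v0 by (simp add: vX)
          with C1 Yk show ?thesis by simp
        next
          case 3
          show ?thesis
          proof (rule result')
            show "ps_Y ^ 4 * v\<^sup>2 = u * (- (u * u + v * ps_X ^ (m - 1))) + ?F * 1"
              using m power_minus_mult[of m "ps_X :: 'a ps3"]
              by (simp add: cubic_def vX uZ 3 power3_eq_cube power2_eq_square algebra_simps)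
            show "- (u * u + v * ps_X ^ (m - 1)) \<in> P"
              by (intro tideal_minus[OF id] tideal_add[OF id] tideal_mult_right[OF id] uP vP)
          qed (rule Yk)
        qed
      qed
    qed
  qed
qed

end

end

lemma curve_param_X: "curve_param (ps_X :: 'a::field ps3) ps_Y (fps_const \<circ> fps_const)"
proof
  show "(ps_X :: 'a ps3) \<in> mm" by (rule gens_in_mm)
  show "rhom (fps_const \<circ> fps_const :: 'a fps \<Rightarrow> 'a ps3)" by (intro rhom_comp rhom_fps_const)
  show "(ps_Y :: 'a ps3) \<notin> range (fps_const \<circ> fps_const)"
  proof
    assume "(ps_Y :: 'a ps3) \<in> range (fps_const \<circ> fps_const)"
    then obtain g where "(ps_Y :: 'a ps3) = fps_const (fps_const g)" by auto
    then have "fps_nth (fps_nth (ps_Y :: 'a ps3) 0) 1 = fps_nth (fps_nth (fps_const (fps_const g)) 0) 1"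
      by (rule arg_cong)
    then show False by (simp add: ps_Y_def)
  qed
  show "\<exists>a b c. f = ps_const (ps_coeff f 0 0 0) + ps_X * a + ps_Y * b + ps_Z * c" for f :: "'a ps3"
    by (rule ps_decompose_ex)
qed (simp_all add: ps_X_def ps_const_def ps_Y_def)

lemma curve_param_Y: "curve_param (ps_Y :: 'a::field ps3) ps_X (fps_const \<circ> fmap fps_const)"
proof
  show "(ps_Y :: 'a ps3) \<in> mm" by (rule gens_in_mm)
  show "rhom (fps_const \<circ> fmap fps_const :: 'a fps \<Rightarrow> 'a ps3)"
    by (intro rhom_comp rhom_fps_const rhom_fmap)
  show "(fps_const \<circ> fmap fps_const) (fps_X :: 'a fps) = ps_Y"
    by (auto simp: ps_Y_def fps_eq_iff)
  show "(ps_X :: 'a ps3) \<notin> range (fps_const \<circ> fmap fps_const)"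
  proof
    assume "(ps_X :: 'a ps3) \<in> range (fps_const \<circ> fmap fps_const)"
    then obtain g where "(ps_X :: 'a ps3) = fps_const (fmap fps_const g)" by auto
    then have "fps_nth (fps_nth (fps_nth (ps_X :: 'a ps3) 0) 0) 1 =
        fps_nth (fps_nth (fps_nth (fps_const (fmap fps_const g)) 0) 0) 1"
      by (rule arg_cong)
    then show False by (simp add: ps_X_def)
  qed
  show "\<exists>a b c. f = ps_const (ps_coeff f 0 0 0) + ps_Y * a + ps_X * b + ps_Z * c" for f :: "'a ps3"
  proof -
    obtain a b c where "f = ps_const (ps_coeff f 0 0 0) + ps_X * a + ps_Y * b + ps_Z * c"
      using ps_decompose_ex[of f] by blast
    also have "\<dots> = ps_const (ps_coeff f 0 0 0) + ps_Y * b + ps_X * a + ps_Z * c"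
      by (simp only: add.assoc add.left_commute)
    finally show ?thesis by blast
  qed
qed (simp_all add: ps_X_def ps_const_def ps_Y_def fmap_const)

text \<open>\<open>S/P\<close> is a discrete valuation ring with uniformizer \<open>p\<close>.  As \<open>Z^3\<close> lies in \<open>p^4 S + P\<close>, one of
  \<open>X\<close>, \<open>Y\<close> is a uniformizer as well.\<close>

theorem smooth_curve_square_relation:
  fixes P :: "'a::field ps3 set"
  assumes prime: "tprime P" and F: "cubic m r \<in> P" and r: "r \<le> 2" and m: "m \<ge> 3"
    and three: "(3 :: 'a) \<noteq> 0"
    and p: "p \<in> mm" "\<And>f. f \<in> mm \<Longrightarrow> \<exists>a. f - p * a \<in> P" and nP: "\<not> mm \<subseteq> P"
  shows "\<exists>u v w q s b. u \<in> P \<and> v \<in> P \<and> w \<in> P \<and> s \<notin> P \<and> b \<in> P \<and>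
    (\<forall>p\<in>P. \<exists>a c. p = u * a + v * c) \<and> s * u\<^sup>2 = v * w + cubic m r * q \<and>
    (\<forall>k f. cubic m r dvd b ^ k * f \<longrightarrow> cubic m r dvd f)"
proof -
  note id = tprime_tideal[OF prime]
  note P_mm = proper_in_mm[OF id tprime_1[OF prime]]
  have pP: "p \<notin> P"
  proof
    assume "p \<in> P"
    have "f \<in> P" if "f \<in> mm" for f
    proof -
      obtain a where "f - p * a \<in> P" using p(2)[OF \<open>f \<in> mm\<close>] by blast
      then show ?thesis using tideal_cong[OF id] tideal_mult_right[OF id \<open>p \<in> P\<close>] by blast
    qed
    then show False using nP by blast
  qed
  obtain x1 where x1: "ps_X - p * x1 \<in> P" using p(2)[OF gens_in_mm(1)] by blast
  obtain y1 where y1: "ps_Y - p * y1 \<in> P" using p(2)[OF gens_in_mm(2)] by blast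
  obtain z1 where z1: "ps_Z - p * z1 \<in> P" using p(2)[OF gens_in_mm(3)] by blast
  have pow: "a ^ n - b ^ n \<in> P" if "a - b \<in> P" for a b n
    using tideal_mult_right[OF id that] power_diff_sumr2[of a n b] by simp
  have mult: "a * c - b * d \<in> P" if "a - b \<in> P" "c - d \<in> P" for a b c d
  proof -
    have "a * c - b * d = (a - b) * c + b * (c - d)" by (simp add: algebra_simps)
    then show ?thesis using tideal_add[OF id tideal_mult_right[OF id that(1)] tideal_mult[OF id that(2)]] by simp
  qed
  have z1_mm: "z1 \<in> mm"
  proof -
    let ?F1 = "(p * z1) ^ 3 + (p * x1) ^ m * (p * z1) + (p * x1) ^ r * (p * y1) ^ 4"
    have "cubic m r - ?F1 = (ps_Z ^ 3 - (p * z1) ^ 3) + (ps_X ^ m * ps_Z - (p * x1) ^ m * (p * z1))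
       + (ps_X ^ r * ps_Y ^ 4 - (p * x1) ^ r * (p * y1) ^ 4)"
      by (simp add: cubic_def)
    also have "\<dots> \<in> P" by (intro tideal_add[OF id] mult pow x1 y1 z1)
    finally have "?F1 \<in> P" using F tideal_cong[OF id] by blast
    moreover obtain m' where m': "m = m' + 3" using m by (metis add.commute le_Suc_ex)
    have "?F1 = p ^ 3 * (z1 ^ 3 + p * (p ^ m' * x1 ^ m * z1 + (p * x1) ^ r * y1 ^ 4))"
      by (simp add: m' power_mult_distrib power_add algebra_simps power2_eq_square power3_eq_cube eval_nat_numeral)
    ultimately have "z1 ^ 3 + p * (p ^ m' * x1 ^ m * z1 + (p * x1) ^ r * y1 ^ 4) \<in> P"
      using pP tprime_power[OF prime] tprime_mult_iff[OF prime] by metis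
    then have "z1 ^ 3 \<in> mm"
      using P_mm tideal_mult_right[OF tideal_mm p(1)] tideal_cong[OF tideal_mm]
      by (metis add_diff_cancel_left')
    then show ?thesis using tprime_power[OF tprime_mm] by blast
  qed
  obtain a b c where "p = ps_const (ps_coeff p 0 0 0) + ps_X * a + ps_Y * b + ps_Z * c"
    using ps_decompose_ex[of p] by blast
  then have pabc: "p = ps_X * a + ps_Y * b + ps_Z * c" using p(1) by (simp add: in_mm_iff ps_const_def)
  \<comment> \<open>Writing p in the three coordinates and dividing by p modulo \<open>P\<close>
    yields 1 = x1 a + y1 b + z1 c. Since z1 is no unit, x1 or y1 must be one.\<close>
  have "p * (1 - (x1 * a + y1 * b + z1 * c)) = p - p * (x1 * a + y1 * b + z1 * c)"
    by (simp add: algebra_simps)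
  also have "\<dots> = (ps_X * a + ps_Y * b + ps_Z * c) - p * (x1 * a + y1 * b + z1 * c)"
    by (simp only: pabc[symmetric])
  also have "\<dots> = (ps_X - p * x1) * a + (ps_Y - p * y1) * b + (ps_Z - p * z1) * c"
    by (simp add: algebra_simps)
  also have "\<dots> \<in> P" by (intro tideal_add[OF id] tideal_mult_right[OF id] x1 y1 z1)
  finally have "1 - (x1 * a + y1 * b + z1 * c) \<in> P" using pP tprime_mult_iff[OF prime] by blast
  then have one: "1 - (x1 * a + y1 * b + z1 * c) \<in> mm" by (rule P_mm)
  have "x1 \<notin> mm \<or> y1 \<notin> mm"
  proof (rule ccontr)
    assume "\<not> (x1 \<notin> mm \<or> y1 \<notin> mm)"
    then have "x1 * a + y1 * b + z1 * c \<in> mm"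
      using z1_mm by (intro tideal_add[OF tideal_mm] tideal_mult_right[OF tideal_mm]) auto
    then show False using one tideal_cong[OF tideal_mm] tprime_1[OF tprime_mm] by blast
  qed
  have div: "\<exists>d. f - t * d \<in> P" if "t - p * t1 \<in> P" "t1 \<notin> mm" "f \<in> mm" for t t1 f
  proof -
    obtain s where s: "t1 * s = 1" using ps_unit[OF \<open>t1 \<notin> mm\<close>] .
    obtain d where d: "f - p * d \<in> P" using p(2)[OF \<open>f \<in> mm\<close>] by blast
    have "f - t * (s * d) = (f - p * d) - (t - p * t1) * (s * d) + p * d * (1 - t1 * s)"
      by (simp add: algebra_simps)
    also have "\<dots> \<in> P" using tideal_diff[OF id d tideal_mult_right[OF id that(1)]] by (simp add: s)
    finally show ?thesis by blast
  qed
  have tP: "t \<notin> P" if "t - p * t1 \<in> P" "t1 \<notin> mm" for t t1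
    using that pP P_mm tideal_cong[OF id that(1)] tprime_mult_iff[OF prime] by blast
  from \<open>x1 \<notin> mm \<or> y1 \<notin> mm\<close> show ?thesis
  proof
    assume t1: "x1 \<notin> mm"
    interpret curve_param ps_X ps_Y "fps_const \<circ> fps_const :: 'a fps \<Rightarrow> 'a ps3" by (rule curve_param_X)
    obtain \<alpha> where \<alpha>: "ps_Z - ps_X * \<alpha> \<in> P" using div[OF x1 t1 gens_in_mm(3)] by blast
    obtain \<beta> where \<beta>: "ps_Y - ps_X * \<beta> \<in> P" using div[OF x1 t1 gens_in_mm(2)] by blast
    show ?thesis by (rule square_relation[OF prime tP[OF x1 t1] F r m three \<alpha> \<beta>])
  next
    assume t1: "y1 \<notin> mm"
    interpret curve_param ps_Y ps_X "fps_const \<circ> fmap fps_const :: 'a fps \<Rightarrow> 'a ps3" by (rule curve_param_Y)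
    obtain \<alpha> where \<alpha>: "ps_Z - ps_Y * \<alpha> \<in> P" using div[OF y1 t1 gens_in_mm(3)] by blast
    obtain \<beta> where \<beta>: "ps_X - ps_Y * \<beta> \<in> P" using div[OF y1 t1 gens_in_mm(1)] by blast
    show ?thesis by (rule square_relation[OF prime tP[OF y1 t1] F r m three \<alpha> \<beta>])
  qed
qed

section \<open>The equimultiple curve \<open>X = Z = 0\<close>\<close>

text \<open>The restriction f(0, Y, 0) to the curve X = Z = 0. Its kernel is
  \<open>wt 1 0 1 1\<close>, which is therefore prime.\<close>

definition axis_part :: "'a::comm_ring_1 ps3 \<Rightarrow> 'a fps"
  where "axis_part = fmap (\<lambda>b. fps_nth b 0) \<circ> (\<lambda>f. fps_nth f 0)"

lemma axis_part_nth: "fps_nth (axis_part f) j = ps_coeff f 0 j 0"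
  by (simp add: axis_part_def ps_coeff_def)

lemma rhom_axis_part: "rhom axis_part"
  unfolding axis_part_def by (intro rhom_comp rhom_fmap rhomI) simp_all

lemma axis_part_eq_0_iff: "axis_part f = 0 \<longleftrightarrow> f \<in> wt 1 0 1 1"
  by (auto simp: fps_eq_iff axis_part_nth wt_def)

lemma tprime_axis: "tprime (wt 1 0 1 1 :: 'a::idom ps3 set)"
  unfolding tprime_def axis_part_eq_0_iff[symmetric]
  using tideal_wt by (auto simp: rhom_mult[OF rhom_axis_part] rhom_1[OF rhom_axis_part])

text \<open>Series of order at least \<open>i\<close> in \<open>X, Z\<close> whose leading form has degree less than \<open>c\<close> in \<open>Z\<close>.\<close>

definition lead :: "nat \<Rightarrow> nat \<Rightarrow> 'a::comm_ring_1 ps3 set"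
  where "lead i c = {p \<in> wt 1 0 1 i. \<forall>j l. c \<le> l \<longrightarrow> l \<le> i \<longrightarrow> ps_coeff p (i - l) j l = 0}"

text \<open>Multiplication by \<open>s\<close> affects the leading form in X and Z only through the
  restriction of \<open>s\<close> to the axis, a series in Y, so the degree in Z of the leading form
  cannot grow.\<close>

lemma tideal_lead: "tideal (lead i c :: 'a::comm_ring_1 ps3 set)"
  unfolding tideal_def
proof (intro conjI ballI allI)
  fix p s :: "'a ps3" assume p: "p \<in> lead i c"
  then have pi: "p \<in> wt 1 0 1 i" by (simp add: lead_def)
  have "ps_coeff (s * p) (i - l) j l = 0" if l: "c \<le> l" "l \<le> i" for j l
    unfolding ps_coeff_mult
  proof (intro sum.neutral ballI)
    fix l' j' i' assume *: "l' \<in> {..l}" "j' \<in> {..j}" "i' \<in> {..i-l}"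
    show "ps_coeff s i' j' l' * ps_coeff p (i - l - i') (j - j') (l - l') = 0"
    proof (cases "i' = 0 \<and> l' = 0")
      case True
      then show ?thesis using p l by (simp add: lead_def)
    next
      case False
      then have "ps_coeff p (i - l - i') (j - j') (l - l') = 0"
        using * l by (intro wtD[OF pi]) auto
      then show ?thesis by simp
    qed
  qed
  then show "s * p \<in> lead i c" using wt_mult_left[OF pi] by (simp add: lead_def)
qed (auto simp: lead_def wt_add)

lemma lead_0: "lead i 0 = (wt 1 0 1 (Suc i) :: 'a::comm_ring_1 ps3 set)"
proof -
  have "ps_coeff p a j l = 0" if "p \<in> lead i 0" "a + l < Suc i" for p :: "'a ps3" and a j l
  proof (cases "a + l = i")
    case True
    then have "a = i - l" "l \<le> i" by auto
    with that(1) show ?thesis by (simp add: lead_def)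
  next
    case False
    with that show ?thesis by (auto simp: lead_def intro!: wtD[of p 1 0 1 i])
  qed
  then have "lead i 0 \<subseteq> (wt 1 0 1 (Suc i) :: 'a ps3 set)" by (auto intro!: wtI)
  moreover have "wt 1 0 1 (Suc i) \<subseteq> (lead i 0 :: 'a ps3 set)"
    by (auto simp: lead_def wt_antimono[of i "Suc i"] intro!: wtD)
  ultimately show ?thesis by blast
qed

lemma lead_mono: "c \<le> c' \<Longrightarrow> lead i c \<subseteq> lead i c'"
  by (auto simp: lead_def)

lemma wt_Suc_lead: "wt 1 0 1 (Suc i) \<subseteq> lead i c"
  using lead_mono[of 0 c i] by (simp add: lead_0)

lemma wt_axis_decompose:
  fixes f :: "'a::comm_ring_1 ps3"
  assumes "f \<in> wt 1 0 1 (Suc k)"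
  obtains a c where "f = ps_X * a + ps_Z * c" "a \<in> wt 1 0 1 k" "c \<in> wt 1 0 1 k"
proof -
  define a :: "'a ps3" where "a = Abs_fps (\<lambda>l. Abs_fps (\<lambda>j. Abs_fps (\<lambda>i. if l = 0 then ps_coeff f (Suc i) j 0 else 0)))"
  define c :: "'a ps3" where "c = Abs_fps (\<lambda>l. Abs_fps (\<lambda>j. Abs_fps (\<lambda>i. ps_coeff f i j (Suc l))))"
  have a: "ps_coeff a i j l = (if l = 0 then ps_coeff f (Suc i) j 0 else 0)"
    and c: "ps_coeff c i j l = ps_coeff f i j (Suc l)" for i j l
    by (simp_all add: a_def c_def ps_coeff_def)
  have "f = ps_X * a + ps_Z * c"
    by (rule ps_eqI) (auto simp: a c intro!: wtD[OF assms])
  moreover have "a \<in> wt 1 0 1 k" "c \<in> wt 1 0 1 k"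
    by (auto intro!: wtI wtD[OF assms] simp: a c)
  ultimately show thesis using that by blast
qed

context
  fixes m :: nat assumes m: "m \<ge> 3"
begin

definition leadF :: "nat \<Rightarrow> nat \<Rightarrow> 'a::comm_ring_1 ps3 set"
  where "leadF i c = {p + cubic m 3 * q |p q. p \<in> lead i c}"

lemma tideal_leadF: "tideal (leadF i c :: 'a::comm_ring_1 ps3 set)"
  unfolding tideal_def
proof (intro conjI ballI allI)
  have "0 = 0 + cubic m 3 * (0 :: 'a ps3)" by simp
  then show "(0 :: 'a ps3) \<in> leadF i c"
    using tideal_0[OF tideal_lead] unfolding leadF_def by blast
  fix f g s :: "'a ps3" assume "f \<in> leadF i c"
  then obtain p q where f: "f = p + cubic m 3 * q" "p \<in> lead i c" by (auto simp: leadF_def)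
  have "s * f = s * p + cubic m 3 * (s * q)" by (simp add: f algebra_simps)
  then show "s * f \<in> leadF i c" using tideal_mult[OF tideal_lead f(2)] unfolding leadF_def by blast
  assume "g \<in> leadF i c"
  then obtain p' q' where g: "g = p' + cubic m 3 * q'" "p' \<in> lead i c" by (auto simp: leadF_def)
  have "f + g = (p + p') + cubic m 3 * (q + q')" by (simp add: f g algebra_simps)
  then show "f + g \<in> leadF i c" using tideal_add[OF tideal_lead f(2) g(2)] unfolding leadF_def by blast
qed

lemma leadF_mono:
  "lead i c \<subseteq> (lead i' c' :: 'a::comm_ring_1 ps3 set) \<Longrightarrow> leadF i c \<subseteq> (leadF i' c' :: 'a ps3 set)"
  unfolding leadF_def by blast

lemma leadFI: "p \<in> lead i c \<Longrightarrow> f = p + cubic m 3 * q \<Longrightarrow> f \<in> leadF i c"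
  unfolding leadF_def by blast

lemma lead_leadF: "lead i c \<subseteq> leadF i c"
  by (auto intro: leadFI[of _ _ _ _ 0])

lemma cubic_leadF: "cubic m 3 \<in> leadF i c"
  by (rule leadFI[OF tideal_0[OF tideal_lead], where q = 1]) simp

text \<open>Weierstrass division keeps the order along the axis, by \<open>nf_order\<close> with
  \<open>e = 0\<close>, and leaves degree at most two in Z.\<close>

lemma wt_leadF: "wt 1 0 1 i \<subseteq> (leadF i 3 :: 'a::comm_ring_1 ps3 set)"
proof
  fix f :: "'a ps3" assume f: "f \<in> wt 1 0 1 i"
  obtain q where q: "nf (f - cubic m 3 * q)" using weierstrass_division[OF m] .
  define p where "p = f - cubic m 3 * q"
  have "p - cubic m 3 * (- q) = f" by (simp add: p_def)
  then have "p \<in> wt 1 0 1 i"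
    using q f m by (intro nf_order[of p m 3 "- q" 0 i]) (auto simp: p_def[symmetric])
  then have "p \<in> lead i 3" using q by (auto simp: lead_def nf_iff p_def[symmetric])
  moreover have "f = p + cubic m 3 * q" by (simp add: p_def)
  ultimately show "f \<in> leadF i 3" unfolding leadF_def by blast
qed

lemma leadF_Suc: "leadF (Suc i) 3 = (leadF i 0 :: 'a::comm_ring_1 ps3 set)"
proof
  show "leadF (Suc i) 3 \<subseteq> (leadF i 0 :: 'a ps3 set)"
    by (rule leadF_mono) (auto simp: lead_0 lead_def[of "Suc i"])
  show "leadF i 0 \<subseteq> (leadF (Suc i) 3 :: 'a ps3 set)"
  proof
    fix f :: "'a ps3" assume "f \<in> leadF i 0"
    then obtain p q where f: "f = p + cubic m 3 * q" "p \<in> wt 1 0 1 (Suc i)"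
      by (auto simp: leadF_def lead_0)
    then show "f \<in> leadF (Suc i) 3"
      using wt_leadF tideal_add[OF tideal_leadF _ tideal_mult_right[OF tideal_leadF cubic_leadF]] by blast
  qed
qed

text \<open>The graded pieces correspond to the monomials \<open>X^a Z^b\<close> with \<open>b \<le> 2\<close>, ordered by \<open>a + b\<close> and
  then by decreasing \<open>b\<close>: the monomial \<open>X^a Z^b\<close> has index \<open>n = 3 (a + b) + 2 - b\<close>.\<close>

definition axis_filt :: "nat \<Rightarrow> 'a::idom ps3 set"
  where "axis_filt n = sat (wt 1 0 1 1) (leadF (n div 3) (3 - n mod 3))"

definition axis_gen :: "nat \<Rightarrow> 'a::idom ps3"
  where "axis_gen n = ps_X ^ (n div 3 - (2 - n mod 3)) * ps_Z ^ (2 - n mod 3)"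

definition axis_idx :: "nat set" where "axis_idx = {n. 2 - n mod 3 \<le> n div 3}"

lemma axis_filt_eq: "axis_filt n = sat (wt 1 0 1 1) (leadF (n div 3) (Suc (2 - n mod 3)))"
proof -
  have "3 - n mod 3 = Suc (2 - n mod 3)" by (simp add: Suc_diff_le)
  then show ?thesis by (simp add: axis_filt_def)
qed

lemma axis_filt_Suc: "axis_filt (Suc n) = sat (wt 1 0 1 1) (leadF (n div 3) (2 - n mod 3))"
proof (cases "n mod 3 = 2")
  case True
  then have "Suc n div 3 = Suc (n div 3)" "Suc n mod 3 = 0" by presburger+
  then show ?thesis using True by (simp add: axis_filt_def leadF_Suc)
next
  case False
  then have "n mod 3 < 2" by presburger
  then have "Suc n div 3 = n div 3" "Suc n mod 3 = Suc (n mod 3)" by presburger+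
  then show ?thesis by (simp add: axis_filt_def)
qed

lemma axis_gen_coeff:
  fixes s :: "'a::idom ps3"
  shows "ps_coeff (s * axis_gen n) a j l = (if a < n div 3 - (2 - n mod 3) \<or> l < 2 - n mod 3 then 0
    else ps_coeff s (a - (n div 3 - (2 - n mod 3))) j (l - (2 - n mod 3)))"
proof -
  have "s * axis_gen n = ps_X ^ (n div 3 - (2 - n mod 3)) * (ps_Z ^ (2 - n mod 3) * s)"
    by (simp add: axis_gen_def mult.commute)
  then show ?thesis by (simp only: ps_coeff_X_power_mult ps_coeff_Z_power_mult) auto
qed

lemma axis_gen_lead:
  assumes "n \<in> axis_idx" shows "(axis_gen n :: 'a::idom ps3) \<in> lead (n div 3) (Suc (2 - n mod 3))"
proof -
  define i l0 where "i = n div 3" "l0 = 2 - n mod 3"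
  have l0: "l0 \<le> i" using assms by (auto simp: i_l0_def axis_idx_def)
  have coeff: "ps_coeff (axis_gen n :: 'a ps3) a j l =
      (if a = i - l0 \<and> j = 0 \<and> l = l0 then 1 else 0)" for a j l
    using axis_gen_coeff[of "1 :: 'a ps3" n a j l, folded i_l0_def] by (auto simp: ps_coeff_1)
  show ?thesis
    unfolding lead_def i_l0_def[symmetric] using l0 by (auto intro!: wtI simp: coeff)
qed

text \<open>The leading form of the equation along the axis has Z^3 as its top term, so the
  monomials with Z-exponent at most two stay independent. In the proof \<open>g'\<close> is the part
  of degree \<open>i\<close> with Z-exponent at most two: a remainder congruent to zero up to order
  i + 1, hence without terms of degree \<open>i\<close>. But its coefficient at the chosen monomial
  is the restriction of \<open>s\<close>, which is nonzero.\<close>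

lemma axis_gen_notin:
  assumes n: "n \<in> axis_idx" shows "(axis_gen n :: 'a::idom ps3) \<notin> axis_filt (Suc n)"
proof
  define i l0 where "i = n div 3" "l0 = 2 - n mod 3"
  have l0: "l0 \<le> i" "l0 \<le> 2" using n by (auto simp: i_l0_def axis_idx_def)
  note coeff = axis_gen_coeff[of _ n, folded i_l0_def]
  assume "axis_gen n \<in> (axis_filt (Suc n) :: 'a ps3 set)"
  then obtain s :: "'a ps3" and p q where s: "s \<notin> wt 1 0 1 1"
    and eq: "s * axis_gen n = p + cubic m 3 * q" and p: "p \<in> lead i l0"
    by (auto simp: axis_filt_Suc sat_def leadF_def i_l0_def)
  define g where "g = s * axis_gen n - p"
  define g' where "g' = Abs_fps (\<lambda>l. Abs_fps (\<lambda>j. Abs_fps (\<lambda>a. if a + l = i \<and> l \<le> 2 then ps_coeff g a j l else 0)))"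
  have g': "ps_coeff g' a j l = (if a + l = i \<and> l \<le> 2 then ps_coeff g a j l else 0)" for a j l
    by (simp add: g'_def ps_coeff_def)
  have "g - g' \<in> wt 1 0 1 (Suc i)"
  proof (rule wtI)
    fix a j l :: nat assume "1 * a + 0 * j + 1 * l < Suc i"
    then consider "a + l < i" | "a + l = i" "l \<le> 2" | "a = i - l" "l \<le> i" "l > 2" by fastforce
    then show "ps_coeff (g - g') a j l = 0"
    proof cases
      case 1
      then have "ps_coeff p a j l = 0" using p by (auto simp: lead_def intro!: wtD[of p 1 0 1 i])
      moreover have "ps_coeff (s * axis_gen n) a j l = 0" using 1 l0 by (auto simp: coeff)
      ultimately show ?thesis using 1 by (simp add: g' g_def)
    next
      case 3
      then have "ps_coeff p a j l = 0" using p l0 by (auto simp: lead_def)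
      moreover have "ps_coeff (s * axis_gen n) a j l = 0" using 3 l0 by (auto simp: coeff)
      ultimately show ?thesis using 3 by (simp add: g' g_def)
    qed (simp add: g')
  qed
  moreover have "g' - cubic m 3 * q = - (g - g')" using eq by (simp add: g_def)
  ultimately have "g' - cubic m 3 * q \<in> wt 1 0 1 (Suc i)" using wt_minus by metis
  then have "g' \<in> wt 1 0 1 (Suc i)"
    using m by (intro nf_order[of g' m 3 q 0]) (auto simp: nf_iff g')
  moreover have "ps_coeff g' (i - l0) j l0 = ps_coeff s 0 j 0" for j
    using p l0 by (simp add: g' g_def coeff lead_def)
  ultimately have "ps_coeff s 0 j 0 = 0" for j
    using l0 wtD[of g' 1 0 1 "Suc i" "i - l0" j l0] by simp
  then show False using s by (auto simp: wt_def)
qed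

lemma filtration_axis: "filtration (wt 1 0 1 1) axis_filt (axis_gen :: nat \<Rightarrow> 'a::idom ps3) axis_idx"
proof
  let ?P = "wt 1 0 1 1 :: 'a ps3 set"
  note prime = tprime_axis[where 'a = 'a]
  show "tprime ?P" by (rule prime)
  have "(UNIV :: 'a ps3 set) \<subseteq> leadF 0 3" using wt_leadF[of 0] by simp
  then show "axis_filt 0 = (UNIV :: 'a ps3 set)" using sat_incl[OF prime] by (auto simp: axis_filt_def)
  show "satideal ?P (axis_filt n)" for n
    unfolding axis_filt_def by (rule satideal_sat[OF prime tideal_leadF])
  have sat_mono: "C \<subseteq> C' \<Longrightarrow> sat ?P C \<subseteq> sat ?P C'" for C C' by (auto simp: sat_def)
  show "axis_filt (Suc n) \<subseteq> (axis_filt n :: 'a ps3 set)" for n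
    unfolding axis_filt_Suc axis_filt_eq[of n] by (intro sat_mono leadF_mono lead_mono) simp
  show "axis_filt n \<subseteq> (axis_filt (Suc n) :: 'a ps3 set)" if "n \<notin> axis_idx" for n
    unfolding axis_filt_Suc axis_filt_eq[of n]
    using that by (intro sat_mono leadF_mono) (auto simp: axis_idx_def lead_def)
  show "p * axis_gen n \<in> axis_filt (Suc n)" if n: "n \<in> axis_idx" and p: "p \<in> ?P" for n p
  proof -
    have "axis_gen n \<in> (wt 1 0 1 (n div 3) :: 'a ps3 set)" using axis_gen_lead[OF n] by (auto simp: lead_def)
    from wt_mult[OF p this] have "p * axis_gen n \<in> lead (n div 3) (2 - n mod 3)"
      using wt_Suc_lead by auto
    then show ?thesis using lead_leadF sat_incl[OF prime] by (fastforce simp: axis_filt_Suc)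
  qed
  show "\<exists>s a. s \<notin> ?P \<and> s * f - a * axis_gen n \<in> axis_filt (Suc n)"
    if n: "n \<in> axis_idx" and f: "f \<in> axis_filt n" for n and f :: "'a ps3"
  proof -
    define i l0 where "i = n div 3" "l0 = 2 - n mod 3"
    have l0: "l0 \<le> i" using n by (auto simp: i_l0_def axis_idx_def)
    note coeff = axis_gen_coeff[of _ n, folded i_l0_def]
    obtain s p q where s: "s \<notin> ?P" "s * f = p + cubic m 3 * q" "p \<in> lead i (Suc l0)"
      using f by (auto simp: axis_filt_eq sat_def leadF_def i_l0_def)
    \<comment> \<open>The cofactor is the coefficient, a series in Y, of the monomial
      \<open>axis_gen n\<close> in the leading form of \<open>p\<close>.\<close>
    define a where "a = Abs_fps (\<lambda>l. Abs_fps (\<lambda>j. Abs_fps (\<lambda>i'.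
        if i' = 0 \<and> l = 0 then ps_coeff p (i - l0) j l0 else 0)))"
    have a: "ps_coeff a i' j l = (if i' = 0 \<and> l = 0 then ps_coeff p (i - l0) j l0 else 0)" for i' j l
      by (simp add: a_def ps_coeff_def)
    have pi: "p \<in> wt 1 0 1 i" using s(3) by (simp add: lead_def)
    have "p - a * axis_gen n \<in> lead i l0"
      unfolding lead_def
    proof (intro CollectI conjI allI impI wtI)
      fix b j l :: nat assume "1 * b + 0 * j + 1 * l < i"
      then show "ps_coeff (p - a * axis_gen n) b j l = 0"
        using wtD[OF pi, of b j l] l0 by (auto simp: coeff a)
    next
      fix j l assume l: "l0 \<le> l" "l \<le> i"
      show "ps_coeff (p - a * axis_gen n) (i - l) j l = 0"
      proof (cases "l = l0")
        case False
        then have "ps_coeff p (i - l) j l = 0" using s(3) l by (auto simp: lead_def)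
        then show ?thesis using False l by (auto simp: coeff a)
      qed (simp add: coeff a)
    qed
    moreover have "s * f - a * axis_gen n = (p - a * axis_gen n) + cubic m 3 * q" by (simp add: s)
    ultimately have "s * f - a * axis_gen n \<in> leadF i l0" unfolding leadF_def by blast
    then have "s * f - a * axis_gen n \<in> axis_filt (Suc n)"
      using sat_incl[OF prime] unfolding axis_filt_Suc i_l0_def by blast
    with s(1) show ?thesis by blast
  qed
qed

text \<open>The k-th power corresponds to \<open>axis_filt (3 * k)\<close>, whose length is the
  number of monomials X^a Z^b with b <= 2 and a + b < k.\<close>

theorem axis_hs_mult_3:
  fixes W :: "nat \<Rightarrow> 'a::idom ps3 set"
  assumes "local_powers (wt 1 0 1 1) (cubic m 3) W"
  shows "local_powers.hs_mult (wt 1 0 1 1) W 3"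
proof -
  interpret local_powers "wt 1 0 1 1" "cubic m 3" W by fact
  interpret filtration "wt 1 0 1 1" axis_filt "axis_gen :: nat \<Rightarrow> 'a ps3" axis_idx by (rule filtration_axis)
  let ?P = "wt 1 0 1 1 :: 'a ps3 set"
  have filt3: "axis_filt (3 * k) = sat ?P (leadF k 3)" for k by (simp add: axis_filt_def)
  have sub: "W k \<subseteq> axis_filt (3 * k)" for k
  proof (induction k)
    case 0 then show ?case using D0 by simp
  next
    case (Suc k)
    show ?case
    proof (rule W_least)
      show "satideal ?P (axis_filt (3 * Suc k))" by (rule D_sat)
      show "(cubic m 3 :: 'a ps3) \<in> axis_filt (3 * Suc k)"
        unfolding filt3 by (rule subsetD[OF sat_incl[OF tprime_axis] cubic_leadF])
      fix p f assume p: "p \<in> ?P" and "f \<in> W k"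
      then obtain s p' q where s: "s \<notin> ?P" "s * f = p' + cubic m 3 * q" "p' \<in> lead k 3"
        using subsetD[OF Suc] unfolding filt3 sat_def leadF_def by blast
      have "p * p' \<in> wt 1 0 1 (1 + k)" using s(3) by (intro wt_mult p) (simp add: lead_def)
      then have "p * p' \<in> leadF (Suc k) 3" using wt_leadF by auto
      moreover have "s * (p * f) = p * p' + cubic m 3 * (p * q)"
        using arg_cong[OF s(2), of "\<lambda>x. p * x"] by (simp add: algebra_simps)
      ultimately have "s * (p * f) \<in> leadF (Suc k) 3"
        using tideal_add[OF tideal_leadF _ tideal_mult_right[OF tideal_leadF cubic_leadF], of "p * p'" "Suc k" 3 "p * q"]
        by simp
      then show "p * f \<in> axis_filt (3 * Suc k)" using s(1) unfolding filt3 sat_def by blast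
    qed
  qed
  have wt_W: "wt 1 0 1 k \<subseteq> W k" for k
  proof (induction k)
    case 0 then show ?case by (simp add: W_0)
  next
    case (Suc k)
    have gens: "(ps_X :: 'a ps3) \<in> ?P" "(ps_Z :: 'a ps3) \<in> ?P"
      using X_power_in_wt[where 'a = 'a, of 1 1 0 1] Z_power_in_wt[where 'a = 'a, of 1 1 0 1] by simp_all
    show ?case
    proof
      fix f :: "'a ps3" assume "f \<in> wt 1 0 1 (Suc k)"
      then obtain a c where "f = ps_X * a + ps_Z * c" "a \<in> wt 1 0 1 k" "c \<in> wt 1 0 1 k"
        by (rule wt_axis_decompose)
      moreover have "a \<in> W k" "c \<in> W k" using calculation Suc by auto
      ultimately show "f \<in> W (Suc k)"
        using tideal_add[OF idW W_mult[OF gens(1)] W_mult[OF gens(2)]] by blast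
    qed
  qed
  have sup: "axis_filt (3 * k) \<subseteq> W k" for k
    unfolding filt3
  proof (intro sat_least W_sat subsetI)
    fix f :: "'a ps3" assume "f \<in> leadF k 3"
    then obtain p q where "f = p + cubic m 3 * q" "p \<in> wt 1 0 1 k" by (auto simp: leadF_def lead_def)
    then show "f \<in> W k"
      using wt_W tideal_add[OF idW _ tideal_mult_right[OF idW F_in_W, where s = q]] by auto
  qed
  have len: "slen ?P (W k) = enat (3 * k - 3)" if k: "k \<ge> 2" for k
  proof -
    have "slen ?P (axis_filt (3 * k)) = enat (card (axis_idx \<inter> {..<3 * k}))"
    proof (rule slen_eq)
      fix n assume n: "n \<in> axis_idx"
      have "axis_gen n \<in> axis_filt n"
        unfolding axis_filt_eq
        by (rule subsetD[OF sat_incl[OF tprime_axis] subsetD[OF lead_leadF axis_gen_lead[OF n]]])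
      with axis_gen_notin[OF n] show "axis_gen n \<in> axis_filt n \<and> axis_gen n \<notin> axis_filt (Suc n)" by blast
    qed
    \<comment> \<open>The three exceptional indices would belong to the exponent pairs (-2, 2), (-1,
      1) and (-1, 2) of X and Z.\<close>
    also have "(2 - n mod 3 \<le> n div 3) \<longleftrightarrow> n \<notin> {0, 1, 3}" for n :: nat
    proof (cases "n < 6")
      case True
      then have "n \<in> {0, 1, 2, 3, 4, 5}" by auto
      then show ?thesis by auto
    next
      case False
      then have "n div 3 \<ge> 2" by linarith
      with False show ?thesis by auto
    qed
    then have "axis_idx \<inter> {..<3 * k} = {..<3 * k} - {0, 1, 3}" by (auto simp: axis_idx_def)
    also have "card ({..<3 * k} - {0, 1, 3}) = 3 * k - 3"
      using k by (subst card_Diff_subset) auto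
    finally show ?thesis using sub[of k] sup[of k] by (metis subset_antisym)
  qed
  show ?thesis unfolding hs_mult_def
  proof (intro exI[of _ "[:-3, 3:]"] conjI)
    show "\<forall>\<^sub>F k in sequentially. \<exists>l. slen ?P (W k) = enat l \<and> real l = poly [:- 3, 3:] (real k)"
      using eventually_ge_at_top[of 2] 
    proof eventually_elim
      case (elim k)
      then show ?case by (intro exI[of _ "3 * k - 3"]) (simp add: len[OF elim, simplified] of_nat_diff)
    qed
  qed simp
qed

end

section \<open>Quotients and fractions of a commutative ring\<close>

text \<open>Calculations in a ring with a carrier are pulled back along \<open>h\<close> to a type-class ring.\<close>

locale quo = cring R for R :: "('b, 'm) ring_scheme" (structure) +
  fixes h :: "'r::comm_ring_1 \<Rightarrow> 'b"
  assumes carrier_eq: "carrier R = range h"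
    and h_add: "h a \<oplus> h b = h (a + b)"
    and h_mult: "h a \<otimes> h b = h (a * b)"
    and h_one: "\<one> = h 1"
begin

lemma h_carrier [simp, intro]: "h a \<in> carrier R"
  by (simp add: carrier_eq)

lemma h_zero: "\<zero> = h 0"
proof -
  have "h 0 \<oplus> h 0 = h 0 \<oplus> \<zero>" by (simp add: h_add)
  then show ?thesis by (metis h_carrier add.l_cancel zero_closed)
qed

lemma h_minus: "\<ominus> h a = h (- a)"
proof -
  have "h (- a) \<oplus> h a = \<zero>" by (simp add: h_add h_zero)
  then show ?thesis by (metis h_carrier minus_equality)
qed

lemma h_diff: "h a \<ominus> h b = h (a - b)"
  by (simp add: minus_eq h_minus h_add)

lemma h_eq_iff: "h a = h b \<longleftrightarrow> h (a - b) = \<zero>"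
  by (metis h_carrier h_diff r_right_minus_eq)

lemma carrierE: assumes "x \<in> carrier R" obtains a where "x = h a"
  using assms by (auto simp: carrier_eq)

definition ker :: "'r set" where "ker = {a. h a = \<zero>}"

definition pre :: "'b set \<Rightarrow> 'r set" where "pre C = {a. h a \<in> C}"

lemma in_pre: "a \<in> pre C \<longleftrightarrow> h a \<in> C"
  by (simp add: pre_def)

lemma in_ker: "a \<in> ker \<longleftrightarrow> h a = \<zero>"
  by (simp add: ker_def)

lemma tideal_pre: assumes "ideal C R" shows "tideal (pre C)"
proof -
  interpret C: ideal C R by fact
  show ?thesis unfolding tideal_def pre_def
    using C.zero_closed C.a_closed C.I_l_closed by (auto simp: h_zero simp flip: h_add h_mult)
qed

lemma ker_pre: assumes "ideal C R" shows "ker \<subseteq> pre C"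
proof -
  interpret C: ideal C R by fact
  show ?thesis using C.zero_closed by (auto simp: ker_def pre_def)
qed

lemma image_pre: "C \<subseteq> carrier R \<Longrightarrow> h ` pre C = C"
  by (auto simp: pre_def carrier_eq)

lemma tideal_ker: "tideal ker"
proof -
  have "ideal {\<zero>} R" by (rule zeroideal)
  moreover have "pre {\<zero>} = ker" by (auto simp: pre_def ker_def)
  ultimately show ?thesis using tideal_pre by metis
qed

lemma pre_image: assumes "tideal N" "ker \<subseteq> N" shows "pre (h ` N) = N"
proof -
  have "a \<in> N" if "h a = h b" "b \<in> N" for a b
  proof -
    have "a - b \<in> N" using that assms(2) by (auto simp: h_eq_iff in_ker)
    then show ?thesis using tideal_cong[OF assms(1)] that by blast
  qed
  then show ?thesis by (auto simp: pre_def)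
qed

lemma ideal_image: assumes "tideal N" shows "ideal (h ` N) R"
proof (rule idealI)
  show "ring R" by (rule ring_axioms)
  show "subgroup (h ` N) (add_monoid R)"
  proof (rule add.subgroupI)
    show "h ` N \<subseteq> carrier R" by auto
    show "h ` N \<noteq> {}" using tideal_0[OF assms] by auto
    show "\<ominus> a \<in> h ` N" if "a \<in> h ` N" for a
      using that tideal_minus[OF assms] by (auto simp: h_minus)
    show "a \<oplus> b \<in> h ` N" if "a \<in> h ` N" "b \<in> h ` N" for a b
      using that tideal_add[OF assms] by (auto simp: h_add)
  qed
  show "x \<otimes> a \<in> h ` N" "a \<otimes> x \<in> h ` N" if "a \<in> h ` N" "x \<in> carrier R" for a x
    using that tideal_mult[OF assms] tideal_mult_right[OF assms] by (auto simp: carrier_eq h_mult)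
qed

lemma pre_subset_iff: "C \<subseteq> carrier R \<Longrightarrow> pre C \<subseteq> pre C' \<longleftrightarrow> C \<subseteq> C'"
  by (auto simp: pre_def carrier_eq)

lemma prime_pre_iff: assumes "ideal C R" shows "primeideal C R \<longleftrightarrow> tprime (pre C)"
proof
  assume "primeideal C R"
  then interpret C: primeideal C R .
  have "h 1 \<notin> C" using C.I_notcarr C.one_imp_carrier by (auto simp flip: h_one)
  moreover have "a \<in> pre C \<or> b \<in> pre C" if "a * b \<in> pre C" for a b
    using that C.I_prime[of "h a" "h b"] by (simp add: pre_def h_mult)
  ultimately show "tprime (pre C)" using tideal_pre[OF assms] by (simp add: tprime_def in_pre)
next
  interpret C: ideal C R by fact
  assume *: "tprime (pre C)"
  show "primeideal C R"
  proof (intro primeideal.intro primeideal_axioms.intro assms cring_axioms)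
    show "carrier R \<noteq> C" using * by (auto simp: tprime_def pre_def)
    show "a \<in> C \<or> b \<in> C" if ab: "a \<in> carrier R" "b \<in> carrier R" "a \<otimes> b \<in> C" for a b
    proof -
      obtain x y where "a = h x" "b = h y" using ab by (metis carrierE)
      then show ?thesis using ab(3) tprime_mult_iff[OF *, of x y] by (simp add: h_mult in_pre)
    qed
  qed
qed

lemma quo_Quot:
  assumes "ideal P R"
  shows "quo (R Quot P) (\<lambda>f. P +> h f)" and "quo.ker (R Quot P) (\<lambda>f. P +> h f) = pre P"
proof -
  interpret P: ideal P R by fact
  interpret Q: cring "R Quot P" by (rule P.quotient_is_cring[OF cring_axioms])
  show *: "quo (R Quot P) (\<lambda>f. P +> h f)"
  proof
    show "carrier (R Quot P) = range (\<lambda>f. P +> h f)"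
      by (auto simp: FactRing_def A_RCOSETS_def' carrier_eq)
    show "(P +> h a) \<oplus>\<^bsub>R Quot P\<^esub> (P +> h b) = P +> h (a + b)" for a b
      by (simp add: FactRing_def P.a_rcos_sum h_add)
    show "(P +> h a) \<otimes>\<^bsub>R Quot P\<^esub> (P +> h b) = P +> h (a * b)" for a b
      by (simp add: FactRing_def P.rcoset_mult_add h_mult)
    show "\<one>\<^bsub>R Quot P\<^esub> = P +> h 1" by (simp add: FactRing_def h_one)
  qed
  have "P +> h a = P \<longleftrightarrow> h a \<in> P" for a
    using P.a_rcos_const P.a_rcos_self[of "h a"] by auto
  then show "quo.ker (R Quot P) (\<lambda>f. P +> h f) = pre P"
    unfolding quo.ker_def[OF *] by (simp add: pre_def FactRing_def)
qed

end

lemma (in cring) local_ringI: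
  assumes N: "ideal N R" "\<one> \<notin> N" and units: "\<And>a. a \<in> carrier R \<Longrightarrow> a \<notin> N \<Longrightarrow> a \<in> Units R"
  shows "local_ring R" and "max_ideal R = N"
proof -
  have le: "J \<subseteq> N" if J: "ideal J R" "J \<noteq> carrier R" for J
  proof
    interpret J: ideal J R by fact
    fix a assume a: "a \<in> J"
    show "a \<in> N"
    proof (rule ccontr)
      assume "a \<notin> N"
      then have "a \<in> Units R" using units J.Icarr a by blast
      then have "\<one> \<in> J" using J.I_l_closed[OF a, of "inv a"] by simp
      then show False using J(2) J.one_imp_carrier by simp
    qed
  qed
  have nc: "carrier R \<noteq> N" using N by auto
  have max: "maximalideal N R"
  proof (rule maximalidealI)
    show "J = N \<or> J = carrier R" if "ideal J R" "N \<subseteq> J" for J using le that by blast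
  qed (use N nc in auto)
  have uniq: "M = N" if M: "maximalideal M R" for M
  proof -
    interpret M: maximalideal M R by fact
    have "M \<subseteq> N" using le M.is_ideal M.I_notcarr by auto
    then show ?thesis using M.I_maximal[OF N(1)] ideal.Icarr[OF N(1)] nc by auto
  qed
  show "local_ring R" unfolding local_ring_def using cring_axioms max uniq by blast
  show "max_ideal R = N" unfolding max_ideal_def using max uniq by (rule the_equality)
qed

text \<open>In the stalk of a blowing-up, numerator and denominator must have a common degree, so
  admissibility is a relation \<open>TT\<close> between both and not a condition on denominators
  alone. Localizations are the other instance.\<close>

locale frac = quo R h for R :: "('b, 'm) ring_scheme" (structure) and h :: "'r::comm_ring_1 \<Rightarrow> 'b" +
  fixes T :: "('b \<times> 'b) set" and TT :: "'r \<Rightarrow> 'r \<Rightarrow> bool"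
  assumes T_carrier: "T \<subseteq> carrier R \<times> carrier R"
    and TT_iff: "TT f g \<longleftrightarrow> (h f, h g) \<in> T"
    and TT_1: "TT 1 1" and TT_0: "TT 0 1"
    and TT_mult: "TT f g \<Longrightarrow> TT f' g' \<Longrightarrow> TT (f * f') (g * g')"
    and TT_add: "TT f g \<Longrightarrow> TT f' g' \<Longrightarrow> TT (f * g' + f' * g) (g * g')"
    and TT_minus: "TT f g \<Longrightarrow> TT (- f) g"
begin

definition kap :: "'r \<Rightarrow> 'r \<Rightarrow> ('b \<times> 'b) set"
  where "kap f g = frac_rel R T `` {(h f, h g)}"

definition den :: "'r \<Rightarrow> bool" where "den g \<longleftrightarrow> (\<exists>f. TT f g)"

abbreviation "A \<equiv> frac_ring R T"

lemma den_iff: "h u \<in> snd ` T \<longleftrightarrow> den u"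
  using T_carrier by (force simp: den_def TT_iff carrier_eq)

lemma den_mult: "den f \<Longrightarrow> den g \<Longrightarrow> den (f * g)"
  unfolding den_def using TT_mult by blast

lemma frac_rel_iff:
  "((h f, h g), (h f', h g')) \<in> frac_rel R T \<longleftrightarrow>
    TT f g \<and> TT f' g' \<and> (\<exists>u. den u \<and> u * (f * g' - f' * g) \<in> ker)"
proof -
  have "(\<exists>u\<in>snd ` T. u \<otimes> (h f \<otimes> h g' \<ominus> h f' \<otimes> h g) = \<zero>) \<longleftrightarrow> (\<exists>u. den u \<and> u * (f * g' - f' * g) \<in> ker)"
    (is "?l \<longleftrightarrow> ?r")
  proof
    assume ?l
    then obtain u where u: "u \<in> snd ` T" "u \<otimes> (h f \<otimes> h g' \<ominus> h f' \<otimes> h g) = \<zero>" by blast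
    moreover from u T_carrier have "u \<in> carrier R" by auto
    then obtain v where "u = h v" by (rule carrierE)
    ultimately show ?r by (auto simp: den_iff h_mult h_diff in_ker)
  next
    assume ?r
    then obtain u where u: "den u" "u * (f * g' - f' * g) \<in> ker" by blast
    then have "h u \<otimes> (h f \<otimes> h g' \<ominus> h f' \<otimes> h g) = \<zero>" by (simp add: h_mult h_diff in_ker)
    then show ?l using u(1) den_iff by blast
  qed
  then show ?thesis by (auto simp: frac_rel_def TT_iff)
qed

lemma TE: assumes "p \<in> T" obtains f g where "p = (h f, h g)" "TT f g"
proof -
  obtain a b where p: "p = (a, b)" by (cases p)
  with assms T_carrier have "a \<in> carrier R" "b \<in> carrier R" by auto
  then obtain f g where "a = h f" "b = h g" by (metis carrierE)
  with p assms that show thesis by (simp add: TT_iff)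
qed

lemma equiv_frac_rel: "equiv T (frac_rel R T)"
proof (rule equivI)
  show "frac_rel R T \<subseteq> T \<times> T" by (auto simp: frac_rel_def)
  show "refl_on T (frac_rel R T)"
  proof (rule refl_onI)
    fix p assume "p \<in> T"
    then obtain f g where p: "p = (h f, h g)" "TT f g" by (rule TE)
    moreover have "den g" using p by (auto simp: den_def)
    ultimately show "(p, p) \<in> frac_rel R T"
      using tideal_0[OF tideal_ker] by (auto simp: frac_rel_iff intro!: exI[of _ g])
  qed
  show "sym (frac_rel R T)"
  proof (rule symI)
    fix p p' assume pp: "(p, p') \<in> frac_rel R T"
    then have "p \<in> T" "p' \<in> T" by (auto simp: frac_rel_def)
    then obtain f g f' g' where p: "p = (h f, h g)" "p' = (h f', h g')" by (metis TE)
    obtain u where u: "TT f g" "TT f' g'" "den u" "u * (f * g' - f' * g) \<in> ker"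
      using pp unfolding p frac_rel_iff by blast
    have "u * (f' * g - f * g') = - (u * (f * g' - f' * g))" by (simp add: algebra_simps)
    then show "(p', p) \<in> frac_rel R T"
      unfolding p frac_rel_iff using u tideal_minus[OF tideal_ker] by metis
  qed
  show "trans (frac_rel R T)"
  proof (rule transI)
    fix p p' p'' assume pp: "(p, p') \<in> frac_rel R T" "(p', p'') \<in> frac_rel R T"
    then have "p \<in> T" "p' \<in> T" "p'' \<in> T" by (auto simp: frac_rel_def)
    then obtain f g f' g' f'' g'' where p: "p = (h f, h g)" "p' = (h f', h g')" "p'' = (h f'', h g'')"
      by (metis TE)
    obtain u where u: "TT f g" "TT f' g'" "den u" "u * (f * g' - f' * g) \<in> ker"
      using pp(1) unfolding p frac_rel_iff by blast
    obtain v where v: "TT f'' g''" "den v" "v * (f' * g'' - f'' * g') \<in> ker"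
      using pp(2) unfolding p frac_rel_iff by blast
    \<comment> \<open>The middle denominator \<open>g'\<close> is absorbed into the annihilating
      factor, which is why products of denominators must again be denominators.\<close>
    have "(u * v * g') * (f * g'' - f'' * g) =
        (v * g'') * (u * (f * g' - f' * g)) + (u * g) * (v * (f' * g'' - f'' * g'))"
      by (simp add: algebra_simps)
    also have "\<dots> \<in> ker" by (intro tideal_add[OF tideal_ker] tideal_mult[OF tideal_ker] u v)
    finally have "(u * v * g') * (f * g'' - f'' * g) \<in> ker" .
    moreover have "den (u * v * g')" using u v by (intro den_mult) (auto simp: den_def)
    ultimately show "(p, p'') \<in> frac_rel R T" unfolding p frac_rel_iff using u v by blast
  qed
qed

lemma kap_eq_iff:
  assumes "TT f g" "TT f' g'"
  shows "kap f g = kap f' g' \<longleftrightarrow> (\<exists>u. den u \<and> u * (f * g' - f' * g) \<in> ker)"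
proof -
  have "kap f g = kap f' g' \<longleftrightarrow> ((h f, h g), (h f', h g')) \<in> frac_rel R T"
    unfolding kap_def using assms by (intro eq_equiv_class_iff[OF equiv_frac_rel]) (simp_all add: TT_iff)
  then show ?thesis using assms by (simp add: frac_rel_iff)
qed

lemma kap_eqI:
  assumes "TT f g" "TT f' g'" "f * g' = f' * g" shows "kap f g = kap f' g'"
proof -
  have "den 1" using TT_1 by (auto simp: den_def)
  moreover have "1 * (f * g' - f' * g) \<in> ker" using tideal_0[OF tideal_ker] assms(3) by simp
  ultimately show ?thesis using kap_eq_iff[OF assms(1,2)] by blast
qed

lemma A_carrier: "carrier A = {kap f g |f g. TT f g}"
proof -
  have "carrier A = T // frac_rel R T" by (simp add: frac_ring_def)
  also have "\<dots> = {kap f g |f g. TT f g}"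
  proof (intro equalityI subsetI)
    fix c assume "c \<in> T // frac_rel R T"
    then obtain p where "p \<in> T" "c = frac_rel R T `` {p}" by (rule quotientE)
    then show "c \<in> {kap f g |f g. TT f g}" unfolding kap_def by (blast elim: TE)
  next
    fix c assume "c \<in> {kap f g |f g. TT f g}"
    then show "c \<in> T // frac_rel R T" unfolding kap_def TT_iff by (blast intro: quotientI)
  qed
  finally show ?thesis .
qed

lemma kap_carrier: "TT f g \<Longrightarrow> kap f g \<in> carrier A"
  by (auto simp: A_carrier)

lemma A_carrierE: assumes "x \<in> carrier A" obtains f g where "x = kap f g" "TT f g"
  using assms by (auto simp: A_carrier)

lemma kap_members:
  assumes "p \<in> kap f g" obtains f' g' where "p = (h f', h g')" "TT f' g'" "TT f g" "kap f' g' = kap f g"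
proof -
  have *: "((h f, h g), p) \<in> frac_rel R T" using assms by (simp add: kap_def)
  then have "p \<in> T" by (auto simp: frac_rel_def)
  then obtain f' g' where p: "p = (h f', h g')" "TT f' g'" by (rule TE)
  with * have "TT f g" by (simp add: frac_rel_iff)
  moreover have "kap f' g' = kap f g"
    unfolding kap_def using equiv_class_eq[OF equiv_frac_rel *] p by simp
  ultimately show thesis using p that by blast
qed

lemma self_in_kap: "TT f g \<Longrightarrow> (h f, h g) \<in> kap f g"
  unfolding kap_def by (intro equiv_class_self[OF equiv_frac_rel]) (simp add: TT_iff)

text \<open>The operations of \<open>frac_ring\<close> are unions over all representatives;
  independence of the representatives makes all members of the union equal, and the classes are
  nonempty.\<close>

lemma kap_UN:
  assumes T: "TT f g" "TT f' g'"
    and cong: "\<And>a b c d. TT a b \<Longrightarrow> TT c d \<Longrightarrow> kap a b = kap f g \<Longrightarrow> kap c d = kap f' g'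
      \<Longrightarrow> \<Phi> (h a) (h b) (h c) (h d) = Z"
  shows "(\<Union>(a, s)\<in>kap f g. \<Union>(b, t)\<in>kap f' g'. \<Phi> a s b t) = Z"
proof -
  have "(case p of (a, s) \<Rightarrow> \<Union>(b, t)\<in>kap f' g'. \<Phi> a s b t) = Z" if p: "p \<in> kap f g" for p
  proof -
    from p obtain a s where p': "p = (h a, h s)" "TT a s" "kap a s = kap f g" by (metis kap_members)
    have "(case q of (b, t) \<Rightarrow> \<Phi> (h a) (h s) b t) = Z" if q: "q \<in> kap f' g'" for q
    proof -
      from q obtain b t where q': "q = (h b, h t)" "TT b t" "kap b t = kap f' g'" by (metis kap_members)
      with cong[of a s b t] p' show ?thesis by simp
    qed
    then show ?thesis using self_in_kap[OF T(2)] unfolding p'(1) by (auto simp del: split_paired_All)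
  qed
  then show ?thesis using self_in_kap[OF T(1)] by (auto simp del: split_paired_All)
qed

lemma kap_mult: assumes "TT f g" "TT f' g'" shows "kap f g \<otimes>\<^bsub>A\<^esub> kap f' g' = kap (f * f') (g * g')"
proof -
  have "(\<Union>(a, s)\<in>kap f g. \<Union>(b, t)\<in>kap f' g'. frac_rel R T `` {(a \<otimes> b, s \<otimes> t)}) = kap (f * f') (g * g')"
  proof (rule kap_UN[OF assms])
    fix a b c d assume *: "TT a b" "TT c d" "kap a b = kap f g" "kap c d = kap f' g'"
    obtain u where u: "den u" "u * (a * g - f * b) \<in> ker" using * assms by (auto simp: kap_eq_iff)
    obtain v where v: "den v" "v * (c * g' - f' * d) \<in> ker" using * assms by (auto simp: kap_eq_iff)
    have "(u * v) * ((a * c) * (g * g') - (f * f') * (b * d)) =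
        (v * c * g') * (u * (a * g - f * b)) + (u * f * b) * (v * (c * g' - f' * d))"
      by (simp add: algebra_simps)
    also have "\<dots> \<in> ker" by (intro tideal_add[OF tideal_ker] tideal_mult[OF tideal_ker] u v)
    finally have "kap (a * c) (b * d) = kap (f * f') (g * g')"
      using u v den_mult by (subst kap_eq_iff) (auto intro: TT_mult * assms)
    then show "frac_rel R T `` {(h a \<otimes> h c, h b \<otimes> h d)} = kap (f * f') (g * g')"
      by (simp add: kap_def h_mult)
  qed
  then show ?thesis by (simp add: frac_ring_def)
qed

lemma kap_add:
  assumes "TT f g" "TT f' g'" shows "kap f g \<oplus>\<^bsub>A\<^esub> kap f' g' = kap (f * g' + f' * g) (g * g')"
proof -
  have "(\<Union>(a, s)\<in>kap f g. \<Union>(b, t)\<in>kap f' g'. frac_rel R T `` {(a \<otimes> t \<oplus> b \<otimes> s, s \<otimes> t)})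
      = kap (f * g' + f' * g) (g * g')"
  proof (rule kap_UN[OF assms])
    fix a b c d assume *: "TT a b" "TT c d" "kap a b = kap f g" "kap c d = kap f' g'"
    obtain u where u: "den u" "u * (a * g - f * b) \<in> ker" using * assms by (auto simp: kap_eq_iff)
    obtain v where v: "den v" "v * (c * g' - f' * d) \<in> ker" using * assms by (auto simp: kap_eq_iff)
    have "(u * v) * ((a * d + c * b) * (g * g') - (f * g' + f' * g) * (b * d)) =
        (v * d * g') * (u * (a * g - f * b)) + (u * g * b) * (v * (c * g' - f' * d))"
      by (simp add: algebra_simps)
    also have "\<dots> \<in> ker" by (intro tideal_add[OF tideal_ker] tideal_mult[OF tideal_ker] u v)
    finally have "kap (a * d + c * b) (b * d) = kap (f * g' + f' * g) (g * g')"
      using u v den_mult by (subst kap_eq_iff) (auto intro: TT_add * assms)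
    then show "frac_rel R T `` {(h a \<otimes> h d \<oplus> h c \<otimes> h b, h b \<otimes> h d)} = kap (f * g' + f' * g) (g * g')"
      by (simp add: kap_def h_mult h_add)
  qed
  then show ?thesis by (simp add: frac_ring_def)
qed

lemma kap_one: "\<one>\<^bsub>A\<^esub> = kap 1 1" and kap_zero: "\<zero>\<^bsub>A\<^esub> = kap 0 1"
  by (simp_all add: frac_ring_def kap_def h_one h_zero)

lemma cring_A: "cring A"
proof (rule cringI)
  show "abelian_group A"
  proof (rule abelian_groupI)
    fix x y z assume "x \<in> carrier A" "y \<in> carrier A" "z \<in> carrier A"
    then obtain a b c d e f where *: "x = kap a b" "y = kap c d" "z = kap e f"
      and T: "TT a b" "TT c d" "TT e f" by (metis A_carrierE)
    show "x \<oplus>\<^bsub>A\<^esub> y \<in> carrier A" using T by (simp add: * kap_add kap_carrier TT_add)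
    show "x \<oplus>\<^bsub>A\<^esub> y \<oplus>\<^bsub>A\<^esub> z = x \<oplus>\<^bsub>A\<^esub> (y \<oplus>\<^bsub>A\<^esub> z)"
      using T by (simp add: * kap_add TT_add) (simp add: algebra_simps)
    show "x \<oplus>\<^bsub>A\<^esub> y = y \<oplus>\<^bsub>A\<^esub> x" using T by (simp add: * kap_add) (simp add: algebra_simps)
    show "\<zero>\<^bsub>A\<^esub> \<oplus>\<^bsub>A\<^esub> x = x" using T by (simp add: * kap_add kap_zero TT_0)
    have "kap (- a) b \<oplus>\<^bsub>A\<^esub> x = \<zero>\<^bsub>A\<^esub>"
      unfolding * kap_zero kap_add[OF TT_minus[OF T(1)] T(1)]
      by (rule kap_eqI[OF TT_add[OF TT_minus[OF T(1)] T(1)] TT_0]) simp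
    then show "\<exists>y\<in>carrier A. y \<oplus>\<^bsub>A\<^esub> x = \<zero>\<^bsub>A\<^esub>" using kap_carrier[OF TT_minus[OF T(1)]] by blast
  next
    show "\<zero>\<^bsub>A\<^esub> \<in> carrier A" by (simp add: kap_zero kap_carrier TT_0)
  qed
  show "Group.comm_monoid A"
  proof (rule comm_monoidI)
    fix x y z assume "x \<in> carrier A" "y \<in> carrier A" "z \<in> carrier A"
    then obtain a b c d e f where *: "x = kap a b" "y = kap c d" "z = kap e f"
      and T: "TT a b" "TT c d" "TT e f" by (metis A_carrierE)
    show "x \<otimes>\<^bsub>A\<^esub> y \<in> carrier A" using T by (simp add: * kap_mult kap_carrier TT_mult)
    show "x \<otimes>\<^bsub>A\<^esub> y \<otimes>\<^bsub>A\<^esub> z = x \<otimes>\<^bsub>A\<^esub> (y \<otimes>\<^bsub>A\<^esub> z)"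
      using T by (simp add: * kap_mult TT_mult mult.assoc)
    show "x \<otimes>\<^bsub>A\<^esub> y = y \<otimes>\<^bsub>A\<^esub> x" using T by (simp add: * kap_mult mult.commute)
    show "\<one>\<^bsub>A\<^esub> \<otimes>\<^bsub>A\<^esub> x = x" using T by (simp add: * kap_mult kap_one TT_1)
  next
    show "\<one>\<^bsub>A\<^esub> \<in> carrier A" by (simp add: kap_one kap_carrier TT_1)
  qed
  fix x y z assume "x \<in> carrier A" "y \<in> carrier A" "z \<in> carrier A"
  then obtain a b c d e f where *: "x = kap a b" "y = kap c d" "z = kap e f"
    and T: "TT a b" "TT c d" "TT e f" by (metis A_carrierE)
  show "(x \<oplus>\<^bsub>A\<^esub> y) \<otimes>\<^bsub>A\<^esub> z = x \<otimes>\<^bsub>A\<^esub> z \<oplus>\<^bsub>A\<^esub> y \<otimes>\<^bsub>A\<^esub> z"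
  proof -
    have "kap ((a * d + c * b) * e) ((b * d) * f) = kap ((a * e) * (d * f) + (c * e) * (b * f)) ((b * f) * (d * f))"
      by (rule kap_eqI[OF TT_mult[OF TT_add[OF T(1,2)] T(3)] TT_add[OF TT_mult[OF T(1,3)] TT_mult[OF T(2,3)]]])
        (simp add: algebra_simps)
    with T show ?thesis unfolding * by (simp add: kap_mult kap_add TT_add TT_mult)
  qed
qed

lemma kap_Units: assumes "TT f g" "TT g f" shows "kap f g \<in> Units A"
proof -
  interpret A: cring A by (rule cring_A)
  have "kap f g \<otimes>\<^bsub>A\<^esub> kap g f = \<one>\<^bsub>A\<^esub>"
    unfolding kap_one kap_mult[OF assms] using TT_mult[OF assms] TT_1 by (rule kap_eqI) simp
  then show ?thesis
    using kap_carrier[OF assms(1)] kap_carrier[OF assms(2)] A.m_comm[OF kap_carrier[OF assms(1)] kap_carrier[OF assms(2)]]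
    unfolding Units_def by auto
qed

lemma kap_cong: assumes "TT f g" "TT f' g" "f - f' \<in> ker" shows "kap f g = kap f' g"
proof (subst kap_eq_iff[OF assms(1,2)], intro exI conjI)
  show "den g" using assms by (auto simp: den_def)
  have "g * (f * g - f' * g) = (g * g) * (f - f')" by (simp add: algebra_simps)
  then show "g * (f * g - f' * g) \<in> ker" using tideal_mult[OF tideal_ker assms(3)] by simp
qed

end

section \<open>Localizations\<close>

locale loc = quo R h for R :: "('b, 'm) ring_scheme" (structure) and h :: "'r::comm_ring_1 \<Rightarrow> 'b" +
  fixes P :: "'b set" and F :: 'r
  assumes primeideal_P: "primeideal P R" and ker_F: "ker = {f. F dvd f}"
begin

lemma ideal_P: "ideal P R" using primeideal_P by (simp add: primeideal_def)

abbreviation "PP \<equiv> pre P"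

lemma prime_PP: "tprime PP" using prime_pre_iff[OF ideal_P] primeideal_P by simp

sublocale frac R h "carrier R \<times> (carrier R - P)" "\<lambda>f g. g \<notin> PP"
proof
  show "g \<notin> PP \<longleftrightarrow> (h f, h g) \<in> carrier R \<times> (carrier R - P)" for f g by (simp add: in_pre)
qed (use tprime_1[OF prime_PP] tprime_not_mult[OF prime_PP] in auto)

lemma A_eq: "localization R P = A" by (simp add: localization_def)

sublocale A: cring A by (rule cring_A)

lemma one_PP: "1 \<notin> PP" by (rule tprime_1[OF prime_PP])

section \<open>Contraction and extension between the localization and saturated ideals\<close>

definition cont :: "('b \<times> 'b) set set \<Rightarrow> 'r set" where "cont C = {f. kap f 1 \<in> C}"

definition ext :: "'r set \<Rightarrow> ('b \<times> 'b) set set" where "ext N = {kap f g |f g. f \<in> N \<and> g \<notin> PP}"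

lemma kap_factor: "g \<notin> PP \<Longrightarrow> kap f g = kap f 1 \<otimes>\<^bsub>A\<^esub> kap 1 g"
  using one_PP by (simp add: kap_mult)

lemma kap_cancel: "g \<notin> PP \<Longrightarrow> kap f 1 = kap f g \<otimes>\<^bsub>A\<^esub> kap g 1"
proof -
  assume g: "g \<notin> PP"
  have "kap f 1 = kap (f * g) (g * 1)" using g one_PP by (intro kap_eqI) simp_all
  then show ?thesis using g one_PP by (simp add: kap_mult)
qed

lemma kap_in_iff:
  assumes "ideal C A" "g \<notin> PP" shows "kap f g \<in> C \<longleftrightarrow> f \<in> cont C"
proof -
  interpret C: ideal C A by fact
  show ?thesis unfolding cont_def mem_Collect_eq
    using kap_factor[OF assms(2)] kap_cancel[OF assms(2)] assms(2) one_PP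
      C.I_r_closed[OF _ kap_carrier] by metis
qed

lemma cont_mono_iff:
  assumes "ideal C A" "ideal C' A" shows "cont C \<subseteq> cont C' \<longleftrightarrow> C \<subseteq> C'"
proof
  assume *: "cont C \<subseteq> cont C'"
  show "C \<subseteq> C'"
  proof
    fix x assume x: "x \<in> C"
    then obtain f g where "x = kap f g" "g \<notin> PP" using ideal.Icarr[OF assms(1)] A_carrierE by metis
    with x * show "x \<in> C'" using kap_in_iff assms by blast
  qed
qed (auto simp: cont_def)

lemma satideal_cont:
  assumes "ideal C A" shows "satideal PP (cont C)"
proof -
  interpret C: ideal C A by fact
  have 1: "kap 0 1 \<in> C" using C.zero_closed kap_zero by simp
  have 2: "kap (a + b) 1 \<in> C" if "kap a 1 \<in> C" "kap b 1 \<in> C" for a b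
    using C.a_closed[OF that] one_PP by (simp add: kap_add)
  have 3: "kap (s * a) 1 \<in> C" if "kap a 1 \<in> C" for s a
    using C.I_l_closed[OF that kap_carrier[of 1 s]] one_PP by (simp add: kap_mult)
  have 4: "kap f 1 \<in> C" if "s \<notin> PP" "kap (s * f) 1 \<in> C" for s f
  proof -
    have "kap (s * f) 1 \<otimes>\<^bsub>A\<^esub> kap 1 s \<in> C" using that by (intro C.I_r_closed kap_carrier)
    also have "kap (s * f) 1 \<otimes>\<^bsub>A\<^esub> kap 1 s = kap f 1"
    proof -
      have "kap (s * f * 1) (1 * s) = kap f 1" using that(1) one_PP by (intro kap_eqI) simp_all
      then show ?thesis using that(1) one_PP by (simp add: kap_mult)
    qed
    finally show ?thesis .
  qed
  show ?thesis unfolding satideal_def tideal_def cont_def using 1 2 3 4 by blast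
qed

lemma ker_in_ideal: "ideal C A \<Longrightarrow> ker \<subseteq> cont C"
proof
  fix f assume C: "ideal C A" and f: "f \<in> ker"
  have "kap f 1 = kap 0 1" using f one_PP by (intro kap_cong) auto
  then show "f \<in> cont C" using additive_subgroup.zero_closed[OF ideal.axioms(1)[OF C]] kap_zero
    by (simp add: cont_def)
qed

lemma in_ext_iff:
  assumes N: "satideal PP N" "ker \<subseteq> N" and g: "g \<notin> PP" shows "kap f g \<in> ext N \<longleftrightarrow> f \<in> N"
proof
  assume "kap f g \<in> ext N"
  then obtain f' g' where *: "kap f g = kap f' g'" "f' \<in> N" "g' \<notin> PP" by (auto simp: ext_def)
  then obtain u where u: "u \<notin> PP" "u * (f * g' - f' * g) \<in> ker"
    using kap_eq_iff[of g g' f f'] g by (auto simp: den_def)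
  note id = satideal_tideal[OF N(1)]
  have "u * (f * g' - f' * g) + (u * g) * f' \<in> N"
    using u(2) N(2) * by (intro tideal_add[OF id] tideal_mult[OF id, of f']) auto
  then have "(u * g') * f \<in> N" by (simp add: algebra_simps)
  then show "f \<in> N" using satD[OF N(1)] tprime_not_mult[OF prime_PP u(1) *(3)] by blast
qed (use g in \<open>auto simp: ext_def\<close>)

lemma cont_ext: "satideal PP N \<Longrightarrow> ker \<subseteq> N \<Longrightarrow> cont (ext N) = N"
  using in_ext_iff one_PP by (auto simp: cont_def)

lemma ideal_ext:
  assumes N: "satideal PP N" "ker \<subseteq> N" shows "ideal (ext N) A"
proof (rule idealI)
  note id = satideal_tideal[OF N(1)]
  show "ring A" by (rule A.ring_axioms)
  have mult: "x \<otimes>\<^bsub>A\<^esub> a \<in> ext N" if ax: "a \<in> ext N" "x \<in> carrier A" for a x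
  proof -
    obtain f g where a: "a = kap f g" "f \<in> N" "g \<notin> PP" using ax by (auto simp: ext_def)
    obtain f' g' where x: "x = kap f' g'" "g' \<notin> PP" using ax by (auto elim: A_carrierE)
    show ?thesis using a x tideal_mult[OF id a(2)] tprime_not_mult[OF prime_PP x(2) a(3)]
      by (auto simp: kap_mult ext_def)
  qed
  have carr: "ext N \<subseteq> carrier A" by (auto simp: ext_def intro: kap_carrier)
  show "x \<otimes>\<^bsub>A\<^esub> a \<in> ext N" "a \<otimes>\<^bsub>A\<^esub> x \<in> ext N" if "a \<in> ext N" "x \<in> carrier A" for a x
    using mult[OF that] A.m_comm that carr by auto
  show "subgroup (ext N) (add_monoid A)"
  proof (rule A.add.subgroupI)
    show "ext N \<subseteq> carrier A" by (rule carr)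
    show "ext N \<noteq> {}" using tideal_0[OF id] one_PP by (auto simp: ext_def)
    show "\<ominus>\<^bsub>A\<^esub> a \<in> ext N" if a: "a \<in> ext N" for a
    proof -
      have "a \<in> carrier A" using a carr by blast
      then have "\<ominus>\<^bsub>A\<^esub> a = (\<ominus>\<^bsub>A\<^esub> \<one>\<^bsub>A\<^esub>) \<otimes>\<^bsub>A\<^esub> a" by (simp add: A.l_minus)
      then show ?thesis using mult[OF a, of "\<ominus>\<^bsub>A\<^esub> \<one>\<^bsub>A\<^esub>"] by simp
    qed
    show "a \<oplus>\<^bsub>A\<^esub> b \<in> ext N" if ab: "a \<in> ext N" "b \<in> ext N" for a b
    proof -
      obtain f g where a: "a = kap f g" "f \<in> N" "g \<notin> PP" using ab by (auto simp: ext_def)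
      obtain f' g' where b: "b = kap f' g'" "f' \<in> N" "g' \<notin> PP" using ab by (auto simp: ext_def)
      have "f * g' + f' * g \<in> N" by (intro tideal_add[OF id] tideal_mult_right[OF id] a b)
      then show ?thesis using a b tprime_not_mult[OF prime_PP a(3) b(3)] by (auto simp: kap_add ext_def)
    qed
  qed
qed

lemma ker_PP: "ker \<subseteq> PP" by (rule ker_pre[OF ideal_P])

lemma satideal_PP: "satideal PP PP"
  using tprime_tideal[OF prime_PP] tprime_mult_iff[OF prime_PP] by (auto simp: satideal_def)

lemma local_A: "local_ring A" and max_ideal_A: "max_ideal A = ext PP"
proof -
  note id = ideal_ext[OF satideal_PP ker_PP]
  have "\<one>\<^bsub>A\<^esub> \<notin> ext PP" using in_ext_iff[OF satideal_PP ker_PP one_PP] one_PP by (simp add: kap_one)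
  moreover have "a \<in> Units A" if "a \<in> carrier A" "a \<notin> ext PP" for a
    using that by (auto elim!: A_carrierE simp: in_ext_iff[OF satideal_PP ker_PP] intro!: kap_Units)
  ultimately show "local_ring A" "max_ideal A = ext PP"
    using A.local_ringI[OF id] by auto
qed

definition pow :: "nat \<Rightarrow> 'r set" where "pow k = cont (ideal_pow A (max_ideal A) k)"

lemma ideal_max: "ideal (max_ideal A) A"
  unfolding max_ideal_A by (rule ideal_ext[OF satideal_PP ker_PP])

lemma ideal_ideal_pow: "ideal (ideal_pow A (max_ideal A) k) A"
  by (induction k) (auto intro: A.oneideal A.ideal_prod_is_ideal ideal_max)

lemma F_ker: "F \<in> ker" by (simp add: ker_F)

sublocale local_powers PP F pow
proof
  show "tprime PP" by (rule prime_PP)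
  show "F \<in> PP" using F_ker ker_PP by blast
  show "pow 0 = UNIV" using one_PP by (auto simp: pow_def cont_def intro: kap_carrier)
  show "satideal PP (pow k)" for k unfolding pow_def by (rule satideal_cont[OF ideal_ideal_pow])
  show "F \<in> pow k" for k unfolding pow_def using ker_in_ideal[OF ideal_ideal_pow] F_ker by blast
  show "p * f \<in> pow (Suc k)" if "p \<in> PP" "f \<in> pow k" for k p f
  proof -
    have "kap p 1 \<in> max_ideal A" using that one_PP by (auto simp: max_ideal_A ext_def)
    then have "kap p 1 \<otimes>\<^bsub>A\<^esub> kap f 1 \<in> ideal_pow A (max_ideal A) (Suc k)"
      using that by (auto simp: pow_def cont_def intro: ideal_prod.prod)
    then show ?thesis using one_PP by (simp add: kap_mult pow_def cont_def)
  qed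
  show "pow (Suc k) \<subseteq> C" if C: "satideal PP C" "F \<in> C"
    and mult: "\<And>p f. p \<in> PP \<Longrightarrow> f \<in> pow k \<Longrightarrow> p * f \<in> C" for k C
  proof -
    have kC: "ker \<subseteq> C" using tideal_dvd[OF satideal_tideal[OF C(1)] C(2)] by (auto simp: ker_F)
    interpret E: ideal "ext C" A by (rule ideal_ext[OF C(1) kC])
    have "x \<in> ext C" if "x \<in> ideal_pow A (max_ideal A) (Suc k)" for x
      using that unfolding ideal_pow.simps
    proof (induction rule: ideal_prod.induct)
      case (prod i j)
      then obtain p g where i: "i = kap p g" "p \<in> PP" "g \<notin> PP" by (auto simp: max_ideal_A ext_def)
      have "j \<in> carrier A" using prod ideal.Icarr[OF ideal_ideal_pow] by blast
      then obtain f g' where j: "j = kap f g'" "g' \<notin> PP" by (rule A_carrierE)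
      have "f \<in> pow k" using prod(2) j kap_in_iff[OF ideal_ideal_pow] by (simp add: pow_def)
      from mult[OF i(2) this] show ?case
        using i j tprime_not_mult[OF prime_PP i(3) j(2)] by (auto simp: kap_mult ext_def)
    qed (simp add: E.a_closed)
    then show ?thesis using in_ext_iff[OF C(1) kC one_PP] unfolding pow_def cont_def by blast
  qed
qed

text \<open>Contraction and extension are mutually inverse and preserve inclusions, so chains of
  ideals of the localization correspond to chains of saturated ideals.\<close>

lemma quot_length_eq:
  assumes J: "ideal J A" shows "quot_length A J = slen PP (cont J)"
proof -
  have "(\<exists>C. (\<forall>i\<le>n. ideal (C i) A \<and> J \<subseteq> C i) \<and> (\<forall>i<n. C i \<subset> C (Suc i))) \<longleftrightarrow>
    (\<exists>C. satchain PP (cont J) n C)" for n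
  proof
    assume "\<exists>C. (\<forall>i\<le>n. ideal (C i) A \<and> J \<subseteq> C i) \<and> (\<forall>i<n. C i \<subset> C (Suc i))"
    then obtain C where C: "\<And>i. i \<le> n \<Longrightarrow> ideal (C i) A \<and> J \<subseteq> C i" "\<And>i. i < n \<Longrightarrow> C i \<subset> C (Suc i)"
      by blast
    have "satchain PP (cont J) n (\<lambda>i. cont (C i))"
      unfolding satchain_def
    proof (intro conjI allI impI)
      fix i assume "i \<le> n"
      then show "satideal PP (cont (C i))" "cont J \<subseteq> cont (C i)"
        using C(1)[of i] satideal_cont cont_mono_iff[OF J] by auto
    next
      fix i assume "i < n"
      then show "cont (C i) \<subset> cont (C (Suc i))"
        using C(1)[of i] C(1)[of "Suc i"] C(2)[of i] cont_mono_iff[of "C i" "C (Suc i)"]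
          cont_mono_iff[of "C (Suc i)" "C i"] by auto
    qed
    then show "\<exists>C. satchain PP (cont J) n C" by blast
  next
    assume "\<exists>C. satchain PP (cont J) n C"
    then obtain C where C: "\<And>i. i \<le> n \<Longrightarrow> satideal PP (C i) \<and> cont J \<subseteq> C i" "\<And>i. i < n \<Longrightarrow> C i \<subset> C (Suc i)"
      by (auto simp: satchain_def)
    have kC: "ker \<subseteq> C i" if "i \<le> n" for i using ker_in_ideal[OF J] C(1)[OF that] by blast
    have id: "ideal (ext (C i)) A" and ce: "cont (ext (C i)) = C i" if "i \<le> n" for i
      using ideal_ext cont_ext kC[OF that] C(1)[OF that] by auto
    have "\<forall>i\<le>n. ideal (ext (C i)) A \<and> J \<subseteq> ext (C i)"
      using id ce C(1) cont_mono_iff[OF J id] by auto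
    moreover have "\<forall>i<n. ext (C i) \<subset> ext (C (Suc i))"
    proof (intro allI impI)
      fix i assume i: "i < n"
      then have "i \<le> n" "Suc i \<le> n" by auto
      then show "ext (C i) \<subset> ext (C (Suc i))"
        using C(2)[OF i] ce cont_mono_iff[OF id id] unfolding less_le_not_le by metis
    qed
    ultimately show "\<exists>C. (\<forall>i\<le>n. ideal (C i) A \<and> J \<subseteq> C i) \<and> (\<forall>i<n. C i \<subset> C (Suc i))"
      by (intro exI[of _ "\<lambda>i. ext (C i)"] conjI)
  qed
  then show ?thesis unfolding quot_length_def slen_def by (simp only:)
qed

lemma has_multiplicity_iff: "has_multiplicity (localization R P) d \<longleftrightarrow> hs_mult d"
  unfolding A_eq has_multiplicity_def hs_mult_def quot_length_eq[OF ideal_ideal_pow] pow_def ..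

end

section \<open>The ring of a surface\<close>

definition cls :: "'a::field ps3 \<Rightarrow> 'a ps3 \<Rightarrow> 'a ps3 set"
  where "cls F f = surface_ideal F +>\<^bsub>ring_of_type_algebra\<^esub> f"

lemma quo_type_algebra: "quo (ring_of_type_algebra :: 'r::comm_ring_1 ring) id"
proof -
  interpret cring "ring_of_type_algebra :: 'r ring" by (rule cring_from_type_algebra)
  show ?thesis by unfold_locales (auto simp: ring_of_type_algebra_def)
qed

lemma surface_ideal_eq: "surface_ideal F = {f. F dvd f}"
  and ideal_surface_ideal: "ideal (surface_ideal F) ring_of_type_algebra"
proof -
  interpret quo "ring_of_type_algebra :: 'a ps3 ring" id by (rule quo_type_algebra)
  show "surface_ideal F = {f. F dvd f}"
    unfolding surface_ideal_def by (subst cgenideal_eq_genideal[symmetric])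
      (auto simp: cgenideal_def ring_of_type_algebra_def dvd_def mult.commute)
  show "ideal (surface_ideal F) ring_of_type_algebra"
    unfolding surface_ideal_def by (rule genideal_ideal) (simp add: ring_of_type_algebra_def)
qed

lemma quo_surface: "quo (surface_ring F) (cls F)"
  and ker_surface: "quo.ker (surface_ring F) (cls F) = {f. F dvd f}"
proof -
  interpret quo "ring_of_type_algebra :: 'a ps3 ring" id by (rule quo_type_algebra)
  have *: "(\<lambda>f. surface_ideal F +>\<^bsub>ring_of_type_algebra\<^esub> id f) = cls F" by (simp add: cls_def fun_eq_iff)
  show "quo (surface_ring F) (cls F)"
    using quo_Quot(1)[OF ideal_surface_ideal[of F]] unfolding * surface_ring_def .
  show "quo.ker (surface_ring F) (cls F) = {f. F dvd f}"
    using quo_Quot(2)[OF ideal_surface_ideal[of F]] unfolding * surface_ring_def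
    by (simp add: pre_def surface_ideal_eq)
qed

lemma surface_const_eq: "surface_const F c = cls F (ps_const c)"
  by (simp add: surface_const_def cls_def)

text \<open>A series with nonzero constant term is invertible, and so is its class in every quotient
  of K[[X,Y,Z]].\<close>

lemma quo_local:
  fixes h :: "'a::field ps3 \<Rightarrow> 'b"
  assumes "quo R h" "1 \<notin> quo.ker R h"
  shows "local_ring R" "max_ideal R = h ` mm" "quo.ker R h \<subseteq> mm"
proof -
  interpret quo R h by fact
  show k: "ker \<subseteq> mm" using proper_in_mm[OF tideal_ker assms(2)] by blast
  have pre: "pre (h ` mm) = mm" by (rule pre_image[OF tideal_mm k])
  have "h 1 \<notin> h ` mm" using pre tprime_1[OF tprime_mm] by (metis in_pre)
  moreover have "a \<in> Units R" if a: "a \<in> carrier R" "a \<notin> h ` mm" for a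
  proof -
    obtain f where f: "a = h f" "f \<notin> mm" using a by (auto elim!: carrierE)
    then obtain g where "f * g = 1" using ps_unit by blast
    then have "h f \<otimes>\<^bsub>R\<^esub> h g = \<one>\<^bsub>R\<^esub>" "h g \<otimes>\<^bsub>R\<^esub> h f = \<one>\<^bsub>R\<^esub>" by (simp_all add: h_mult h_one mult.commute)
    then show ?thesis unfolding Units_def f by blast
  qed
  ultimately show "local_ring R" "max_ideal R = h ` mm"
    using local_ringI[OF ideal_image[OF tideal_mm]] by (auto simp: h_one)
qed

lemma krull_dim_le:
  assumes "\<And>n C. (\<forall>i\<le>n. primeideal (C i) R) \<Longrightarrow> (\<forall>i<n. C i \<subset> C (Suc i)) \<Longrightarrow> n \<le> d"
  shows "krull_dim R \<le> enat d"
  unfolding krull_dim_def by (intro Sup_least) (auto dest: assms)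

lemma (in quo) Idl_principal: "Idl {h p} = {h (p * a) |a. True}"
proof -
  have "Idl {h p} = PIdl (h p)" by (simp add: cgenideal_eq_genideal)
  also have "\<dots> = {x \<otimes> h p |x. x \<in> range h}" by (simp add: cgenideal_def carrier_eq)
  also have "\<dots> = {h a \<otimes> h p |a. True}" by blast
  finally show ?thesis by (simp add: h_mult mult.commute)
qed

text \<open>Regularity in dimension one provides a single generator of the maximal ideal of the
  quotient, which is lifted to \<open>p\<close>. The relation \<open>rel\<close> then feeds the
  Hilbert function bound; it is a hypothesis so that \<open>cubic\<close> and its reflection are
  both covered.\<close>

theorem no_permitted_curve:
  fixes F :: "'a::field ps3"
  assumes F: "F \<in> mm" "ps_order F = 3"
    and rel: "\<And>P p. tprime P \<Longrightarrow> F \<in> P \<Longrightarrow> p \<in> mm \<Longrightarrow> (\<And>f. f \<in> mm \<Longrightarrow> \<exists>a. f - p * a \<in> P) \<Longrightarrow> \<not> mm \<subseteq> P \<Longrightarrow>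
      \<exists>u v w q s b. u \<in> P \<and> v \<in> P \<and> w \<in> P \<and> s \<notin> P \<and> b \<in> P \<and>
        (\<forall>p\<in>P. \<exists>a c. p = u * a + v * c) \<and> s * u\<^sup>2 = v * w + F * q \<and>
        (\<forall>k f. F dvd b ^ k * f \<longrightarrow> F dvd f)"
  shows "\<not> permitted_curve F C"
proof
  assume perm: "permitted_curve F C"
  interpret quo "surface_ring F" "cls F" by (rule quo_surface)
  have prC: "primeideal C (surface_ring F)" using perm unfolding permitted_curve_def by blast
  interpret loc "surface_ring F" "cls F" C F
    by (intro loc.intro loc_axioms.intro quo_surface prC ker_surface)
  note Q = quo_Quot[OF ideal_P]
  interpret Q: quo "surface_ring F Quot C" "\<lambda>f. C +>\<^bsub>surface_ring F\<^esub> cls F f" by (rule Q)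
  let ?Q = "surface_ring F Quot C" and ?h = "\<lambda>f. C +>\<^bsub>surface_ring F\<^esub> cls F f"
  note Qloc = quo_local[OF Q(1), unfolded Q(2), OF one_PP]
  have reg: "regular_local_ring ?Q" and dim: "krull_dim ?Q = 1"
    and mult: "has_multiplicity (localization (surface_ring F) C) 3"
    using perm unfolding permitted_curve_def F(2) by blast+
  from reg dim obtain S where S: "S \<subseteq> carrier ?Q" "max_ideal ?Q = Idl\<^bsub>?Q\<^esub> S" "enat (card S) = 1"
    unfolding regular_local_ring_def by metis
  then have "card S = 1" by (simp add: one_enat_def)
  then obtain x where "S = {x}" by (rule card_1_singletonE)
  moreover then obtain p where "x = ?h p" using S(1) Q.carrierE by blast
  ultimately have max: "?h ` mm = Idl\<^bsub>?Q\<^esub> {?h p}" using S(2) Qloc(2) by simp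
  have pre_mm: "Q.pre (?h ` mm) = mm" using Qloc(3) by (intro Q.pre_image tideal_mm) (simp add: Q(2))
  have "?h (p * 1) \<in> ?h ` mm" unfolding max Q.Idl_principal by blast
  then have p: "p \<in> mm" using pre_mm Q.in_pre[of p] by auto
  have gen: "\<exists>a. f - p * a \<in> PP" if "f \<in> mm" for f
  proof -
    have "?h f \<in> Idl\<^bsub>?Q\<^esub> {?h p}" using that max by blast
    then obtain a where "?h f = ?h (p * a)" unfolding Q.Idl_principal by blast
    then have "f - p * a \<in> Q.ker" by (simp add: Q.h_eq_iff Q.in_ker)
    then show ?thesis using Q(2) by blast
  qed
  \<comment> \<open>Otherwise every prime of the quotient would have preimage \<open>mm\<close>, so
    the dimension would be zero.\<close>
  have nP: "\<not> mm \<subseteq> PP"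
  proof
    assume mP: "mm \<subseteq> PP"
    have "krull_dim ?Q \<le> enat 0"
    proof (rule krull_dim_le)
      fix n D assume D: "\<forall>i\<le>n. primeideal (D i) ?Q" "\<forall>i<n. D i \<subset> D (Suc i)"
      have preD: "Q.pre (D i) = mm" if "i \<le> n" for i
      proof -
        have id: "ideal (D i) ?Q" using D(1) that by (simp add: primeideal_def)
        then have pr: "tprime (Q.pre (D i))" using Q.prime_pre_iff D(1) that by blast
        have "Q.pre (D i) \<subseteq> mm"
          by (intro subsetI) (rule proper_in_mm[OF tprime_tideal[OF pr] tprime_1[OF pr]])
        moreover have "mm \<subseteq> Q.pre (D i)" using Q.ker_pre[OF id] mP Q(2) by blast
        ultimately show ?thesis by blast
      qed
      show "n \<le> 0"
      proof (rule ccontr)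
        assume "\<not> n \<le> 0"
        then have n: "0 < n" by simp
        have "ideal (D 1) ?Q" using D(1) n by (simp add: primeideal_def)
        then have "D 1 \<subseteq> carrier ?Q" by (intro subsetI) (rule ideal.Icarr)
        moreover have "Q.pre (D 1) \<subseteq> Q.pre (D 0)" using preD[of 0] preD[of 1] n by simp
        ultimately have "D 1 \<subseteq> D 0" using Q.pre_subset_iff by blast
        then show False using D(2) n by auto
      qed
    qed
    then show False using dim by (simp add: one_enat_def)
  qed
  have "\<exists>u v w q s b. u \<in> PP \<and> v \<in> PP \<and> w \<in> PP \<and> s \<notin> PP \<and> b \<in> PP \<and>
        (\<forall>p\<in>PP. \<exists>a c. p = u * a + v * c) \<and> s * u\<^sup>2 = v * w + F * q \<and>
        (\<forall>k f. F dvd b ^ k * f \<longrightarrow> F dvd f)"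
    by (rule rel[OF prime_PP F_in_P p _ nP]) (rule gen)
  then obtain u v w q s b where uv: "u \<in> PP" "v \<in> PP" "w \<in> PP" "s \<notin> PP" "b \<in> PP"
    "\<forall>p\<in>PP. \<exists>a c. p = u * a + v * c" "s * u\<^sup>2 = v * w + F * q" "\<forall>k f. F dvd b ^ k * f \<longrightarrow> F dvd f"
    by blast
  have "\<not> hs_mult 3"
  proof (rule not_hs_mult_3[OF uv(1,2) _ uv(4,7,3,5)])
    show "\<exists>a c. p = u * a + v * c" if "p \<in> PP" for p using uv(6) that by blast
    show "F dvd f" if "F dvd b ^ k * f" for k f using uv(8) that by blast
  qed
  then show False using mult has_multiplicity_iff by simp
qed

section \<open>The curve X = Z = 0 as a permitted curve\<close>

lemma cubic_in_mm: "(cubic m r :: 'a::comm_ring_1 ps3) \<in> mm"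
  using ps_coeff_cubic_mult[of m r "1 :: 'a ps3" 0 0 0] by (simp add: in_mm_iff)

text \<open>Modulo X and Z only K[[Y]] remains, where ideals are determined by an order:
  \<open>n\<close> is the least order of a nonzero restriction to the axis, and an element attaining
  it is Y^n times a unit.\<close>

lemma axis_ideal:
  fixes N :: "'a::field ps3 set"
  assumes N: "tideal N" "wt 1 0 1 1 \<subseteq> N" "N \<noteq> wt 1 0 1 1"
  obtains n where "ps_Y ^ n \<in> N" "\<And>f. f \<in> N \<Longrightarrow> \<exists>g. f - ps_Y ^ n * g \<in> wt 1 0 1 1"
proof -
  define n where "n = (LEAST n. \<exists>f\<in>N. axis_part f \<noteq> 0 \<and> subdegree (axis_part f) = n)"
  have "\<exists>f\<in>N. axis_part f \<noteq> 0" using N(2,3) axis_part_eq_0_iff by blast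
  then have "\<exists>f\<in>N. axis_part f \<noteq> 0 \<and> subdegree (axis_part f) = n"
  proof -
    assume "\<exists>f\<in>N. axis_part f \<noteq> 0"
    then have "\<exists>k. \<exists>f\<in>N. axis_part f \<noteq> 0 \<and> subdegree (axis_part f) = k" by metis
    then show ?thesis unfolding n_def by (rule LeastI_ex)
  qed
  then obtain f0 where f0: "f0 \<in> N" "axis_part f0 \<noteq> 0" "subdegree (axis_part f0) = n" by blast
  have least: "n \<le> subdegree (axis_part f)" if "f \<in> N" "axis_part f \<noteq> 0" for f
    unfolding n_def using that by (intro Least_le) blast
  define \<iota> :: "'a fps \<Rightarrow> 'a ps3" where "\<iota> = fps_const \<circ> fmap fps_const"
  have axis_\<iota>: "axis_part (\<iota> g) = g" for g by (simp add: fps_eq_iff axis_part_nth \<iota>_def ps_coeff_def)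
  have axis_Y: "axis_part ps_Y = fps_X" by (simp add: fps_eq_iff axis_part_nth ps_coeff_def ps_Y_def fps_X_def)
  have repr: "f - ps_Y ^ n * \<iota> (fps_shift n (axis_part f)) \<in> wt 1 0 1 1" if "axis_part f \<noteq> 0 \<Longrightarrow> n \<le> subdegree (axis_part f)" for f
  proof -
    have "axis_part f = fps_X ^ n * fps_shift n (axis_part f)"
    proof (cases "axis_part f = 0")
      case False
      have "fps_nth (axis_part f) k = 0" if "k < n" for k
        using that \<open>axis_part f \<noteq> 0 \<Longrightarrow> n \<le> subdegree (axis_part f)\<close>[OF False] by (intro nth_less_subdegree_zero) simp
      then show ?thesis by (intro fps_ext) (simp add: fps_X_power_mult_nth)
    qed simp
    then have "axis_part (f - ps_Y ^ n * \<iota> (fps_shift n (axis_part f))) = 0"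
      by (simp add: rhom_simps[OF rhom_axis_part] axis_\<iota> axis_Y)
    then show ?thesis by (simp only: axis_part_eq_0_iff)
  qed
  show thesis
  proof (rule that)
    let ?g = "\<iota> (fps_shift n (axis_part f0))"
    have "ps_coeff ?g 0 0 0 = fps_nth (axis_part ?g) 0" by (simp add: axis_part_nth)
    then have "?g \<notin> mm" using nth_subdegree_nonzero[OF f0(2)] f0(3) by (simp add: in_mm_iff axis_\<iota>) 
    then obtain g' where g': "?g * g' = 1" by (rule ps_unit)
    have "f0 - ps_Y ^ n * ?g \<in> N" using repr[of f0] f0 N(2) by blast
    then have "ps_Y ^ n * ?g \<in> N" using tideal_cong[OF N(1)] f0(1) by blast
    then have "ps_Y ^ n * ?g * g' \<in> N" by (rule tideal_mult_right[OF N(1)])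
    then show "ps_Y ^ n \<in> N" by (simp add: mult.assoc g')
    show "\<exists>g. f - ps_Y ^ n * g \<in> wt 1 0 1 1" if "f \<in> N" for f
      using repr[of f] least[OF that] by blast
  qed
qed

text \<open>The quotient is a copy of K[[Y]]. All ideals are principal, generated by zero or a power
  of Y, and a nonzero prime contains Y, so chains of primes have at most two members.\<close>

lemma axis_regular:
  fixes h :: "'a::field ps3 \<Rightarrow> 'b"
  assumes Q: "quo Q h" and ker: "quo.ker Q h = wt 1 0 1 1"
  shows "regular_local_ring Q" "krull_dim Q = 1"
proof -
  let ?P = "wt 1 0 1 1 :: 'a ps3 set"
  interpret Q: quo Q h by (rule Q)
  note kerQ = ker
  have idP: "tideal ?P" by (rule tideal_wt)
  note Qloc = quo_local[OF Q, unfolded kerQ, OF tprime_1[OF tprime_axis]]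
  have Y_mm: "h ` mm = Idl\<^bsub>Q\<^esub> {h ps_Y}"
  proof -
    have "\<exists>a. h f = h (ps_Y * a)" if "f \<in> mm" for f
    proof -
      obtain a b c where f: "f = ps_const (ps_coeff f 0 0 0) + ps_X * a + ps_Y * b + ps_Z * c"
        using ps_decompose_ex by blast
      moreover have "ps_const (ps_coeff f 0 0 0) = 0" using that by (simp add: in_mm_iff ps_const_def)
      ultimately have "f - ps_Y * b = ps_X * a + ps_Z * c" by (simp add: algebra_simps)
      moreover have XZ: "(ps_X :: 'a ps3) \<in> ?P" "(ps_Z :: 'a ps3) \<in> ?P"
        using X_power_in_wt[where 'a = 'a, of 1 1 0 1] Z_power_in_wt[where 'a = 'a, of 1 1 0 1] by simp_all
      ultimately have "f - ps_Y * b \<in> Q.ker"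
        using tideal_add[OF idP tideal_mult_right[OF idP XZ(1), of a] tideal_mult_right[OF idP XZ(2), of c]]
        by (simp only: kerQ)
      then have "h f = h (ps_Y * b)" by (simp only: Q.h_eq_iff Q.in_ker)
      then show ?thesis by blast
    qed
    then show ?thesis unfolding Q.Idl_principal
      using tideal_mult_right[OF tideal_mm gens_in_mm(2)] by auto
  qed
  have Y_P: "(ps_Y :: 'a ps3) \<notin> ?P"
  proof
    assume "(ps_Y :: 'a ps3) \<in> ?P"
    then have "fps_nth (axis_part (ps_Y :: 'a ps3)) 1 = fps_nth 0 1" by (simp only: axis_part_eq_0_iff[symmetric])
    then show False by (simp add: axis_part_nth ps_coeff_def ps_Y_def)
  qed
  have noeth: "noetherian_ring Q"
  proof (intro noetherian_ring.intro noetherian_ring_axioms.intro Q.ring_axioms)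
    fix I assume I: "ideal I Q"
    have carr: "I \<subseteq> carrier Q" using ideal.Icarr[OF I] by blast
    have idI: "tideal (Q.pre I)" "?P \<subseteq> Q.pre I" using Q.tideal_pre[OF I] Q.ker_pre[OF I] kerQ by auto
    have "\<exists>p. I = Idl\<^bsub>Q\<^esub> {h p}"
    proof (cases "Q.pre I = ?P")
      case True
      have "I = h ` ?P" using Q.image_pre[OF carr] True by simp
      also have "\<dots> = {h 0}"
      proof -
        have "h f = h 0" if "f \<in> ?P" for f using that by (simp only: kerQ[symmetric] Q.in_ker Q.h_zero)
        then show ?thesis using tideal_0[OF idP] by blast
      qed
      finally show ?thesis by (intro exI[of _ 0]) (simp add: Q.Idl_principal)
    next
      case False
      then obtain n where n: "ps_Y ^ n \<in> Q.pre I" "\<And>f. f \<in> Q.pre I \<Longrightarrow> \<exists>g. f - ps_Y ^ n * g \<in> ?P"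
        using axis_ideal[OF idI] by metis
      have "I = Idl\<^bsub>Q\<^esub> {h (ps_Y ^ n)}"
        unfolding Q.Idl_principal
      proof (intro equalityI subsetI)
        fix x assume x: "x \<in> I"
        then obtain f where f: "x = h f" using carr Q.carrierE by blast
        then obtain g where "f - ps_Y ^ n * g \<in> Q.ker" using n(2)[of f] x by (auto simp: Q.in_pre kerQ)
        then have "h f = h (ps_Y ^ n * g)" by (simp add: Q.h_eq_iff Q.in_ker)
        then show "x \<in> {h (ps_Y ^ n * a) |a. True}" using f by blast
      next
        fix x assume "x \<in> {h (ps_Y ^ n * a) |a. True}"
        then show "x \<in> I" using tideal_mult_right[OF idI(1) n(1)] by (auto simp: Q.in_pre)
      qed
      then show ?thesis by blast
    qed
    then show "\<exists>A\<subseteq>carrier Q. finite A \<and> I = Idl\<^bsub>Q\<^esub> A" by (metis Q.h_carrier empty_subsetI finite.emptyI finite_insert insert_subset)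
  qed
  have "krull_dim Q \<le> enat 1"
  proof (rule krull_dim_le)
    fix n D assume D: "\<forall>i\<le>n. primeideal (D i) Q" "\<forall>i<n. D i \<subset> D (Suc i)"
    show "n \<le> 1"
    proof (rule ccontr)
      assume "\<not> n \<le> 1"
      then have n: "2 \<le> n" by simp
      have id: "ideal (D i) Q" if "i \<le> 2" for i
        using D(1) that n by (simp add: primeideal_def)
      have carr: "D i \<subseteq> carrier Q" if "i \<le> 2" for i
        using ideal.Icarr[OF id[OF that]] by blast
      have "D 0 \<subset> D (Suc 0)" "D (Suc 0) \<subset> D (Suc (Suc 0))" using D(2) n by auto
      then have lt: "D 0 \<subset> D 1" "D 1 \<subset> D 2" by (simp_all add: numeral_2_eq_2)
      have pr: "tprime (Q.pre (D i))" if "i \<le> 2" for i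
        using Q.prime_pre_iff[OF id[OF that]] D(1) that n by auto
      have "?P \<subseteq> Q.pre (D 0)" using Q.ker_pre[OF id[of 0]] kerQ by simp
      moreover have "\<not> Q.pre (D 1) \<subseteq> Q.pre (D 0)" using Q.pre_subset_iff[OF carr[of 1]] lt by auto
      ultimately have "Q.pre (D 1) \<noteq> ?P" by blast
      moreover have "?P \<subseteq> Q.pre (D 1)" using Q.ker_pre[OF id[of 1]] kerQ by simp
      ultimately obtain k where "ps_Y ^ k \<in> Q.pre (D 1)"
        using axis_ideal[OF Q.tideal_pre[OF id[of 1]]] by (metis one_le_numeral)
      then have "ps_Y \<in> Q.pre (D 1)" using tprime_power[OF pr[of 1]] by simp
      then have "Idl\<^bsub>Q\<^esub> {h ps_Y} \<subseteq> D 1"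
        using Q.genideal_minimal[OF id[of 1]] by (simp add: Q.in_pre)
      then have "h ` mm \<subseteq> D 1" unfolding Y_mm .
      then have "mm \<subseteq> Q.pre (D 1)" unfolding Q.pre_def by blast
      moreover have "Q.pre (D 2) \<subseteq> mm"
        using proper_in_mm[OF tprime_tideal[OF pr[of 2]] tprime_1[OF pr[of 2]]] by auto
      ultimately have "D 2 \<subseteq> D 1" using Q.pre_subset_iff[OF carr[of 2], of "D 1"] by auto
      then show False using lt by blast
    qed
  qed
  moreover have "enat 1 \<le> krull_dim Q"
  proof -
    define D where "D = (\<lambda>i::nat. if i = 0 then h ` ?P else h ` mm)"
    have "?P \<subseteq> mm" using Qloc(3) .
    have pre: "Q.pre (h ` ?P) = ?P" "Q.pre (h ` mm) = mm"
      using \<open>?P \<subseteq> mm\<close> by (auto intro!: Q.pre_image tideal_wt tideal_mm simp: kerQ)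
    have "primeideal (h ` ?P) Q" "primeideal (h ` mm) Q"
      using Q.prime_pre_iff[OF Q.ideal_image[OF idP]] Q.prime_pre_iff[OF Q.ideal_image[OF tideal_mm]]
        tprime_axis tprime_mm pre by auto
    moreover have "h ` ?P \<subset> h ` mm"
      using pre \<open>?P \<subseteq> mm\<close> Y_P gens_in_mm(2) by (metis image_mono psubsetI)
    ultimately have "\<exists>C. (\<forall>i\<le>1::nat. primeideal (C i) Q) \<and> (\<forall>i<1. C i \<subset> C (Suc i))"
      by (intro exI[of _ D]) (auto simp: D_def)
    then show ?thesis unfolding krull_dim_def by (intro Sup_upper) auto
  qed
  ultimately show dim: "krull_dim Q = 1" by (simp add: one_enat_def)
  show "regular_local_ring Q"
    unfolding regular_local_ring_def
    using Qloc(1,2) noeth Y_mm dim by (auto intro!: exI[of _ "{h ps_Y}"] simp: one_enat_def)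
qed

text \<open>With r = 3 every monomial of the equation has degree at least three in X and Z, so the
  ideal of the axis contains the equation and the multiplicity count along it applies.\<close>

theorem permitted_axis:
  fixes m :: nat
  assumes m: "m \<ge> 3" and ord: "ps_order (cubic m 3 :: 'a::field ps3) = 3"
  shows "permitted_curve (cubic m 3 :: 'a ps3) (cls (cubic m 3) ` wt 1 0 1 1)"
proof -
  let ?F = "cubic m 3 :: 'a ps3" and ?P = "wt 1 0 1 1 :: 'a ps3 set"
  let ?C = "cls ?F ` ?P"
  interpret quo "surface_ring ?F" "cls ?F" by (rule quo_surface)
  have idX: "tideal ?P" by (rule tideal_wt)
  have FP: "?F \<in> ?P" using wt_antimono[of 1 3, OF _ cubic_in_wt[of m 3 0]] m by simp
  have kerP: "ker \<subseteq> ?P" using tideal_dvd[OF idX FP] by (auto simp: ker_surface)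
  note preC = pre_image[OF idX kerP] and idC = ideal_image[OF idX]
  have primeC: "primeideal ?C (surface_ring ?F)"
    unfolding prime_pre_iff[OF idC] preC by (rule tprime_axis)
  interpret loc "surface_ring ?F" "cls ?F" ?C ?F
    by (intro loc.intro loc_axioms.intro quo_surface primeC ker_surface)
  note Q = quo_Quot[OF idC]
  let ?Q = "surface_ring ?F Quot ?C" and ?h = "\<lambda>f. ?C +>\<^bsub>surface_ring ?F\<^esub> cls ?F f"
  have kerQ: "quo.ker ?Q ?h = ?P" using Q(2) preC by simp
  note reg = axis_regular[OF Q(1) kerQ]
  have "hs_mult 3"
    using axis_hs_mult_3[OF m, of pow] local_powers_axioms unfolding preC by simp
  then show ?thesis
    unfolding permitted_curve_def ord has_multiplicity_iff[symmetric] using primeC reg by blast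
qed

section \<open>Completed local rings of a blowing-up\<close>

text \<open>\<open>\<Phi>\<close> is the substitution of a chart, \<open>F\<close> and \<open>G\<close> are the equations before and after the
  blowing-up; \<open>I d\<close> is the \<open>d\<close>-th power of the ideal of the center, and the chart is centered at the
  point where \<open>y / X\<close> and \<open>z / X\<close> take the values \<open>Y\<close> and \<open>Z\<close>.\<close>

locale chart =
  fixes F G :: "'a::field ps3" and \<Phi> :: "'a ps3 \<Rightarrow> 'a ps3" and I :: "nat \<Rightarrow> 'a ps3 set"
    and J :: "nat \<Rightarrow> nat \<Rightarrow> 'a ps3 set" and y z :: "'a ps3"
  assumes hom: "rhom \<Phi>" and \<Phi>_F: "G dvd \<Phi> F" and \<Phi>_X: "\<Phi> ps_X = ps_X"
    and \<Phi>_const: "\<Phi> (ps_const c) = ps_const c" and \<Phi>_y: "\<Phi> y = ps_X * ps_Y"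
    and \<Phi>_z: "\<Phi> z = ps_X * ps_Z" and \<Phi>_mm: "\<Phi> f \<in> mm \<longleftrightarrow> f \<in> mm"
    and I_0: "I 0 = UNIV" and I_ideal: "tideal (I d)"
    and I_mult: "f \<in> I d \<Longrightarrow> g \<in> I d' \<Longrightarrow> f * g \<in> I (d + d')"
    and X_I: "ps_X \<in> I 1" and y_I: "y \<in> I 1" and z_I: "z \<in> I 1"
    and I_Suc: "f \<in> I (Suc d) \<Longrightarrow> \<exists>a\<in>I d. \<exists>b\<in>I d. \<exists>c\<in>I d. f = ps_X * a + y * b + z * c"
    and I_div: "f \<in> I d \<Longrightarrow> \<exists>h. \<Phi> f = ps_X ^ d * h"
    and kernel: "G dvd \<Phi> f \<Longrightarrow> F dvd f"
    and jet: "f \<in> I d \<Longrightarrow> G dvd \<Phi> f - ps_X ^ d * h \<Longrightarrow> h \<in> wt 1 1 1 k \<Longrightarrow> \<exists>f0\<in>J d k. F dvd f - f0"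
    and J_I: "J d k \<subseteq> I d"
    and J_Suc: "f \<in> J d (Suc k) \<Longrightarrow> \<exists>a\<in>J d k. \<exists>b\<in>J d k. \<exists>c\<in>J d k.
        ps_X * f = ps_X * ps_X * a + y * b + z * c"
    and dense: "\<exists>d f h'. f \<in> I d \<and> \<Phi> f = ps_X ^ d * h' \<and> h' - h \<in> wt 1 1 1 k"
    and X_cancel: "G dvd ps_X ^ d * f \<Longrightarrow> G dvd f"
    and F_mm: "F \<in> mm" and G_mm: "G \<in> mm"
    and separated: "(\<And>k. \<exists>q. f - G * q \<in> wt 1 1 1 k) \<Longrightarrow> G dvd f"
begin

definition center :: "'a ps3 set set" where "center = cls F ` I 1"

sublocale R: quo "surface_ring F" "cls F" by (rule quo_surface)

abbreviation "R \<equiv> surface_ring F"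

lemma kerR: "R.ker = {f. F dvd f}" by (rule ker_surface)

lemma cls_eq_iff: "cls F f = cls F g \<longleftrightarrow> F dvd f - g"
  using kerR by (simp add: R.h_eq_iff flip: R.in_ker)

lemma ideal_pow_center: "ideal_pow R center d = cls F ` I d"
proof (induction d)
  case 0 then show ?case by (simp add: I_0 R.carrier_eq)
next
  case (Suc d)
  have "x \<in> cls F ` I (Suc d)" if "x \<in> center \<cdot>\<^bsub>R\<^esub> (cls F ` I d)" for x
    using that
  proof (induction rule: ideal_prod.induct)
    case (prod i j)
    then obtain f g where "i = cls F f" "f \<in> I 1" "j = cls F g" "g \<in> I d" by (auto simp: center_def)
    then show ?case using I_mult[of f 1 g d] by (simp add: R.h_mult)
  next
    case (sum s t)
    then show ?case using tideal_add[OF I_ideal] by (auto simp: R.h_add)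
  qed
  moreover have "x \<in> center \<cdot>\<^bsub>R\<^esub> (cls F ` I d)" if x: "x \<in> cls F ` I (Suc d)" for x
  proof -
    from x obtain f where "f \<in> I (Suc d)" "x = cls F f" by blast
    with I_Suc obtain a b c where abc: "a \<in> I d" "b \<in> I d" "c \<in> I d" "x = cls F (ps_X * a + y * b + z * c)"
      by metis
    have gen: "cls F (g * e) \<in> center \<cdot>\<^bsub>R\<^esub> (cls F ` I d)" if "g \<in> I 1" "e \<in> I d" for g e
      unfolding R.h_mult[symmetric] using that by (intro ideal_prod.prod) (auto simp: center_def)
    show ?thesis
      unfolding abc(4) R.h_add[symmetric] by (intro ideal_prod.sum gen X_I y_I z_I abc)
  qed
  ultimately show ?case using Suc by auto
qed

text \<open>\<open>rep d f f'\<close>: \<open>f\<close> lies in the \<open>d\<close>-th power of the center and \<open>f / X^d\<close> is mapped to \<open>f'\<close>.\<close>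

definition rep :: "nat \<Rightarrow> 'a ps3 \<Rightarrow> 'a ps3 \<Rightarrow> bool"
  where "rep d f f' \<longleftrightarrow> (\<exists>f0\<in>I d. F dvd f - f0) \<and> G dvd \<Phi> f - ps_X ^ d * f'"

lemma cls_in_pow: "cls F f \<in> ideal_pow R center d \<longleftrightarrow> (\<exists>f0\<in>I d. F dvd f - f0)"
  unfolding ideal_pow_center by (auto simp: cls_eq_iff)

lemma \<Phi>_cong: "F dvd f - g \<Longrightarrow> G dvd \<Phi> f - \<Phi> g"
  using rhom_dvd[OF hom, of F "f - g"] \<Phi>_F by (auto simp: rhom_diff[OF hom] intro: dvd_trans)

lemma dvd_cong: "G dvd f - g \<Longrightarrow> G dvd f \<longleftrightarrow> G dvd g"
  using dvd_diff[of G f "f - g"] dvd_add[of G "f - g" g] by auto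

lemma rep_exists: assumes "\<exists>f0\<in>I d. F dvd f - f0" obtains f' where "rep d f f'"
proof -
  obtain f0 where f0: "f0 \<in> I d" "F dvd f - f0" using assms by blast
  then obtain f' where f': "\<Phi> f0 = ps_X ^ d * f'" using I_div by blast
  have "G dvd \<Phi> f - ps_X ^ d * f'" using \<Phi>_cong[OF f0(2)] f' by simp
  with f0 that show thesis by (auto simp: rep_def)
qed

text \<open>X is a nonzerodivisor modulo G, so division by X^d has at most one result.\<close>

lemma rep_unique: assumes "rep d f f'" "rep d f f''" shows "G dvd f' - f''"
proof -
  have "G dvd \<Phi> f - ps_X ^ d * f'" "G dvd \<Phi> f - ps_X ^ d * f''" using assms by (auto simp: rep_def)
  from dvd_diff[OF this(2,1)] have "G dvd (\<Phi> f - ps_X ^ d * f'') - (\<Phi> f - ps_X ^ d * f')" .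
  then have "G dvd ps_X ^ d * (f' - f'')" by (simp add: algebra_simps)
  then show ?thesis by (rule X_cancel)
qed

lemma rep_cong: assumes "rep d f f'" "G dvd f' - f''" shows "rep d f f''"
proof -
  have "G dvd (\<Phi> f - ps_X ^ d * f') + ps_X ^ d * (f' - f'')"
    using dvd_add[of G "\<Phi> f - ps_X ^ d * f'"] assms dvd_mult[of G "f' - f''" "ps_X ^ d"] unfolding rep_def by blast
  then show ?thesis using assms(1) by (simp add: rep_def algebra_simps)
qed

lemma rep_cong_F: assumes "rep d f f'" "F dvd f - g" shows "rep d g f'"
proof -
  obtain f0 where f0: "f0 \<in> I d" "F dvd f - f0" using assms(1) by (auto simp: rep_def)
  have "F dvd (f - f0) - (f - g)" by (rule dvd_diff[OF f0(2) assms(2)])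
  then have "F dvd g - f0" by simp
  moreover have "G dvd (\<Phi> f - ps_X ^ d * f') - (\<Phi> f - \<Phi> g)"
    using assms(1) by (intro dvd_diff[OF _ \<Phi>_cong[OF assms(2)]]) (simp add: rep_def)
  then have "G dvd \<Phi> g - ps_X ^ d * f'" by simp
  ultimately show ?thesis unfolding rep_def using f0(1) by blast
qed

lemma rep_mult: assumes "rep d f f'" "rep e g g'" shows "rep (d + e) (f * g) (f' * g')"
proof -
  obtain f0 g0 where f0: "f0 \<in> I d" "F dvd f - f0" and g0: "g0 \<in> I e" "F dvd g - g0"
    using assms by (auto simp: rep_def)
  have "f * g - f0 * g0 = (f - f0) * g + f0 * (g - g0)" by (simp add: algebra_simps)
  then have "F dvd f * g - f0 * g0" using f0 g0 by simp
  moreover have "\<Phi> (f * g) - ps_X ^ (d + e) * (f' * g') =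
      (\<Phi> f - ps_X ^ d * f') * \<Phi> g + ps_X ^ d * f' * (\<Phi> g - ps_X ^ e * g')"
    by (simp add: rhom_mult[OF hom] power_add algebra_simps)
  then have "G dvd \<Phi> (f * g) - ps_X ^ (d + e) * (f' * g')" using assms by (simp add: rep_def)
  ultimately show ?thesis using I_mult[OF f0(1) g0(1)] by (auto simp: rep_def)
qed

lemma rep_add: assumes "rep d f f'" "rep d g g'" shows "rep d (f + g) (f' + g')"
proof -
  obtain f0 g0 where f0: "f0 \<in> I d" "F dvd f - f0" and g0: "g0 \<in> I d" "F dvd g - g0"
    using assms by (auto simp: rep_def)
  have "f + g - (f0 + g0) = (f - f0) + (g - g0)" by simp
  then have "F dvd f + g - (f0 + g0)" using f0 g0 by (metis dvd_add)
  moreover have "\<Phi> (f + g) - ps_X ^ d * (f' + g') = (\<Phi> f - ps_X ^ d * f') + (\<Phi> g - ps_X ^ d * g')"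
    by (simp add: rhom_add[OF hom] algebra_simps)
  then have "G dvd \<Phi> (f + g) - ps_X ^ d * (f' + g')" using assms by (metis dvd_add rep_def)
  ultimately show ?thesis using tideal_add[OF I_ideal f0(1) g0(1)] by (auto simp: rep_def)
qed

lemma rep_0: "rep 0 f (\<Phi> f)"
  unfolding rep_def by (intro conjI bexI[of _ f]) (simp_all add: I_0)

lemma rep_mult_left: assumes "rep d f f'" shows "rep d (g * f) (\<Phi> g * f')"
  using rep_mult[OF rep_0 assms, of g] by simp

lemma rep_minus: "rep d f f' \<Longrightarrow> rep d (- f) (- f')"
  using rep_mult_left[of d f f' "- 1"] by (simp add: rhom_minus[OF hom] rhom_1[OF hom])

lemma rep_diff: assumes "rep d f f'" "rep d g g'" shows "rep d (f - g) (f' - g')"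
  using rep_add[OF assms(1) rep_minus[OF assms(2)]] by simp

text \<open>The substitution induces an injection between the two surface rings, and X^d cancels
  modulo G.\<close>

lemma rep_eq_0: assumes "rep d f f'" shows "F dvd f \<longleftrightarrow> G dvd f'"
proof -
  have "F dvd f \<longleftrightarrow> G dvd \<Phi> f" using \<Phi>_cong[of f 0] kernel by (auto simp: rhom_0[OF hom])
  also have "\<dots> \<longleftrightarrow> G dvd ps_X ^ d * f'" using assms by (intro dvd_cong) (simp add: rep_def)
  also have "\<dots> \<longleftrightarrow> G dvd f'" using X_cancel[of d f'] dvd_mult[of G f' "ps_X ^ d"] by blast
  finally show ?thesis .
qed

lemma rep_I: "f \<in> I d \<Longrightarrow> \<Phi> f = ps_X ^ d * f' \<Longrightarrow> rep d f f'"
  by (auto simp: rep_def intro!: bexI[of _ f])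

lemma X_pow_I: "ps_X ^ d \<in> I d"
proof (induction d)
  case (Suc d) then show ?case using I_mult[OF X_I Suc] by simp
qed (simp add: I_0)

lemma rep_X_pow: "rep d (ps_X ^ d) 1"
  by (rule rep_I[OF X_pow_I]) (simp add: rhom_power[OF hom] \<Phi>_X)

lemma rep_X: "rep 1 ps_X 1" using rep_X_pow[of 1] by simp

lemma rep_y: "rep 1 y ps_Y" by (rule rep_I[OF y_I]) (simp add: \<Phi>_y)

lemma rep_z: "rep 1 z ps_Z" by (rule rep_I[OF z_I]) (simp add: \<Phi>_z)

section \<open>The closed point at the origin of the chart\<close>

lemma G_dvd_mm: "G dvd f \<Longrightarrow> f \<in> mm" using tideal_dvd[OF tideal_mm G_mm] .

lemma rep_mm: assumes "rep d f f'" "rep d f f''" shows "f' \<in> mm \<longleftrightarrow> f'' \<in> mm"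
  using tideal_cong[OF tideal_mm G_dvd_mm[OF rep_unique[OF assms]]] .

text \<open>The degree d part of the homogeneous prime of the origin of the chart: elements whose
  quotient by X^d vanishes there.\<close>

definition pt :: "nat \<Rightarrow> 'a ps3 set set" where "pt d = {cls F f |f f'. rep d f f' \<and> f' \<in> mm}"

lemma in_pt: assumes "rep d f f'" shows "cls F f \<in> pt d \<longleftrightarrow> f' \<in> mm"
proof
  assume "cls F f \<in> pt d"
  then obtain g g' where g: "cls F f = cls F g" "rep d g g'" "g' \<in> mm" by (auto simp: pt_def)
  then have "F dvd g - f" by (metis cls_eq_iff)
  then have "rep d f g'" using rep_cong_F[OF g(2)] by simp
  then show "f' \<in> mm" using rep_mm[OF assms] g(3) by blast
qed (use assms in \<open>auto simp: pt_def\<close>)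

lemma powE: assumes "x \<in> ideal_pow R center d" obtains f f' where "x = cls F f" "rep d f f'"
proof -
  obtain f where f: "f \<in> I d" "x = cls F f" using assms by (auto simp: ideal_pow_center)
  then have "\<exists>f0\<in>I d. F dvd f - f0" by (auto intro!: bexI[of _ f])
  then obtain f' where "rep d f f'" by (rule rep_exists)
  with f that show thesis by blast
qed

lemma rep_pow: "rep d f f' \<Longrightarrow> cls F f \<in> ideal_pow R center d"
  by (simp add: cls_in_pow rep_def)

lemma pt_sub: "pt d \<subseteq> ideal_pow R center d"
  by (auto simp: pt_def rep_pow)

lemma pt_subgroup: "additive_subgroup (pt d) R"
proof (rule additive_subgroup.intro, rule R.add.subgroupI)
  show "pt d \<subseteq> carrier R" by (auto simp: pt_def)
  have "rep d 0 0" using tideal_0[OF I_ideal] by (intro rep_I) (simp_all add: rhom_0[OF hom])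
  then show "pt d \<noteq> {}" using tideal_0[OF tideal_mm] by (auto simp: pt_def)
  show "\<ominus>\<^bsub>R\<^esub> a \<in> pt d" if a: "a \<in> pt d" for a
  proof -
    obtain f f' where f: "a = cls F f" "rep d f f'" "f' \<in> mm" using a by (auto simp: pt_def)
    show ?thesis using rep_minus[OF f(2)] tideal_minus[OF tideal_mm f(3)] unfolding pt_def f(1) R.h_minus by blast
  qed
  show "a \<oplus>\<^bsub>R\<^esub> b \<in> pt d" if ab: "a \<in> pt d" "b \<in> pt d" for a b
  proof -
    obtain f f' where f: "a = cls F f" "rep d f f'" "f' \<in> mm" using ab by (auto simp: pt_def)
    obtain g g' where g: "b = cls F g" "rep d g g'" "g' \<in> mm" using ab by (auto simp: pt_def)
    show ?thesis using rep_add[OF f(2) g(2)] tideal_add[OF tideal_mm f(3) g(3)] f g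
      by (auto simp: pt_def R.h_add)
  qed
qed

lemma blowup_point_pt: "blowup_point R center pt"
  unfolding blowup_point_def
proof (intro conjI allI ballI impI pt_subgroup pt_sub)
  show "a \<otimes>\<^bsub>R\<^esub> b \<in> pt (d + e)" if ab: "a \<in> ideal_pow R center d" "b \<in> pt e" for d e a b
  proof -
    obtain f f' where f: "a = cls F f" "rep d f f'" using ab(1) by (rule powE)
    obtain g g' where g: "b = cls F g" "rep e g g'" "g' \<in> mm" using ab by (auto simp: pt_def)
    show ?thesis using in_pt[OF rep_mult[OF f(2) g(2)]] tideal_mult[OF tideal_mm g(3)] f g
      by (simp add: R.h_mult)
  qed
  show "a \<in> pt d \<or> b \<in> pt e" if ab: "a \<in> ideal_pow R center d" "b \<in> ideal_pow R center e"
    "a \<otimes>\<^bsub>R\<^esub> b \<in> pt (d + e)" for d e a b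
  proof -
    obtain f f' where f: "a = cls F f" "rep d f f'" using ab(1) by (rule powE)
    obtain g g' where g: "b = cls F g" "rep e g g'" using ab(2) by (rule powE)
    have "f' * g' \<in> mm" using ab(3) in_pt[OF rep_mult[OF f(2) g(2)]] f g by (simp add: R.h_mult)
    then show ?thesis using in_pt[OF f(2)] in_pt[OF g(2)] f g tprime_mult_iff[OF tprime_mm] by blast
  qed
  have "cls F ps_X \<notin> pt 1" using in_pt[OF rep_X] tprime_1[OF tprime_mm] by simp
  then show "\<exists>d>0. pt d \<noteq> ideal_pow R center d" using rep_pow[OF rep_X] by (metis zero_less_one)
qed

lemma mm_const_split: "f - ps_const (ps_coeff f 0 0 0) \<in> mm"
  by (simp add: in_mm_iff ps_coeff_const)

text \<open>The residue field of the origin is K. An element of a larger prime \<open>Q'\<close>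
  outside \<open>pt\<close> differs from c X^d, with c a nonzero constant, by an element of
  \<open>pt\<close>; then X^d would lie in \<open>Q'\<close>.\<close>

lemma blowup_closed_point_pt: "blowup_closed_point R center pt"
  unfolding blowup_closed_point_def
proof (intro conjI allI impI blowup_point_pt)
  fix Q' assume Q': "blowup_point R center Q' \<and> (\<forall>d. pt d \<subseteq> Q' d)"
  then have sub: "\<And>d. pt d \<subseteq> Q' d" and pw: "\<And>d. Q' d \<subseteq> ideal_pow R center d"
    and sg: "\<And>d. additive_subgroup (Q' d) R"
    and mult: "\<And>d e a b. a \<in> ideal_pow R center d \<Longrightarrow> b \<in> Q' e \<Longrightarrow> a \<otimes>\<^bsub>R\<^esub> b \<in> Q' (d + e)"
    and prime: "\<And>d e a b. a \<in> ideal_pow R center d \<Longrightarrow> b \<in> ideal_pow R center e \<Longrightarrow>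
        a \<otimes>\<^bsub>R\<^esub> b \<in> Q' (d + e) \<Longrightarrow> a \<in> Q' d \<or> b \<in> Q' e"
    and irr: "\<exists>d>0. Q' d \<noteq> ideal_pow R center d"
    unfolding blowup_point_def by blast+
  have one: "cls F 1 \<notin> Q' 0"
  proof
    assume 1: "cls F 1 \<in> Q' 0"
    have "ideal_pow R center d \<subseteq> Q' d" for d
    proof
      fix x assume x: "x \<in> ideal_pow R center d"
      then obtain f where "x = cls F f" by (rule powE)
      then show "x \<in> Q' d" using mult[OF x 1] by (simp add: R.h_mult)
    qed
    then show False using irr pw by blast
  qed
  \<comment> \<open>\<open>y\<close> and \<open>z\<close> already lie in \<open>pt\<close>, so
    together with X all generators of the center would lie in \<open>Q'\<close>, and
    \<open>Q'\<close> would contain the irrelevant ideal.\<close>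
  have X: "cls F ps_X \<notin> Q' 1"
  proof
    assume X: "cls F ps_X \<in> Q' 1"
    have yz: "cls F y \<in> Q' 1" "cls F z \<in> Q' 1"
      using in_pt[OF rep_y] in_pt[OF rep_z] gens_in_mm sub by auto
    have "ideal_pow R center (Suc d) \<subseteq> Q' (Suc d)" for d
    proof
      fix x assume "x \<in> ideal_pow R center (Suc d)"
      then obtain f where "f \<in> I (Suc d)" "x = cls F f" by (auto simp only: ideal_pow_center)
      with I_Suc obtain a b c where abc: "a \<in> I d" "b \<in> I d" "c \<in> I d" "x = cls F (ps_X * a + y * b + z * c)"
        by metis
      have *: "cls F (g * e) \<in> Q' (Suc d)" if g: "cls F g \<in> Q' 1" and e: "e \<in> I d" for g e
      proof -
        have "cls F e \<in> ideal_pow R center d" using e by (auto simp: ideal_pow_center)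
        from mult[OF this g] show ?thesis by (simp add: R.h_mult mult.commute)
      qed
      show "x \<in> Q' (Suc d)"
        unfolding abc(4) R.h_add[symmetric]
        by (intro additive_subgroup.a_closed[OF sg] * X yz abc)
    qed
    then show False using irr pw by (metis Suc_pred subset_antisym)
  qed
  have Xd: "cls F (ps_X ^ d) \<notin> Q' d" for d
  proof (induction d)
    case 0 then show ?case using one by simp
  next
    case (Suc d)
    then show ?case
      using prime[OF rep_pow[OF rep_X] rep_pow[OF rep_X_pow], of d] X by (auto simp: R.h_mult)
  qed
  have "Q' d \<subseteq> pt d" for d
  proof
    fix x assume x: "x \<in> Q' d"
    then have "x \<in> ideal_pow R center d" using pw by blast
    then obtain f f' where f: "x = cls F f" "rep d f f'" by (rule powE)
    show "x \<in> pt d"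
    proof (rule ccontr)
      assume "x \<notin> pt d"
      then have "f' \<notin> mm" using in_pt f by blast
      define c where "c = ps_coeff f' 0 0 0"
      have c: "c \<noteq> 0" using \<open>f' \<notin> mm\<close> by (simp add: in_mm_iff c_def)
      have rc: "rep d (ps_const c * ps_X ^ d) (ps_const c)"
        using rep_mult_left[OF rep_X_pow[of d], where g = "ps_const c"] by (simp add: \<Phi>_const)
      have "cls F (f - ps_const c * ps_X ^ d) \<in> Q' d"
        using in_pt[OF rep_diff[OF f(2) rc]] mm_const_split[of f'] sub unfolding c_def by blast
      then have "cls F f \<ominus>\<^bsub>R\<^esub> cls F (f - ps_const c * ps_X ^ d) \<in> Q' d"
        unfolding R.minus_eq using x f(1) additive_subgroup.a_closed[OF sg] additive_subgroup.a_inv_closed[OF sg] by blast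
      then have "cls F (ps_const c * ps_X ^ d) \<in> Q' d" by (simp add: R.h_diff)
      then have "cls F (ps_const (inverse c)) \<otimes>\<^bsub>R\<^esub> cls F (ps_const c * ps_X ^ d) \<in> Q' (0 + d)"
        by (intro mult rep_pow[OF rep_0])
      moreover have "ps_const (inverse c) * (ps_const c * ps_X ^ d) = ps_X ^ d"
        using c by (simp add: ps_const_def mult.assoc[symmetric])
      ultimately show False using Xd by (simp add: R.h_mult)
    qed
  qed
  then show "Q' = pt" using sub by (intro ext) blast
qed

lemma pt_0: "pt 0 = cls F ` mm"
proof -
  have "cls F f \<in> pt 0 \<longleftrightarrow> f \<in> mm" for f using in_pt[OF rep_0] \<Phi>_mm by blast
  moreover have "pt 0 \<subseteq> range (cls F)" by (auto simp: pt_def)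
  ultimately show ?thesis by blast
qed

section \<open>The stalk and its embedding into the ring of the transformed equation\<close>

definition TT :: "'a ps3 \<Rightarrow> 'a ps3 \<Rightarrow> bool"
  where "TT f g \<longleftrightarrow> (\<exists>d f' g'. rep d f f' \<and> rep d g g' \<and> g' \<notin> mm)"

abbreviation "T \<equiv> blowup_fractions R center pt"

lemma TT_iff_T: "TT f g \<longleftrightarrow> (cls F f, cls F g) \<in> T"
proof
  assume "TT f g"
  then obtain d f' g' where *: "rep d f f'" "rep d g g'" "g' \<notin> mm" by (auto simp: TT_def)
  have "cls F g \<notin> pt d" using in_pt[OF *(2)] *(3) by simp
  with rep_pow[OF *(1)] rep_pow[OF *(2)] show "(cls F f, cls F g) \<in> T"
    unfolding blowup_fractions_def by blast
next
  assume "(cls F f, cls F g) \<in> T"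
  then obtain d where d: "cls F f \<in> ideal_pow R center d" "cls F g \<in> ideal_pow R center d" "cls F g \<notin> pt d"
    by (auto simp: blowup_fractions_def)
  then obtain f' g' where "rep d f f'" "rep d g g'" by (metis cls_in_pow rep_exists)
  with d(3) show "TT f g" using in_pt by (auto simp: TT_def)
qed

lemma mm_mult: "f \<notin> mm \<Longrightarrow> g \<notin> mm \<Longrightarrow> f * g \<notin> mm" for f g :: "'a ps3"
  using tprime_mult_iff[OF tprime_mm] by blast

text \<open>\<open>r\<close> represents the image of f/g modulo G; it exists since \<open>g'\<close>
  is a unit of the power series ring.\<close>

definition val :: "'a ps3 \<Rightarrow> 'a ps3 \<Rightarrow> 'a ps3 \<Rightarrow> bool"
  where "val f g r \<longleftrightarrow> (\<exists>d f' g'. rep d f f' \<and> rep d g g' \<and> g' \<notin> mm \<and> G dvd f' - r * g')"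

lemma val_TT: "val f g r \<Longrightarrow> TT f g" by (auto simp: val_def TT_def)

lemma val_exists: assumes "TT f g" obtains r where "val f g r"
proof -
  obtain d f' g' where *: "rep d f f'" "rep d g g'" "g' \<notin> mm" using assms by (auto simp: TT_def)
  obtain u where "g' * u = 1" using ps_unit[OF *(3)] .
  then have "f' - (f' * u) * g' = 0" by (simp add: mult.assoc mult.commute)
  then have "G dvd f' - (f' * u) * g'" by (simp only: dvd_0_right)
  then have "val f g (f' * u)" using * unfolding val_def by blast
  with that show thesis .
qed

lemma val_mult: assumes "val f g r" "val f1 g1 r1" shows "val (f * f1) (g * g1) (r * r1)"
proof -
  obtain d f' g' where *: "rep d f f'" "rep d g g'" "g' \<notin> mm" "G dvd f' - r * g'" using assms(1) by (auto simp: val_def)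
  obtain d1 f1' g1' where 1: "rep d1 f1 f1'" "rep d1 g1 g1'" "g1' \<notin> mm" "G dvd f1' - r1 * g1'" using assms(2) by (auto simp: val_def)
  have "f' * f1' - (r * r1) * (g' * g1') = (f' - r * g') * f1' + r * g' * (f1' - r1 * g1')"
    by (simp add: algebra_simps)
  then have "G dvd f' * f1' - (r * r1) * (g' * g1')" using *(4) 1(4) by simp
  then show ?thesis using rep_mult[OF *(1) 1(1)] rep_mult[OF *(2) 1(2)] mm_mult[OF *(3) 1(3)]
    unfolding val_def by blast
qed

lemma val_add: assumes "val f g r" "val f1 g1 r1" shows "val (f * g1 + f1 * g) (g * g1) (r + r1)"
proof -
  obtain d f' g' where *: "rep d f f'" "rep d g g'" "g' \<notin> mm" "G dvd f' - r * g'" using assms(1) by (auto simp: val_def)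
  obtain d1 f1' g1' where 1: "rep d1 f1 f1'" "rep d1 g1 g1'" "g1' \<notin> mm" "G dvd f1' - r1 * g1'" using assms(2) by (auto simp: val_def)
  have "f' * g1' + f1' * g' - (r + r1) * (g' * g1') = (f' - r * g') * g1' + g' * (f1' - r1 * g1')"
    by (simp add: algebra_simps)
  then have "G dvd f' * g1' + f1' * g' - (r + r1) * (g' * g1')" using *(4) 1(4) by simp
  moreover have "rep (d + d1) (f * g1 + f1 * g) (f' * g1' + f1' * g')"
    using rep_add[OF rep_mult[OF *(1) 1(2)] rep_mult[OF 1(1) *(2), unfolded add.commute[of d1 d]]] .
  ultimately show ?thesis using rep_mult[OF *(2) 1(2)] mm_mult[OF *(3) 1(3)]
    unfolding val_def by blast
qed

lemma val_minus: assumes "val f g r" shows "val (- f) g (- r)"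
proof -
  obtain d f' g' where *: "rep d f f'" "rep d g g'" "g' \<notin> mm" "G dvd f' - r * g'" using assms(1) by (auto simp: val_def)
  have "- f' - (- r) * g' = - (f' - r * g')" by simp
  then have "G dvd - f' - (- r) * g'" using *(4) by (simp only: dvd_minus_iff)
  then show ?thesis using * rep_minus[OF *(1)] unfolding val_def by blast
qed

lemma val_I: "rep d f f' \<Longrightarrow> rep d g 1 \<Longrightarrow> val f g f'"
proof -
  assume *: "rep d f f'" "rep d g 1"
  have "G dvd f' - f' * 1" by simp
  with * show ?thesis using tprime_1[OF tprime_mm] unfolding val_def by blast
qed

lemma val_0: "val f 1 (\<Phi> f)"
  using val_I[OF rep_0, of 1 f] rep_0[of 1] by (simp add: rhom_1[OF hom])

sublocale frac R "cls F" T TT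
proof
  show "T \<subseteq> carrier R \<times> carrier R"
    unfolding blowup_fractions_def ideal_pow_center by auto
  show "TT f g \<longleftrightarrow> (cls F f, cls F g) \<in> T" for f g by (rule TT_iff_T)
  show "TT 1 1" "TT 0 1" using val_TT[OF val_0] by auto
  show "TT (f * f') (g * g')" "TT (f * g' + f' * g) (g * g')" if "TT f g" "TT f' g'" for f g f' g'
    using that val_mult val_add val_TT by (metis val_exists)+
  show "TT (- f) g" if "TT f g" for f g using that val_minus val_TT by (metis val_exists)
qed

lemma A_stalk: "blowup_stalk R center pt = A" by (simp add: blowup_stalk_def)

sublocale A: cring A by (rule cring_A)

text \<open>Cross-multiplication transports equality of fractions to the chart, where denominators
  become units. The stalk thus embeds into K[[X,Y,Z]]/(G).\<close>

lemma kap_val_eq: assumes "val f g r" "val f1 g1 r1" shows "kap f g = kap f1 g1 \<longleftrightarrow> G dvd r - r1"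
proof -
  obtain d f' g' where *: "rep d f f'" "rep d g g'" "g' \<notin> mm" "G dvd f' - r * g'" using assms(1) by (auto simp: val_def)
  obtain d1 f1' g1' where 1: "rep d1 f1 f1'" "rep d1 g1 g1'" "g1' \<notin> mm" "G dvd f1' - r1 * g1'" using assms(2) by (auto simp: val_def)
  have unit: "G dvd u * x \<longleftrightarrow> G dvd x" if u: "u \<notin> mm" for u x
  proof
    obtain v where v: "u * v = 1" using ps_unit[OF u] .
    assume "G dvd u * x"
    then have "G dvd v * (u * x)" by (rule dvd_mult)
    moreover have "v * (u * x) = x" using v by (metis mult.assoc mult.commute mult_1)
    ultimately show "G dvd x" by simp
  qed simp
  have D: "rep (d + d1) (f * g1 - f1 * g) (f' * g1' - f1' * g')"
    using rep_diff[OF rep_mult[OF *(1) 1(2)] rep_mult[OF 1(1) *(2), unfolded add.commute[of d1 d]]] .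
  have "(\<exists>u. den u \<and> F dvd u * (f * g1 - f1 * g)) \<longleftrightarrow> G dvd f' * g1' - f1' * g'"
  proof
    assume "\<exists>u. den u \<and> F dvd u * (f * g1 - f1 * g)"
    then obtain u e d2 e' u' where u: "F dvd u * (f * g1 - f1 * g)" "rep d2 u u'" "u' \<notin> mm"
      unfolding den_def TT_def by blast
    then have "G dvd u' * (f' * g1' - f1' * g')" using rep_eq_0[OF rep_mult[OF u(2) D]] by simp
    then show "G dvd f' * g1' - f1' * g'" using unit u(3) by blast
  next
    assume "G dvd f' * g1' - f1' * g'"
    then have "F dvd 1 * (f * g1 - f1 * g)" using rep_eq_0[OF D] by simp
    moreover have "den 1" using TT_1 by (auto simp: den_def)
    ultimately show "\<exists>u. den u \<and> F dvd u * (f * g1 - f1 * g)" by blast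
  qed
  also have "\<dots> \<longleftrightarrow> G dvd (g' * g1') * (r - r1)"
  proof (rule dvd_cong)
    have "f' * g1' - f1' * g' - (g' * g1') * (r - r1) = (f' - r * g') * g1' - (f1' - r1 * g1') * g'"
      by (simp add: algebra_simps)
    then show "G dvd f' * g1' - f1' * g' - (g' * g1') * (r - r1)" using *(4) 1(4) by (simp add: dvd_diff)
  qed
  also have "\<dots> \<longleftrightarrow> G dvd r - r1" by (rule unit[OF mm_mult[OF *(3) 1(3)]])
  finally show ?thesis
    using kap_eq_iff[OF val_TT[OF assms(1)] val_TT[OF assms(2)]] by (simp add: kerR)
qed

lemma val_swap: assumes "val f g r" "r \<notin> mm" shows "TT g f"
proof -
  obtain d f' g' where *: "rep d f f'" "rep d g g'" "g' \<notin> mm" "G dvd f' - r * g'" using assms(1) by (auto simp: val_def)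
  have "f' \<notin> mm" using tideal_cong[OF tideal_mm G_dvd_mm[OF *(4)]] mm_mult[OF assms(2) *(3)] by blast
  then show ?thesis using * by (auto simp: TT_def)
qed

text \<open>The contraction to the stalk of the ideal \<open>N\<close> of the chart ring, taken
  along this embedding.\<close>

definition KK :: "'a ps3 set \<Rightarrow> ('a ps3 set \<times> 'a ps3 set) set set"
  where "KK N = {kap f g |f g r. val f g r \<and> r \<in> N}"

lemma in_KK: assumes N: "tideal N" "G \<in> N" and v: "val f g r" shows "kap f g \<in> KK N \<longleftrightarrow> r \<in> N"
proof
  assume "kap f g \<in> KK N"
  then obtain f1 g1 r1 where 1: "kap f g = kap f1 g1" "val f1 g1 r1" "r1 \<in> N" by (auto simp: KK_def)
  then have "G dvd r - r1" using kap_val_eq[OF v 1(2)] by simp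
  then have "r - r1 \<in> N" using tideal_dvd[OF N] by blast
  then show "r \<in> N" using tideal_cong[OF N(1)] 1(3) by blast
qed (use v in \<open>auto simp: KK_def\<close>)

lemma A_valE: assumes "x \<in> carrier A" obtains f g r where "x = kap f g" "val f g r"
  using assms by (metis A_carrierE val_exists)

lemma ideal_KK: assumes N: "tideal N" "G \<in> N" shows "ideal (KK N) A"
proof (rule idealI)
  show "ring A" by (rule A.ring_axioms)
  have carr: "KK N \<subseteq> carrier A" using kap_carrier val_TT by (auto simp: KK_def)
  have mult: "x \<otimes>\<^bsub>A\<^esub> a \<in> KK N" if ax: "a \<in> KK N" "x \<in> carrier A" for a x
  proof -
    obtain f g r where a: "a = kap f g" "val f g r" "r \<in> N" using ax by (auto simp: KK_def)
    obtain f1 g1 r1 where x: "x = kap f1 g1" "val f1 g1 r1" using ax(2) by (rule A_valE)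
    show ?thesis using val_mult[OF x(2) a(2)] tideal_mult[OF N(1) a(3)]
      by (auto simp: KK_def a(1) x(1) kap_mult[OF val_TT[OF x(2)] val_TT[OF a(2)]])
  qed
  show "x \<otimes>\<^bsub>A\<^esub> a \<in> KK N" "a \<otimes>\<^bsub>A\<^esub> x \<in> KK N" if "a \<in> KK N" "x \<in> carrier A" for a x
    using mult[OF that] A.m_comm that carr by auto
  show "subgroup (KK N) (add_monoid A)"
  proof (rule A.add.subgroupI)
    show "KK N \<subseteq> carrier A" by (rule carr)
    have "kap 0 1 \<in> KK N" using in_KK[OF N val_0] tideal_0[OF N(1)] by (simp add: rhom_0[OF hom])
    then show "KK N \<noteq> {}" by blast
    show "\<ominus>\<^bsub>A\<^esub> a \<in> KK N" if a: "a \<in> KK N" for a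
    proof -
      have "a \<in> carrier A" using a carr by blast
      then have "\<ominus>\<^bsub>A\<^esub> a = (\<ominus>\<^bsub>A\<^esub> \<one>\<^bsub>A\<^esub>) \<otimes>\<^bsub>A\<^esub> a" by (simp add: A.l_minus)
      then show ?thesis using mult[OF a, of "\<ominus>\<^bsub>A\<^esub> \<one>\<^bsub>A\<^esub>"] by simp
    qed
    show "a \<oplus>\<^bsub>A\<^esub> b \<in> KK N" if ab: "a \<in> KK N" "b \<in> KK N" for a b
    proof -
      obtain f g r where a: "a = kap f g" "val f g r" "r \<in> N" using ab by (auto simp: KK_def)
      obtain f1 g1 r1 where b: "b = kap f1 g1" "val f1 g1 r1" "r1 \<in> N" using ab by (auto simp: KK_def)
      show ?thesis using val_add[OF a(2) b(2)] tideal_add[OF N(1) a(3) b(3)]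
        by (auto simp: KK_def a(1) b(1) kap_add[OF val_TT[OF a(2)] val_TT[OF b(2)]])
    qed
  qed
qed

section \<open>Powers of the maximal ideal of the stalk\<close>

lemma max_ideal_A: "max_ideal A = KK mm"
proof (rule A.local_ringI(2))
  show "ideal (KK mm) A" by (rule ideal_KK[OF tideal_mm G_mm])
  show "\<one>\<^bsub>A\<^esub> \<notin> KK mm"
    using in_KK[OF tideal_mm G_mm val_0, of 1] tprime_1[OF tprime_mm] by (simp add: kap_one rhom_1[OF hom])
  show "a \<in> Units A" if a: "a \<in> carrier A" "a \<notin> KK mm" for a
  proof -
    obtain f g r where f: "a = kap f g" "val f g r" using a(1) by (rule A_valE)
    then have "r \<notin> mm" using in_KK[OF tideal_mm G_mm f(2)] a(2) by simp
    then show ?thesis unfolding f(1) by (intro kap_Units val_TT[OF f(2)] val_swap[OF f(2)])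
  qed
qed

text \<open>The ideal generated by G and the k-th power of the maximal ideal of K[[X,Y,Z]].\<close>

definition MG :: "nat \<Rightarrow> 'a ps3 set" where "MG k = {r. \<exists>q. r - G * q \<in> wt 1 1 1 k}"

lemma MG_I: "r - G * q \<in> wt 1 1 1 k \<Longrightarrow> r \<in> MG k"
  unfolding MG_def by blast

lemma tideal_MG: "tideal (MG k)"
  unfolding tideal_def
proof (intro conjI ballI allI)
  have "(0 :: 'a ps3) - G * 0 \<in> wt 1 1 1 k" by simp
  then show "0 \<in> MG k" unfolding MG_def by blast
  fix a b s assume "a \<in> MG k"
  then obtain q where q: "a - G * q \<in> wt 1 1 1 k" by (auto simp: MG_def)
  have "s * a - G * (s * q) = s * (a - G * q)" by (simp add: algebra_simps)
  with wt_mult_left[OF q, of s] show "s * a \<in> MG k" by (intro MG_I[of _ "s * q"]) (simp only:)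
  assume "b \<in> MG k"
  then obtain q' where q': "b - G * q' \<in> wt 1 1 1 k" by (auto simp: MG_def)
  have "a + b - G * (q + q') = (a - G * q) + (b - G * q')" by (simp add: algebra_simps)
  with wt_add[OF q q'] show "a + b \<in> MG k" by (intro MG_I[of _ "q + q'"]) (simp only:)
qed

lemma G_MG: "G \<in> MG k"
proof -
  have "G - G * 1 \<in> wt 1 1 1 k" by simp
  then show ?thesis unfolding MG_def by blast
qed

lemma wt_MG: "wt 1 1 1 k \<subseteq> MG k"
proof
  fix r :: "'a ps3" assume "r \<in> wt 1 1 1 k"
  then have "r - G * 0 \<in> wt 1 1 1 k" by simp
  then show "r \<in> MG k" unfolding MG_def by blast
qed

lemma MG_Suc: "MG (Suc k) \<subseteq> MG k"
  by (auto simp: MG_def dest: wt_antimono[of k "Suc k", rotated])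

lemma MG_mult: assumes "a \<in> mm" "b \<in> MG k" shows "a * b \<in> MG (Suc k)"
proof -
  obtain q where q: "b - G * q \<in> wt 1 1 1 k" using assms(2) by (auto simp: MG_def)
  have "a * (b - G * q) \<in> wt 1 1 1 (1 + k)" using assms(1) q by (intro wt_mult) (simp add: mm_eq_wt)
  moreover have "a * (b - G * q) = a * b - G * (a * q)" by (simp add: algebra_simps)
  ultimately show ?thesis by (intro MG_I[of _ "a * q"]) (simp only: plus_1_eq_Suc)
qed

lemma ideal_pow_sub: "ideal_pow A (KK mm) k \<subseteq> KK (MG k)"
proof (induction k)
  case 0
  have "MG 0 = UNIV" by (auto simp: MG_def)
  then show ?case by (auto simp: KK_def elim!: A_valE)
next
  case (Suc k)
  have "x \<in> KK (MG (Suc k))" if "x \<in> KK mm \<cdot>\<^bsub>A\<^esub> ideal_pow A (KK mm) k" for x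
    using that
  proof (induction rule: ideal_prod.induct)
    case (prod i j)
    obtain f g r where a: "i = kap f g" "val f g r" "r \<in> mm" using prod by (auto simp: KK_def)
    obtain f1 g1 r1 where b: "j = kap f1 g1" "val f1 g1 r1" "r1 \<in> MG k" using prod Suc by (auto simp: KK_def)
    show ?case using val_mult[OF a(2) b(2)] MG_mult[OF a(3) b(3)]
      by (auto simp: KK_def a(1) b(1) kap_mult[OF val_TT[OF a(2)] val_TT[OF b(2)]])
  next
    case (sum s t)
    then show ?case
      using additive_subgroup.a_closed[OF ideal.axioms(1)[OF ideal_KK[OF tideal_MG G_MG]]] by blast
  qed
  then show ?case by auto
qed

lemma ideal_ideal_pow: "ideal (ideal_pow A (KK mm) k) A"
  by (induction k) (auto intro: A.oneideal A.ideal_prod_is_ideal ideal_KK[OF tideal_mm G_mm])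

lemma TT_X_pow: "f \<in> I d \<Longrightarrow> TT f (ps_X ^ d)"
proof -
  assume "f \<in> I d"
  then obtain f' where "rep d f f'" using I_div rep_I by blast
  then show ?thesis using val_TT[OF val_I[OF _ rep_X_pow]] by blast
qed

text \<open>Induction by \<open>J_Suc\<close>: X, y/X and z/X lie in the maximal ideal of the stalk,
  and f/X^d is a combination of them with coefficients from the previous level.\<close>

lemma jet_in_pow: "f \<in> J d k \<Longrightarrow> kap f (ps_X ^ d) \<in> ideal_pow A (KK mm) k"
proof (induction k arbitrary: f)
  case 0
  then have "TT f (ps_X ^ d)" using J_I TT_X_pow by blast
  then show ?case by (simp add: kap_carrier)
next
  case (Suc k)
  obtain a b c where abc: "a \<in> J d k" "b \<in> J d k" "c \<in> J d k"
    and eq: "ps_X * f = ps_X * ps_X * a + y * b + z * c" using J_Suc[OF Suc.prems] by blast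
  have TTf: "TT f (ps_X ^ d)" if "f \<in> J d i" for f i using TT_X_pow J_I that by blast
  have gens: "val ps_X 1 ps_X" "val y ps_X ps_Y" "val z ps_X ps_Z"
    using val_0[of ps_X] val_I[OF rep_y rep_X] val_I[OF rep_z rep_X] by (simp_all add: \<Phi>_X)
  have K: "kap ps_X 1 \<in> KK mm" "kap y ps_X \<in> KK mm" "kap z ps_X \<in> KK mm"
    using gens gens_in_mm by (auto simp: KK_def)
  note Tg = gens[THEN val_TT] and Ta = TTf[OF abc(1)] and Tb = TTf[OF abc(2)] and Tc = TTf[OF abc(3)]
  let ?D = "ps_X ^ d :: 'a ps3"
  let ?s = "kap ps_X 1 \<otimes>\<^bsub>A\<^esub> kap a ?D \<oplus>\<^bsub>A\<^esub> kap y ps_X \<otimes>\<^bsub>A\<^esub> kap b ?D \<oplus>\<^bsub>A\<^esub> kap z ps_X \<otimes>\<^bsub>A\<^esub> kap c ?D"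
  have "?s \<in> ideal_pow A (KK mm) (Suc k)"
    using K abc Suc.IH by (auto intro!: ideal_prod.sum ideal_prod.prod)
  moreover have "?s = kap f ?D"
  proof -
    let ?n = "((ps_X * a) * (ps_X * ?D) + (y * b) * (1 * ?D)) * (ps_X * ?D) + (z * c) * ((1 * ?D) * (ps_X * ?D))"
    let ?d = "((1 * ?D) * (ps_X * ?D)) * (ps_X * ?D)"
    note T1 = TT_mult[OF Tg(1) Ta] and T2 = TT_mult[OF Tg(2) Tb] and T3 = TT_mult[OF Tg(3) Tc]
    note T4 = TT_add[OF TT_add[OF T1 T2] T3]
    have "?s = kap ?n ?d"
      by (simp only: kap_mult[OF Tg(1) Ta] kap_mult[OF Tg(2) Tb] kap_mult[OF Tg(3) Tc]
          kap_add[OF T1 T2] kap_add[OF TT_add[OF T1 T2] T3])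
    also have "\<dots> = kap f ?D"
    proof (rule kap_eqI[OF T4 TTf[OF Suc.prems]])
      have "f * ?d = (ps_X * f) * (?D * ?D * ?D * ps_X)" by (simp add: algebra_simps)
      also have "\<dots> = ?n * ?D" unfolding eq by (simp add: algebra_simps)
      finally show "?n * ?D = f * ?d" ..
    qed
    finally show ?thesis .
  qed
  ultimately show ?case by simp
qed

text \<open>The nontrivial inclusion lifts a congruence from the chart to the stalk. The value is
  changed modulo G to one of order at least \<open>k\<close>, the numerator modulo F to a jet
  \<open>f1\<close>, and f1/g is split as f1/X^d times X^d/g, whose first factor lies in the
  power.\<close>

lemma ideal_pow_A: "ideal_pow A (max_ideal A) k = KK (MG k)"
  unfolding max_ideal_A
proof (intro equalityI ideal_pow_sub subsetI)
  fix x assume "x \<in> KK (MG k)"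
  then obtain f g r where x: "x = kap f g" "val f g r" "r \<in> MG k" by (auto simp: KK_def)
  obtain d f' g' where *: "rep d f f'" "rep d g g'" "g' \<notin> mm" "G dvd f' - r * g'"
    using x(2) by (auto simp: val_def)
  obtain q where q: "r - G * q \<in> wt 1 1 1 k" using x(3) by (auto simp: MG_def)
  define w where "w = r - G * q"
  have eq: "f' - w * g' = (f' - r * g') + G * (q * g')" by (simp add: w_def algebra_simps)
  have "G dvd f' - w * g'" unfolding eq by (intro dvd_add *(4) dvd_triv_left)
  then have rw: "rep d f (w * g')" by (rule rep_cong[OF *(1)])
  obtain f0 where f0: "f0 \<in> I d" "F dvd f - f0" using *(1) by (auto simp: rep_def)
  have "G dvd \<Phi> f0 - ps_X ^ d * (w * g')" using rep_cong_F[OF rw f0(2)] by (simp add: rep_def)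
  then obtain f1 where f1: "f1 \<in> J d k" "F dvd f0 - f1"
    using jet[OF f0(1)] wt_mult_right[OF q[folded w_def]] by blast
  have F1: "F dvd f - f1" using dvd_add[OF f0(2) f1(2)] by simp
  have T1: "TT f1 (ps_X ^ d)" using TT_X_pow J_I f1 by blast
  have T2: "TT (ps_X ^ d) g" using rep_X_pow *(2,3) by (auto simp: TT_def)
  have T3: "TT f1 g" using rep_cong_F[OF *(1) F1] *(2,3) by (auto simp: TT_def)
  have "kap f g = kap f1 g" using F1 by (intro kap_cong val_TT[OF x(2)] T3) (simp add: kerR)
  also have "\<dots> = kap (f1 * ps_X ^ d) (ps_X ^ d * g)" by (intro kap_eqI T3 TT_mult[OF T1 T2]) (simp add: algebra_simps)
  also have "\<dots> = kap f1 (ps_X ^ d) \<otimes>\<^bsub>A\<^esub> kap (ps_X ^ d) g" by (rule kap_mult[OF T1 T2, symmetric])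
  also have "\<dots> \<in> ideal_pow A (KK mm) k"
    by (intro ideal.I_r_closed[OF ideal_ideal_pow] jet_in_pow[OF f1(1)] kap_carrier T2)
  finally show "x \<in> ideal_pow A (KK mm) k" by (simp add: x(1))
qed

end

section \<open>The completion of the stalk\<close>

context chart
begin

text \<open>A residue class of the stalk indexed by an arbitrary power series \<open>s\<close>,
  which need not be the value of a fraction.\<close>

definition coset :: "'a ps3 \<Rightarrow> nat \<Rightarrow> ('a ps3 set \<times> 'a ps3 set) set set"
  where "coset s k = {kap f g |f g r. val f g r \<and> r - s \<in> MG k}"

lemma pow_in_iff: "val f g r \<Longrightarrow> kap f g \<in> ideal_pow A (max_ideal A) k \<longleftrightarrow> r \<in> MG k"
  unfolding ideal_pow_A by (rule in_KK[OF tideal_MG G_MG])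

lemma ideal_pow_ideal: "ideal (ideal_pow A (max_ideal A) k) A"
  unfolding ideal_pow_A by (rule ideal_KK[OF tideal_MG G_MG])

lemma kap_val_carrier: "val f g r \<Longrightarrow> kap f g \<in> carrier A"
  by (intro kap_carrier val_TT)

lemma kap_diff:
  assumes "val f g r" "val f1 g1 r1"
  obtains f2 g2 where "kap f g \<ominus>\<^bsub>A\<^esub> kap f1 g1 = kap f2 g2" "val f2 g2 (r - r1)"
proof -
  note T = val_TT[OF assms(1)] and T1 = val_TT[OF assms(2)]
  have "kap (- f1) g1 \<oplus>\<^bsub>A\<^esub> kap f1 g1 = \<zero>\<^bsub>A\<^esub>"
    unfolding kap_zero kap_add[OF TT_minus[OF T1] T1]
    by (rule kap_eqI[OF TT_add[OF TT_minus[OF T1] T1] TT_0]) simp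
  then have "\<ominus>\<^bsub>A\<^esub> kap f1 g1 = kap (- f1) g1"
    by (intro A.minus_equality kap_carrier T1 TT_minus)
  then have "kap f g \<ominus>\<^bsub>A\<^esub> kap f1 g1 = kap (f * g1 + (- f1) * g) (g * g1)"
    by (simp add: A.minus_eq kap_add[OF T TT_minus[OF T1]])
  moreover have "val (f * g1 + (- f1) * g) (g * g1) (r - r1)"
    using val_add[OF assms(1) val_minus[OF assms(2)]] by simp
  ultimately show thesis using that by blast
qed

lemma coset_eq: assumes "val f g r" shows "ideal_pow A (max_ideal A) k +>\<^bsub>A\<^esub> kap f g = coset r k"
proof -
  interpret P: ideal "ideal_pow A (max_ideal A) k" A by (rule ideal_pow_ideal)
  have *: "x \<in> ideal_pow A (max_ideal A) k +>\<^bsub>A\<^esub> kap f g \<longleftrightarrow> x \<ominus>\<^bsub>A\<^esub> kap f g \<in> ideal_pow A (max_ideal A) k"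
    if "x \<in> carrier A" for x
    by (rule abelian_subgroup.a_rcos_module_minus[OF abelian_subgroupI3[OF P.is_additive_subgroup A.is_abelian_group]
        A.ring_axioms kap_val_carrier[OF assms] that])
  have "x \<in> ideal_pow A (max_ideal A) k +>\<^bsub>A\<^esub> kap f g \<longleftrightarrow> x \<in> coset r k" if x: "x \<in> carrier A" for x
  proof -
    obtain f1 g1 r1 where f1: "x = kap f1 g1" "val f1 g1 r1" using x by (rule A_valE)
    obtain f2 g2 where f2: "kap f1 g1 \<ominus>\<^bsub>A\<^esub> kap f g = kap f2 g2" "val f2 g2 (r1 - r)"
      using kap_diff[OF f1(2) assms] by blast
    have "x \<in> ideal_pow A (max_ideal A) k +>\<^bsub>A\<^esub> kap f g \<longleftrightarrow> x \<ominus>\<^bsub>A\<^esub> kap f g \<in> ideal_pow A (max_ideal A) k"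
      by (rule *[OF x])
    also have "x \<ominus>\<^bsub>A\<^esub> kap f g = kap f2 g2" by (simp only: f1(1) f2(1))
    also have "kap f2 g2 \<in> ideal_pow A (max_ideal A) k \<longleftrightarrow> r1 - r \<in> MG k" by (rule pow_in_iff[OF f2(2)])
    also have "\<dots> \<longleftrightarrow> x \<in> coset r k"
    proof
      assume "x \<in> coset r k"
      then obtain f3 g3 r3 where f3: "x = kap f3 g3" "val f3 g3 r3" "r3 - r \<in> MG k" by (auto simp: coset_def)
      then have "G dvd r1 - r3" using kap_val_eq[OF f1(2) f3(2)] f1(1) by simp
      then have "r1 - r3 \<in> MG k" using tideal_dvd[OF tideal_MG G_MG] by blast
      then have "(r1 - r3) + (r3 - r) \<in> MG k" using f3(3) by (rule tideal_add[OF tideal_MG])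
      then show "r1 - r \<in> MG k" by simp
    qed (use f1 in \<open>auto simp: coset_def\<close>)
    finally show ?thesis .
  qed
  moreover have "ideal_pow A (max_ideal A) k +>\<^bsub>A\<^esub> kap f g \<subseteq> carrier A"
    using kap_val_carrier[OF assms] P.a_subset by (rule A.a_r_coset_subset_G[rotated])
  moreover have "coset r k \<subseteq> carrier A" using kap_val_carrier by (auto simp: coset_def)
  ultimately show ?thesis by blast
qed

lemma coset_cong: assumes "s - s' \<in> MG k" shows "coset s k = coset s' k"
proof -
  have "r - s \<in> MG k \<longleftrightarrow> r - s' \<in> MG k" for r
    using tideal_cong[OF tideal_MG, of "r - s'" "r - s" k] assms by (simp add: algebra_simps)
  then show ?thesis by (simp add: coset_def)
qed

text \<open>By density some numerator over a power of X approximates \<open>s\<close> to order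
  \<open>k\<close>; hence every \<open>coset s k\<close> is nonempty.\<close>

lemma coset_repr: obtains f g r where "val f g r" "r - s \<in> MG k"
proof -
  obtain d f h' where *: "f \<in> I d" "\<Phi> f = ps_X ^ d * h'" "h' - s \<in> wt 1 1 1 k" using dense by blast
  have "val f (ps_X ^ d) h'" by (rule val_I[OF rep_I[OF *(1,2)] rep_X_pow])
  with *(3) that wt_MG show thesis by blast
qed

lemma coset_cong_iff: "coset s k = coset s' k \<longleftrightarrow> s - s' \<in> MG k"
proof
  assume eq: "coset s k = coset s' k"
  obtain f g r where r: "val f g r" "r - s \<in> MG k" by (rule coset_repr)
  then have "kap f g \<in> coset s' k" unfolding eq[symmetric] by (auto simp: coset_def)
  then obtain f1 g1 r1 where r1: "kap f g = kap f1 g1" "val f1 g1 r1" "r1 - s' \<in> MG k" by (auto simp: coset_def)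
  have "G dvd r - r1" using kap_val_eq[OF r(1) r1(2)] r1(1) by simp
  then have "r - r1 \<in> MG k" using tideal_dvd[OF tideal_MG G_MG] by blast
  then have "(r - r1) + (r1 - s') - (r - s) \<in> MG k"
    by (rule tideal_diff[OF tideal_MG tideal_add[OF tideal_MG _ r1(3)] r(2)])
  then show "s - s' \<in> MG k" by simp
qed (rule coset_cong)

text \<open>A common element exists by density, and its value is compared with both series. The
  exponent on the left is one higher, as in the compatibility condition of
  \<open>completion\<close>.\<close>

lemma coset_mono: assumes "coset s' (Suc k) \<subseteq> coset s k" shows "s' - s \<in> MG k"
proof -
  obtain f g r where r: "val f g r" "r - s' \<in> MG (Suc k)" by (rule coset_repr)
  then have "kap f g \<in> coset s k" using assms by (auto simp: coset_def)
  then obtain f1 g1 r1 where r1: "kap f g = kap f1 g1" "val f1 g1 r1" "r1 - s \<in> MG k" by (auto simp: coset_def)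
  have "G dvd r - r1" using kap_val_eq[OF r(1) r1(2)] r1(1) by simp
  then have "r - r1 \<in> MG k" using tideal_dvd[OF tideal_MG G_MG] by blast
  then have "(r - r1) + (r1 - s) - (r - s') \<in> MG k"
    by (rule tideal_diff[OF tideal_MG tideal_add[OF tideal_MG _ r1(3)] subsetD[OF MG_Suc r(2)]])
  then show ?thesis by simp
qed

abbreviation "AQ k \<equiv> A Quot ideal_pow A (max_ideal A) k"

lemma AQ_carrier: "carrier (AQ k) = range (\<lambda>s. coset s k)"
proof -
  have "x \<in> carrier (AQ k) \<longleftrightarrow> (\<exists>s. x = coset s k)" for x
  proof
    assume "x \<in> carrier (AQ k)"
    then obtain a where "a \<in> carrier A" "x = ideal_pow A (max_ideal A) k +>\<^bsub>A\<^esub> a"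
      by (auto simp: FactRing_def A_RCOSETS_def')
    then show "\<exists>s. x = coset s k" using coset_eq by (metis A_valE)
  next
    assume "\<exists>s. x = coset s k"
    then obtain s where s: "x = coset s k" by blast
    obtain f g r where r: "val f g r" "r - s \<in> MG k" by (rule coset_repr)
    then have "x = ideal_pow A (max_ideal A) k +>\<^bsub>A\<^esub> kap f g"
      using coset_eq coset_cong s by simp
    then show "x \<in> carrier (AQ k)"
      using kap_val_carrier[OF r(1)] by (auto simp: FactRing_def A_RCOSETS_def')
  qed
  then show ?thesis by blast
qed

lemma coset_ops:
  "coset s k \<otimes>\<^bsub>AQ k\<^esub> coset s' k = coset (s * s') k" (is ?mult)
  "coset s k \<oplus>\<^bsub>AQ k\<^esub> coset s' k = coset (s + s') k" (is ?add)
proof -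
  interpret P: ideal "ideal_pow A (max_ideal A) k" A by (rule ideal_pow_ideal)
  obtain f g r where r: "val f g r" "r - s \<in> MG k" by (rule coset_repr)
  obtain f1 g1 r1 where r1: "val f1 g1 r1" "r1 - s' \<in> MG k" by (rule coset_repr)
  have s: "coset s k = ideal_pow A (max_ideal A) k +>\<^bsub>A\<^esub> kap f g"
    and s': "coset s' k = ideal_pow A (max_ideal A) k +>\<^bsub>A\<^esub> kap f1 g1"
    using coset_eq[OF r(1)] coset_eq[OF r1(1)] coset_cong[OF r(2)] coset_cong[OF r1(2)] by simp_all
  note c = kap_val_carrier[OF r(1)] kap_val_carrier[OF r1(1)]
  note T = val_TT[OF r(1)] val_TT[OF r1(1)]
  have "r * r1 - s * s' = r1 * (r - s) + s * (r1 - s')" by (simp add: algebra_simps)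
  then have rs: "r * r1 - s * s' \<in> MG k"
    using tideal_add[OF tideal_MG tideal_mult[OF tideal_MG r(2)] tideal_mult[OF tideal_MG r1(2)]] by simp
  have "coset s k \<otimes>\<^bsub>AQ k\<^esub> coset s' k = ideal_pow A (max_ideal A) k +>\<^bsub>A\<^esub> (kap f g \<otimes>\<^bsub>A\<^esub> kap f1 g1)"
    using P.rcoset_mult_add[OF c] by (simp add: FactRing_def s s')
  also have "\<dots> = coset (r * r1) k" unfolding kap_mult[OF T] by (rule coset_eq[OF val_mult[OF r(1) r1(1)]])
  also have "\<dots> = coset (s * s') k" by (rule coset_cong[OF rs])
  finally show ?mult .
  have "r + r1 - (s + s') = (r - s) + (r1 - s')" by simp
  then have rs: "r + r1 - (s + s') \<in> MG k" using tideal_add[OF tideal_MG r(2) r1(2)] by (simp only:)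
  have "coset s k \<oplus>\<^bsub>AQ k\<^esub> coset s' k = ideal_pow A (max_ideal A) k +>\<^bsub>A\<^esub> (kap f g \<oplus>\<^bsub>A\<^esub> kap f1 g1)"
    using P.a_rcos_sum[OF c] by (simp add: FactRing_def s s')
  also have "\<dots> = coset (r + r1) k" unfolding kap_add[OF T] by (rule coset_eq[OF val_add[OF r(1) r1(1)]])
  also have "\<dots> = coset (s + s') k" by (rule coset_cong[OF rs])
  finally show ?add .
qed

lemma coset_one: "\<one>\<^bsub>AQ k\<^esub> = coset 1 k"
  using coset_eq[OF val_0, of k 1] by (simp add: FactRing_def kap_one rhom_1[OF hom])

lemma coset_Suc_sub: "coset s (Suc k) \<subseteq> coset s k"
  unfolding coset_def using MG_Suc[of k] by blast

abbreviation "CA \<equiv> completion A (max_ideal A)"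

lemma coset_carrier: "coset s \<in> carrier CA"
  using AQ_carrier coset_Suc_sub by (auto simp: completion_def)

text \<open>The inverse of the map from the completion: it sends the class of \<open>s\<close> to the compatible family
  of the sets of those elements of \<open>A\<close> whose image is congruent to \<open>s\<close> modulo powers of the maximal
  ideal.\<close>

definition to_completion :: "'a ps3 set \<Rightarrow> nat \<Rightarrow> ('a ps3 set \<times> 'a ps3 set) set set"
  where "to_completion c = coset (SOME s. c = cls G s)"

lemma cls_G_iff: "cls G s = cls G s' \<longleftrightarrow> G dvd s - s'"
proof -
  interpret R': quo "surface_ring G" "cls G" by (rule quo_surface)
  have "R'.ker = {f. G dvd f}" by (rule ker_surface)
  then show ?thesis by (simp add: R'.h_eq_iff flip: R'.in_ker)
qed

lemma to_completion_cls: "to_completion (cls G s) = coset s"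
proof
  fix k
  have "cls G s = cls G (SOME s'. cls G s = cls G s')" by (rule someI[of _ s]) simp
  then have "s - (SOME s'. cls G s = cls G s') \<in> MG k"
    using tideal_dvd[OF tideal_MG G_MG] unfolding cls_G_iff by blast
  then show "to_completion (cls G s) k = coset s k" unfolding to_completion_def by (rule coset_cong[symmetric])
qed

text \<open>A compatible family yields series \<open>r k\<close> that form a Cauchy sequence modulo
  G; completeness of K[[X,Y,Z]] supplies the limit.\<close>

lemma coset_surj: assumes x: "x \<in> carrier CA" shows "\<exists>s. x = coset s"
proof -
  have "\<exists>s. x k = coset s k" for k
  proof -
    have "x k \<in> carrier (AQ k)" using x by (simp add: completion_def)
    then show ?thesis unfolding AQ_carrier by blast
  qed
  then obtain r where r: "\<And>k. x k = coset (r k) k" by metis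
  have rMG: "r (Suc k) - r k \<in> MG k" for k
  proof (rule coset_mono)
    have "x (Suc k) \<subseteq> x k" using x by (simp add: completion_def)
    then show "coset (r (Suc k)) (Suc k) \<subseteq> coset (r k) k" by (simp only: r)
  qed
  \<comment> \<open>The differences are small only modulo G, so they are first replaced by
    representatives of order at least \<open>k\<close>, which can be summed.\<close>
  have "\<exists>w. w \<in> wt 1 1 1 k \<and> G dvd r (Suc k) - r k - w" for k
  proof -
    obtain q where q: "r (Suc k) - r k - G * q \<in> wt 1 1 1 k"
      using rMG[of k] by (auto simp: MG_def)
    have "G dvd r (Suc k) - r k - (r (Suc k) - r k - G * q)" by simp
    with q show ?thesis by blast
  qed
  then obtain w where w: "\<And>k. w k \<in> wt 1 1 1 k" "\<And>k. G dvd r (Suc k) - r k - w k" by metis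
  obtain s0 where s0: "\<And>k. s0 - (\<Sum>n<k. w n) \<in> wt 1 1 1 k" using ps_complete[OF w(1)] by blast
  have sum: "G dvd r k - r 0 - (\<Sum>n<k. w n)" for k
  proof (induction k)
    case (Suc k)
    have "r (Suc k) - r 0 - (\<Sum>n<Suc k. w n) = (r k - r 0 - (\<Sum>n<k. w n)) + (r (Suc k) - r k - w k)"
      by simp
    then show ?case using dvd_add[OF Suc w(2)[of k]] by (simp only:)
  qed simp
  have "x k = coset (r 0 + s0) k" for k
  proof -
    have "r k - (r 0 + s0) = (r k - r 0 - (\<Sum>n<k. w n)) - (s0 - (\<Sum>n<k. w n))" by simp
    also have "\<dots> \<in> MG k"
      by (rule tideal_diff[OF tideal_MG tideal_dvd[OF tideal_MG G_MG sum] subsetD[OF wt_MG s0]])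
    finally show ?thesis unfolding r by (rule coset_cong)
  qed
  then show ?thesis by blast
qed

lemma to_completion_ring_iso: "to_completion \<in> ring_iso (surface_ring G) CA"
proof -
  interpret R': quo "surface_ring G" "cls G" by (rule quo_surface)
  have "to_completion \<in> ring_hom (surface_ring G) CA"
  proof (rule ring_hom_memI)
    fix c c' assume "c \<in> carrier (surface_ring G)" "c' \<in> carrier (surface_ring G)"
    then obtain s s' where s: "c = cls G s" "c' = cls G s'" by (metis R'.carrierE)
    show "to_completion c \<in> carrier CA" by (simp add: s to_completion_cls coset_carrier)
    show "to_completion (c \<otimes>\<^bsub>surface_ring G\<^esub> c') = to_completion c \<otimes>\<^bsub>CA\<^esub> to_completion c'"
      unfolding s R'.h_mult to_completion_cls by (simp add: completion_def coset_ops fun_eq_iff)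
    show "to_completion (c \<oplus>\<^bsub>surface_ring G\<^esub> c') = to_completion c \<oplus>\<^bsub>CA\<^esub> to_completion c'"
      unfolding s R'.h_add to_completion_cls by (simp add: completion_def coset_ops fun_eq_iff)
  next
    show "to_completion \<one>\<^bsub>surface_ring G\<^esub> = \<one>\<^bsub>CA\<^esub>"
      unfolding R'.h_one to_completion_cls by (simp add: completion_def coset_one fun_eq_iff)
  qed
  moreover have "bij_betw to_completion (carrier (surface_ring G)) (carrier CA)"
    unfolding bij_betw_def
  proof (intro conjI inj_onI)
    fix c c' assume "c \<in> carrier (surface_ring G)" "c' \<in> carrier (surface_ring G)" and eq: "to_completion c = to_completion c'"
    then obtain s s' where s: "c = cls G s" "c' = cls G s'" by (metis R'.carrierE)
    have "s - s' \<in> MG k" for k using eq coset_cong_iff unfolding s to_completion_cls by metis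
    then have "\<exists>q. (s - s') - G * q \<in> wt 1 1 1 k" for k by (simp add: MG_def)
    then have "G dvd s - s'" by (rule separated)
    then show "c = c'" by (simp add: s cls_G_iff)
  next
    show "to_completion ` carrier (surface_ring G) = carrier CA"
    proof (intro equalityI subsetI)
      fix x assume "x \<in> carrier CA"
      then obtain s where "x = coset s" using coset_surj by blast
      then show "x \<in> to_completion ` carrier (surface_ring G)" unfolding to_completion_cls[symmetric] by blast
    qed (auto simp: R'.carrier_eq to_completion_cls coset_carrier)
  qed
  ultimately show ?thesis by (simp add: ring_iso_def)
qed

lemma to_completion_const:
  "to_completion (surface_const G c) = completion_map A (max_ideal A) (frac_map R T (surface_const F c))"
proof
  fix k
  have "frac_map R T (surface_const F c) = kap (ps_const c) 1"
    by (simp add: frac_map_def kap_def surface_const_eq R.h_one)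
  then have "completion_map A (max_ideal A) (frac_map R T (surface_const F c)) k = coset (\<Phi> (ps_const c)) k"
    using coset_eq[OF val_0] by (simp add: completion_map_def)
  then show "to_completion (surface_const G c) k = completion_map A (max_ideal A) (frac_map R T (surface_const F c)) k"
    by (simp add: surface_const_eq to_completion_cls \<Phi>_const)
qed

theorem levi_zariski_step: assumes "maximal_center F center" shows "levi_zariski_step F G"
proof -
  have "1 \<notin> R.ker" using tideal_dvd[OF tideal_mm F_mm, of 1] tprime_1[OF tprime_mm] by (auto simp: kerR)
  then have "pt 0 = max_ideal R" using quo_local(2)[OF quo_surface] pt_0 by metis
  then show ?thesis
    unfolding levi_zariski_step_def Let_def
    using assms blowup_closed_point_pt to_completion_ring_iso to_completion_const
    by (intro exI[of _ center] exI[of _ pt]) (auto simp: A_stalk intro!: bexI[of _ to_completion])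
qed

end

section \<open>The charts of the sequence\<close>

text \<open>The Krull intersection property made explicit: by \<open>nf_order\<close> the remainder
  of \<open>f\<close> has arbitrarily large order.\<close>

lemma cubic_separated:
  fixes f :: "'a::field ps3"
  assumes m: "m \<ge> 3" and f: "\<And>k. \<exists>q. f - cubic m r * q \<in> wt 1 1 1 k"
  shows "cubic m r dvd f"
proof -
  obtain q where q: "nf (f - cubic m r * q)" using weierstrass_division[OF m] .
  have "f - cubic m r * q \<in> wt 1 1 1 k" for k
  proof -
    obtain q' where q': "f - cubic m r * q' \<in> wt 1 1 1 k" using f by blast
    have "f - cubic m r * q - cubic m r * (q' - q) = f - cubic m r * q'" by (simp add: algebra_simps)
    with q' have "f - cubic m r * q - cubic m r * (q' - q) \<in> wt 1 1 1 k" by (simp only:)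
    then show ?thesis using m by (intro nf_order[OF q, of m r "q' - q" 1 k]) auto
  qed
  then have "f - cubic m r * q = 0" using wt_all_eq_0[of "f - cubic m r * q" 1] by blast
  then show ?thesis by simp
qed

lemma wt_decompose_center:
  fixes f :: "'a::comm_ring_1 ps3"
  assumes f: "f \<in> wt 1 e 1 (Suc d)" and e: "e \<le> 1"
  shows "\<exists>a\<in>wt 1 e 1 d. \<exists>b\<in>wt 1 e 1 d. \<exists>c\<in>wt 1 e 1 d.
    f = ps_X * a + (if e = 1 then ps_Y else ps_X * ps_Y) * b + ps_Z * c"
proof (cases "e = 0")
  case True
  then obtain a c where "f = ps_X * a + ps_Z * c" "a \<in> wt 1 0 1 d" "c \<in> wt 1 0 1 d"
    using wt_axis_decompose f by blast
  then show ?thesis using True by (intro bexI[of _ a] bexI[of _ 0] bexI[of _ c]) auto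
next
  case False
  then have e1: "e = 1" using e by simp
  obtain a b c where eq: "f = ps_const (ps_coeff f 0 0 0) + ps_X * a + ps_Y * b + ps_Z * c"
    and a: "\<And>i j l. ps_coeff a i j l = (if j = 0 \<and> l = 0 then ps_coeff f (Suc i) 0 0 else 0)"
    and b: "\<And>i j l. ps_coeff b i j l = (if l = 0 then ps_coeff f i (Suc j) 0 else 0)"
    and c: "\<And>i j l. ps_coeff c i j l = ps_coeff f i j (Suc l)"
    using ps_decompose[of f] by metis
  have f0: "ps_coeff f i j l = 0" if "i + j + l < Suc d" for i j l
    using that wtD[OF f, of i j l] e1 by simp
  have "a \<in> wt 1 1 1 d" "b \<in> wt 1 1 1 d" "c \<in> wt 1 1 1 d"
    by (auto intro!: wtI f0 simp: a b c)
  moreover have "f = ps_X * a + ps_Y * b + ps_Z * c" using eq by (simp add: f0 ps_const_def)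
  ultimately show ?thesis using e1 by auto
qed

lemma blow_mm: "blow e f \<in> mm \<longleftrightarrow> f \<in> mm"
  by (simp add: in_mm_iff ps_coeff_blow)

text \<open>For \<open>e = 0\<close> the series Y does not lie in the ideal of the curve, so X Y is
  taken as second element: its quotient by X is Y, as the chart format demands. The bound on
  \<open>m\<close> keeps the transformed exponent m - 2 at least three.\<close>

lemma chart_cubic:
  assumes m: "m \<ge> 5" and e: "e \<le> 1" and r: "r + 4 * e \<ge> 3"
  shows "chart (cubic m r :: 'a::field ps3) (cubic (m - 2) (r + 4 * e - 3)) (blow e) (wt 1 e 1) (jet e)
    (if e = 1 then ps_Y else ps_X * ps_Y) ps_Z"
proof
  let ?F = "cubic m r :: 'a ps3" and ?G = "cubic (m - 2) (r + 4 * e - 3) :: 'a ps3"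
  have m3: "m - 2 \<ge> 3" using m by simp
  show "rhom (blow e :: 'a ps3 \<Rightarrow> 'a ps3)" by (rule rhom_blow)
  show "?G dvd blow e ?F" using m r by (simp add: blow_cubic)
  show "blow e ps_X = (ps_X :: 'a ps3)" "blow e (ps_const c) = (ps_const c :: 'a ps3)" for c by (rule blow_gens)+
  show "blow e ps_Z = (ps_X * ps_Z :: 'a ps3)" by (rule blow_gens)
  have e01: "e = 0 \<or> e = 1" using e by linarith
  then show "blow e (if e = 1 then ps_Y else ps_X * ps_Y) = (ps_X * ps_Y :: 'a ps3)"
    by (auto simp: blow_gens rhom_mult[OF rhom_blow])
  show "blow e f \<in> mm \<longleftrightarrow> f \<in> mm" for f :: "'a ps3" by (rule blow_mm)
  show "wt 1 e 1 0 = (UNIV :: 'a ps3 set)" by (rule wt_0)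
  show "tideal (wt 1 e 1 d :: 'a ps3 set)" for d by (rule tideal_wt)
  show "f * g \<in> wt 1 e 1 (d + d')" if "f \<in> wt 1 e 1 d" "g \<in> wt 1 e 1 d'" for f g :: "'a ps3" and d d'
    using that by (rule wt_mult)
  have XY: "(ps_X :: 'a ps3) \<in> wt 1 e 1 1" "(ps_Z :: 'a ps3) \<in> wt 1 e 1 1" "(ps_Y :: 'a ps3) \<in> wt 1 e 1 e"
    using X_power_in_wt[where 'a = 'a, of 1 1 e 1] Z_power_in_wt[where 'a = 'a, of 1 1 e 1]
      Y_power_in_wt[where 'a = 'a, of 1 1 e 1] by simp_all
  then show "(ps_X :: 'a ps3) \<in> wt 1 e 1 1" "(ps_Z :: 'a ps3) \<in> wt 1 e 1 1" by auto
  show "(if e = 1 then ps_Y else ps_X * ps_Y :: 'a ps3) \<in> wt 1 e 1 1"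
    using XY e01 wt_mult_right[OF XY(1), of ps_Y] by auto
  show "\<exists>a\<in>wt 1 e 1 d. \<exists>b\<in>wt 1 e 1 d. \<exists>c\<in>wt 1 e 1 d.
      f = ps_X * a + (if e = 1 then ps_Y else ps_X * ps_Y) * b + ps_Z * c"
    if "f \<in> wt 1 e 1 (Suc d)" for f :: "'a ps3" and d
    using that e by (rule wt_decompose_center)
  show "\<exists>h. blow e f = ps_X ^ d * h" if "f \<in> wt 1 e 1 d" for f :: "'a ps3" and d
    using blow_divisible[OF that] by blast
  show "?F dvd f" if "?G dvd blow e f" for f
    using m by (intro blow_cubic_kernel[OF _ r that]) simp
  show "\<exists>f0\<in>jet e d k. ?F dvd f - f0"
    if "f \<in> wt 1 e 1 d" "?G dvd blow e f - ps_X ^ d * h" "h \<in> wt 1 1 1 k" for f h d k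
    using blow_cubic_jet[OF m r that] by blast
  show "jet e d k \<subseteq> (wt 1 e 1 d :: 'a ps3 set)" for d k by (auto simp: jet_def)
  show "\<exists>a\<in>jet e d k. \<exists>b\<in>jet e d k. \<exists>c\<in>jet e d k.
      ps_X * f = ps_X * ps_X * a + (if e = 1 then ps_Y else ps_X * ps_Y) * b + ps_Z * c"
    if "f \<in> jet e d (Suc k)" for f :: "'a ps3" and d k
    using jet_decompose[OF that e] by metis
  show "\<exists>d f h'. f \<in> wt 1 e 1 d \<and> blow e f = ps_X ^ d * h' \<and> h' - h \<in> wt 1 1 1 k" for h :: "'a ps3" and k
    using blow_dense[OF e, of h k] by metis
  show "?G dvd f" if "?G dvd ps_X ^ d * f" for f d
    using that m3 by (rule cubic_dvd_X_power_cancel)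
  show "?F \<in> mm" "?G \<in> mm" by (rule cubic_in_mm)+
  show "?G dvd f" if "\<And>k. \<exists>q. f - ?G * q \<in> wt 1 1 1 k" for f
    using m3 that by (rule cubic_separated)
qed

lemma reflect_wt_iff: "reflect f \<in> wt 1 1 1 k \<longleftrightarrow> f \<in> wt 1 1 1 k"
  using reflect_wt[of f k] reflect_wt[of "reflect f" k] by auto

lemma reflect_mm: "reflect f \<in> mm \<longleftrightarrow> f \<in> mm"
  unfolding mm_eq_wt by (rule reflect_wt_iff)

text \<open>The chart of \<open>cubic m 0\<close> is precomposed with the reflection. Only the
  source changes; the transform is already written in the coordinate W, so every later step uses
  \<open>cubic\<close> directly.\<close>

lemma chart_F_eq:
  assumes m: "m \<ge> 5"
  shows "chart (F_eq m :: 'a::field ps3) (cubic (m - 2) 1) (blow 1 \<circ> reflect) (wt 1 1 1)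
    (\<lambda>d k. {f. reflect f \<in> jet 1 d k}) (ps_X - ps_Y) ps_Z"
proof -
  interpret C: chart "cubic m 0 :: 'a ps3" "cubic (m - 2) 1" "blow 1" "wt 1 1 1" "jet 1" ps_Y ps_Z
    using chart_cubic[of m 1 0] m by simp
  note rr = rhom_simps[OF rhom_reflect] reflect_gens
  have dvd: "F_eq m dvd f \<longleftrightarrow> cubic m 0 dvd reflect f" for f :: "'a ps3"
    using rhom_dvd[OF rhom_reflect, of "F_eq m" f] rhom_dvd[OF rhom_reflect, of "cubic m 0" "reflect f"]
    by (auto simp: F_eq_reflect)
  have decomp: "\<exists>a\<in>S. \<exists>b\<in>S. \<exists>c\<in>S. g = u * a + (ps_X - ps_Y) * b + ps_Z * c"
    if ex: "\<exists>a\<in>S'. \<exists>b\<in>S'. \<exists>c\<in>S'. reflect g = reflect u * a + ps_Y * b + ps_Z * c"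
      and sub: "\<And>a. a \<in> S' \<Longrightarrow> reflect a \<in> S" for S S' and g u :: "'a ps3"
  proof -
    obtain a b c where abc: "a \<in> S'" "b \<in> S'" "c \<in> S'" "reflect g = reflect u * a + ps_Y * b + ps_Z * c"
      using ex by blast
    have "g = reflect (reflect u * a + ps_Y * b + ps_Z * c)" using abc(4) by (metis reflect_reflect)
    also have "\<dots> = u * reflect a + (ps_X - ps_Y) * reflect b + ps_Z * reflect c" by (simp add: rr)
    finally show ?thesis using sub abc(1-3) by blast
  qed
  show ?thesis
  proof
    show "rhom (blow 1 \<circ> reflect :: 'a ps3 \<Rightarrow> 'a ps3)" by (intro rhom_comp rhom_blow rhom_reflect)
    show "cubic (m - 2) 1 dvd (blow 1 \<circ> reflect) (F_eq m :: 'a ps3)" using C.\<Phi>_F by (simp add: F_eq_reflect)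
    show "(blow 1 \<circ> reflect) (ps_X :: 'a ps3) = ps_X" "(blow 1 \<circ> reflect) (ps_const c :: 'a ps3) = ps_const c"
      "(blow 1 \<circ> reflect) (ps_X - ps_Y :: 'a ps3) = ps_X * ps_Y" "(blow 1 \<circ> reflect) (ps_Z :: 'a ps3) = ps_X * ps_Z" for c
      by (simp_all add: rr blow_gens)
    show "(blow 1 \<circ> reflect) f \<in> mm \<longleftrightarrow> f \<in> mm" for f :: "'a ps3" by (simp add: blow_mm reflect_mm)
    show "wt 1 1 1 0 = (UNIV :: 'a ps3 set)" by (rule wt_0)
    show "tideal (wt 1 1 1 d :: 'a ps3 set)" for d by (rule tideal_wt)
    show "f * g \<in> wt 1 1 1 (d + d')" if "f \<in> wt 1 1 1 d" "g \<in> wt 1 1 1 d'" for f g :: "'a ps3" and d d'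
      using that by (rule wt_mult)
    show "(ps_X :: 'a ps3) \<in> wt 1 1 1 1" "(ps_X - ps_Y :: 'a ps3) \<in> wt 1 1 1 1" "(ps_Z :: 'a ps3) \<in> wt 1 1 1 1"
      using gens_in_mm wt_diff unfolding mm_eq_wt by blast+
    show "\<exists>a\<in>wt 1 1 1 d. \<exists>b\<in>wt 1 1 1 d. \<exists>c\<in>wt 1 1 1 d. f = ps_X * a + (ps_X - ps_Y) * b + ps_Z * c"
      if "f \<in> wt 1 1 1 (Suc d)" for f :: "'a ps3" and d
    proof (rule decomp[of "wt 1 1 1 d"])
      show "\<exists>a\<in>wt 1 1 1 d. \<exists>b\<in>wt 1 1 1 d. \<exists>c\<in>wt 1 1 1 d. reflect f = reflect ps_X * a + ps_Y * b + ps_Z * c"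
        using C.I_Suc[OF reflect_wt[OF that]] by (simp add: reflect_gens)
    qed (rule reflect_wt)
    show "\<exists>h. (blow 1 \<circ> reflect) f = ps_X ^ d * h" if "f \<in> wt 1 1 1 d" for f :: "'a ps3" and d
      using C.I_div[OF reflect_wt[OF that]] by simp
    show "F_eq m dvd f" if "cubic (m - 2) 1 dvd (blow 1 \<circ> reflect) f" for f :: "'a ps3"
      using C.kernel that by (simp add: dvd)
    show "\<exists>f0\<in>{f. reflect f \<in> jet 1 d k}. F_eq m dvd f - f0"
      if f: "f \<in> wt 1 1 1 d" "cubic (m - 2) 1 dvd (blow 1 \<circ> reflect) f - ps_X ^ d * h" "h \<in> wt 1 1 1 k"
      for f h :: "'a ps3" and d k
    proof -
      obtain f0 where "f0 \<in> jet 1 d k" "cubic m 0 dvd reflect f - f0"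
        using C.jet[OF reflect_wt[OF f(1)] _ f(3)] f(2) by auto
      then show ?thesis by (intro bexI[of _ "reflect f0"]) (simp_all add: dvd rr)
    qed
    show "{f. reflect f \<in> jet 1 d k} \<subseteq> (wt 1 1 1 d :: 'a ps3 set)" for d k
      using C.J_I reflect_wt_iff by blast
    show "\<exists>a\<in>{f. reflect f \<in> jet 1 d k}. \<exists>b\<in>{f. reflect f \<in> jet 1 d k}. \<exists>c\<in>{f. reflect f \<in> jet 1 d k}.
        ps_X * f = ps_X * ps_X * a + (ps_X - ps_Y) * b + ps_Z * c"
      if "f \<in> {f. reflect f \<in> jet 1 d (Suc k)}" for f :: "'a ps3" and d k
    proof (rule decomp[of "jet 1 d k"])
      show "\<exists>a\<in>jet 1 d k. \<exists>b\<in>jet 1 d k. \<exists>c\<in>jet 1 d k.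
          reflect (ps_X * f) = reflect (ps_X * ps_X) * a + ps_Y * b + ps_Z * c"
        using C.J_Suc[of "reflect f" d k] that by (simp add: rr)
    qed simp
    show "\<exists>d f h'. f \<in> wt 1 1 1 d \<and> (blow 1 \<circ> reflect) f = ps_X ^ d * h' \<and> h' - h \<in> wt 1 1 1 k"
      for h :: "'a ps3" and k
    proof -
      obtain d f h' where "f \<in> wt 1 1 1 d" "blow 1 f = ps_X ^ d * h'" "h' - h \<in> wt 1 1 1 k"
        using C.dense by blast
      then show ?thesis using reflect_wt by (intro exI[of _ d] exI[of _ "reflect f"] exI[of _ h']) simp
    qed
    show "cubic (m - 2) 1 dvd f" if "cubic (m - 2) 1 dvd ps_X ^ d * f" for f :: "'a ps3" and d
      by (rule C.X_cancel[OF that])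
    show "F_eq m \<in> (mm :: 'a ps3 set)" using C.F_mm by (simp add: F_eq_reflect reflect_mm)
    show "cubic (m - 2) 1 \<in> (mm :: 'a ps3 set)" by (rule C.G_mm)
    show "cubic (m - 2) 1 dvd f" if "\<And>k. \<exists>q. f - cubic (m - 2) 1 * q \<in> wt 1 1 1 k" for f :: "'a ps3"
      by (rule C.separated[OF that])
  qed
qed

section \<open>Orders and maximal centers\<close>

lemma ps_order_eq_3:
  fixes F :: "'a::comm_ring_1 ps3"
  assumes "F \<in> wt 1 1 1 3" "ps_coeff F 0 0 3 \<noteq> 0" shows "ps_order F = 3"
  unfolding ps_order_def
proof (rule Least_equality)
  show "\<exists>i j k. i + j + k = 3 \<and> ps_coeff F i j k \<noteq> 0" using assms(2) by (intro exI[of _ 0] exI[of _ 3]) simp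
  show "3 \<le> n" if "\<exists>i j k. i + j + k = n \<and> ps_coeff F i j k \<noteq> 0" for n
    using that wtD[OF assms(1)] by (metis mult_1 not_le)
qed

lemma cubic_order: assumes "m \<ge> 2" shows "ps_order (cubic m r :: 'a::field ps3) = 3"
proof (rule ps_order_eq_3)
  show "(cubic m r :: 'a ps3) \<in> wt 1 1 1 3" using cubic_in_wt[of m r 1] assms by simp
  show "ps_coeff (cubic m r :: 'a ps3) 0 0 3 \<noteq> 0"
    using ps_coeff_cubic_mult[of m r "1 :: 'a ps3" 0 0 3] assms by (simp add: ps_coeff_1)
qed

lemma F_eq_coeff:
  "ps_coeff (F_eq m :: 'a::field ps3) i j l =
    (if i = 0 \<and> j = 0 \<and> l = 3 then 1 else 0) + (if i = m \<and> j = 0 \<and> l = 1 then 1 else 0)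
    + (if l = 0 then ps_coeff ((ps_X - ps_Y) ^ 4 :: 'a ps3) i j 0 else 0)"
proof -
  have "ps_coeff ((ps_X - ps_Y) ^ 4 :: 'a ps3) i j l = 0" if "l \<noteq> 0"
    using that by (simp add: ps_coeff_def ps_X_def ps_Y_def fps_const_power)
  moreover have "ps_coeff (ps_Z ^ 3 * 1 :: 'a ps3) i j l = (if i = 0 \<and> j = 0 \<and> l = 3 then 1 else 0)"
    by (simp only: ps_coeff_Z_power_mult) (auto simp: ps_coeff_1)
  moreover have "ps_coeff (ps_X ^ m * (ps_Z * 1) :: 'a ps3) i j l = (if i = m \<and> j = 0 \<and> l = 1 then 1 else 0)"
    by (simp only: ps_coeff_X_power_mult ps_coeff_XYZ_mult) (auto simp: ps_coeff_1)
  ultimately show ?thesis by (simp add: F_eq_def)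
qed

lemma X_minus_Y_in_wt: "((ps_X - ps_Y) ^ 4 :: 'a::field ps3) \<in> wt 1 1 1 4"
  using wt_power[OF wt_diff[OF gens_in_mm(1,2)[unfolded mm_eq_wt]], where 'a = 'a, of 4] by simp

lemma F_eq_in_wt: assumes "m \<ge> 2" shows "(F_eq m :: 'a::field ps3) \<in> wt 1 1 1 3"
  unfolding F_eq_reflect reflect_wt_iff using cubic_in_wt[of m 0 1] assms by simp

lemma F_eq_order: assumes "m \<ge> 2" shows "ps_order (F_eq m :: 'a::field ps3) = 3"
  using F_eq_in_wt[OF assms] assms by (intro ps_order_eq_3) (simp_all add: F_eq_coeff)

lemma max_ideal_surface:
  fixes F :: "'a::field ps3"
  assumes "F \<in> mm" shows "max_ideal (surface_ring F) = cls F ` mm"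
proof -
  have "1 \<notin> quo.ker (surface_ring F) (cls F)"
    using tideal_dvd[OF tideal_mm assms, of 1] tprime_1[OF tprime_mm] by (auto simp: ker_surface)
  then show ?thesis using quo_local(2)[OF quo_surface] by blast
qed

lemma maximal_center_cubic:
  assumes m: "m \<ge> 3" and r: "r \<le> 2" and three: "(3 :: 'a::field) \<noteq> 0"
  shows "maximal_center (cubic m r :: 'a ps3) (cls (cubic m r) ` mm)"
proof -
  have "\<not> permitted_curve (cubic m r :: 'a ps3) C" for C
  proof (rule no_permitted_curve)
    show "(cubic m r :: 'a ps3) \<in> mm" by (rule cubic_in_mm)
    show "ps_order (cubic m r :: 'a ps3) = 3" using m by (intro cubic_order) simp
  qed (rule smooth_curve_square_relation[OF _ _ r m three])
  then show ?thesis by (simp add: maximal_center_def max_ideal_surface[OF cubic_in_mm])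
qed

text \<open>A prime containing \<open>F_eq m\<close> is reflected to a prime containing
  \<open>cubic m 0\<close>; the relation obtained there is reflected back.\<close>

lemma maximal_center_F_eq:
  assumes m: "m \<ge> 3" and three: "(3 :: 'a::field) \<noteq> 0"
  shows "maximal_center (F_eq m :: 'a ps3) (cls (F_eq m) ` mm)"
proof -
  let ?F = "F_eq m :: 'a ps3"
  have F_mm: "?F \<in> mm" using F_eq_in_wt[of m] m unfolding mm_eq_wt by (auto elim: wt_antimono[rotated])
  have "\<not> permitted_curve ?F C" for C
  proof (rule no_permitted_curve[OF F_mm])
    show "ps_order ?F = 3" using m by (intro F_eq_order) simp
    fix P p assume P: "tprime P" "?F \<in> P" and p: "p \<in> mm" "\<And>f. f \<in> mm \<Longrightarrow> \<exists>a. f - p * a \<in> P"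
      and nP: "\<not> mm \<subseteq> P"
    note rr = rhom_simps[OF rhom_reflect] reflect_gens
    define P' where "P' = {f. reflect f \<in> P}"
    have P'_iff: "reflect f \<in> P' \<longleftrightarrow> f \<in> P" "f \<in> P' \<longleftrightarrow> reflect f \<in> P" for f by (auto simp: P'_def)
    have dvd: "?F dvd f" if "cubic m 0 dvd reflect f" for f
      using rhom_dvd[OF rhom_reflect that] by (simp add: F_eq_reflect)
    have dvd': "cubic m 0 dvd reflect f" if "?F dvd f" for f
      using rhom_dvd[OF rhom_reflect that] by (simp add: F_eq_reflect)
    have t1: "tprime P'"
      using P(1) unfolding tprime_def tideal_def P'_def by (simp add: rr)
    have t2: "cubic m 0 \<in> P'" using P(2) by (simp add: P'_def F_eq_reflect)
    have t3: "reflect p \<in> mm" using p(1) by (simp add: reflect_mm)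
    have t4: "\<exists>a. f - reflect p * a \<in> P'" if f: "f \<in> mm" for f
    proof -
      obtain a where "reflect f - p * a \<in> P" using p(2)[of "reflect f"] f by (auto simp: reflect_mm)
      then have "f - reflect p * reflect a \<in> P'" by (simp add: P'_def rr)
      then show ?thesis by blast
    qed
    have t5: "\<not> mm \<subseteq> P'"
    proof
      assume *: "mm \<subseteq> P'"
      have "mm \<subseteq> P"
      proof
        fix f :: "'a ps3" assume "f \<in> mm"
        then have "reflect f \<in> P'" using * reflect_mm by blast
        then show "f \<in> P" by (simp add: P'_iff)
      qed
      then show False using nP by blast
    qed
    have "\<exists>u v w q s b. u \<in> P' \<and> v \<in> P' \<and> w \<in> P' \<and> s \<notin> P' \<and> b \<in> P' \<and>
        (\<forall>p\<in>P'. \<exists>a c. p = u * a + v * c) \<and> s * u\<^sup>2 = v * w + cubic m 0 * q \<and>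
        (\<forall>k f. cubic m 0 dvd b ^ k * f \<longrightarrow> cubic m 0 dvd f)"
      by (rule smooth_curve_square_relation[OF t1 t2 _ m three t3 t4 t5]) simp_all
    then obtain u v w q s b where uv: "u \<in> P'" "v \<in> P'" "w \<in> P'" "s \<notin> P'" "b \<in> P'"
      "\<forall>p\<in>P'. \<exists>a c. p = u * a + v * c" "s * u\<^sup>2 = v * w + cubic m 0 * q"
      "\<forall>k f. cubic m 0 dvd b ^ k * f \<longrightarrow> cubic m 0 dvd f"
      by blast
    have g1: "\<exists>a c. g = reflect u * a + reflect v * c" if g: "g \<in> P" for g
    proof -
      have "reflect g \<in> P'" using g by (simp add: P'_def)
      then obtain a c where "reflect g = u * a + v * c" using uv(6) by blast
      then have "g = reflect u * reflect a + reflect v * reflect c" by (metis reflect_reflect rhom_add[OF rhom_reflect] rhom_mult[OF rhom_reflect])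
      then show ?thesis by blast
    qed
    have g2: "reflect s * (reflect u)\<^sup>2 = reflect v * reflect w + ?F * reflect q"
      using arg_cong[OF uv(7), of reflect] by (simp add: rr F_eq_reflect)
    have g3: "?F dvd f" if "?F dvd reflect b ^ k * f" for k f
    proof (rule dvd)
      have "cubic m 0 dvd b ^ k * reflect f" using dvd'[OF that] by (simp add: rr)
      then show "cubic m 0 dvd reflect f" using uv(8) by blast
    qed
    have g4: "reflect u \<in> P" "reflect v \<in> P" "reflect w \<in> P" "reflect s \<notin> P" "reflect b \<in> P"
      using uv by (simp_all add: P'_def)
    have g1': "\<forall>p\<in>P. \<exists>a c. p = reflect u * a + reflect v * c" using g1 by blast
    have g3': "\<forall>k f. ?F dvd reflect b ^ k * f \<longrightarrow> ?F dvd f" using g3 by blast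
    show "\<exists>u v w q s b. u \<in> P \<and> v \<in> P \<and> w \<in> P \<and> s \<notin> P \<and> b \<in> P \<and>
        (\<forall>p\<in>P. \<exists>a c. p = u * a + v * c) \<and> s * u\<^sup>2 = v * w + ?F * q \<and>
        (\<forall>k f. ?F dvd b ^ k * f \<longrightarrow> ?F dvd f)"
      by (intro exI[of _ "reflect u"] exI[of _ "reflect v"] exI[of _ "reflect w"] exI[of _ "reflect q"]
          exI[of _ "reflect s"] exI[of _ "reflect b"] conjI g1' g2 g3' g4)
  qed
  then show ?thesis by (simp add: maximal_center_def max_ideal_surface[OF F_mm])
qed

lemma step_quadratic:
  assumes m: "m \<ge> 5" and r: "r \<le> 2" and three: "(3 :: 'a::field) \<noteq> 0"
  shows "levi_zariski_step (cubic m r :: 'a ps3) (cubic (m - 2) (r + 1))"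
proof -
  interpret chart "cubic m r :: 'a ps3" "cubic (m - 2) (r + 1)" "blow 1" "wt 1 1 1" "jet 1" ps_Y ps_Z
    using chart_cubic[of m 1 r] m by simp
  have "center = cls (cubic m r) ` mm" unfolding center_def mm_eq_wt ..
  then have "maximal_center (cubic m r :: 'a ps3) center"
    using maximal_center_cubic[OF _ r three, of m] m by simp
  then show ?thesis by (rule levi_zariski_step)
qed

lemma step_monoidal:
  assumes m: "m \<ge> 5"
  shows "levi_zariski_step (cubic m 3 :: 'a::field ps3) (cubic (m - 2) 0)"
proof -
  interpret chart "cubic m 3 :: 'a ps3" "cubic (m - 2) 0" "blow 0" "wt 1 0 1" "jet 0" "ps_X * ps_Y" ps_Z
    using chart_cubic[of m 0 3] m by simp
  have "permitted_curve (cubic m 3 :: 'a ps3) center"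
    unfolding center_def using m by (intro permitted_axis cubic_order) simp_all
  then have "maximal_center (cubic m 3 :: 'a ps3) center" by (auto simp: maximal_center_def)
  then show ?thesis by (rule levi_zariski_step)
qed

lemma step_F_eq:
  assumes m: "m \<ge> 5" and three: "(3 :: 'a::field) \<noteq> 0"
  shows "levi_zariski_step (F_eq m :: 'a ps3) (cubic (m - 2) 1)"
proof -
  interpret chart "F_eq m :: 'a ps3" "cubic (m - 2) 1" "blow 1 \<circ> reflect" "wt 1 1 1"
    "\<lambda>d k. {f. reflect f \<in> jet 1 d k}" "ps_X - ps_Y" ps_Z
    by (rule chart_F_eq[OF m])
  have "center = cls (F_eq m) ` mm" unfolding center_def mm_eq_wt ..
  then have "maximal_center (F_eq m :: 'a ps3) center"
    using maximal_center_F_eq[OF _ three, of m] m by simp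
  then show ?thesis by (rule levi_zariski_step)
qed

lemma algebroid_surfaceI: "ps_order F = 3 \<Longrightarrow> F \<noteq> 0 \<Longrightarrow> algebroid_surface F"
  by (simp add: algebroid_surface_def)

lemma long_sequence:
  fixes N :: nat
  assumes three: "(3 :: 'a::field) \<noteq> 0"
  shows "\<exists>S :: nat \<Rightarrow> 'a ps3. S 0 = F_eq (2 * N + 19) \<and> levi_zariski_sequence S N \<and> (\<forall>i\<le>N. ps_order (S i) = 3)"
proof -
  \<comment> \<open>The exponent of X in the linear term drops by two per step from 2 N + 19, so it
    is still at least 19 at step N. The exponent \<open>r\<close> is \<open>i mod 4\<close>, with
    the initial equation as the reflected case r = 0.\<close>
  define S :: "nat \<Rightarrow> 'a ps3"
    where "S i = (if i = 0 then F_eq (2 * N + 19) else cubic (2 * N + 19 - 2 * i) (i mod 4))" for i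
  have ord: "ps_order (S i) = 3 \<and> S i \<noteq> 0" if "i \<le> N" for i
  proof (cases "i = 0")
    case True
    have "ps_coeff (F_eq (2 * N + 19) :: 'a ps3) 0 0 3 \<noteq> ps_coeff 0 0 0 3" by (simp add: F_eq_coeff)
    then have "(F_eq (2 * N + 19) :: 'a ps3) \<noteq> 0" by metis
    then show ?thesis using True F_eq_order[of "2 * N + 19"] by (simp add: S_def)
  next
    case False
    let ?m = "2 * N + 19 - 2 * i"
    have m: "?m \<ge> 19" using that by simp
    have "ps_coeff (cubic ?m (i mod 4) * 1 :: 'a ps3) 0 0 3 \<noteq> ps_coeff 0 0 0 3"
      using m by (subst ps_coeff_cubic_mult) (simp add: ps_coeff_1)
    then have "(cubic ?m (i mod 4) :: 'a ps3) \<noteq> 0" by (metis mult_1_right)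
    then show ?thesis using False cubic_order[of ?m "i mod 4"] m by (simp add: S_def)
  qed
  have step: "levi_zariski_step (S i) (S (Suc i))" if "i < N" for i
  proof (cases "i = 0")
    case True
    then show ?thesis using step_F_eq[of "2 * N + 19"] three by (simp add: S_def)
  next
    case False
    let ?m = "2 * N + 19 - 2 * i"
    have m: "?m \<ge> 5" "2 * N + 19 - 2 * Suc i = ?m - 2" using that by auto
    show ?thesis
    proof (cases "i mod 4 = 3")
      case True
      then have "Suc i mod 4 = 0" by presburger
      then show ?thesis using step_monoidal[OF m(1)] False True m(2) by (simp add: S_def)
    next
      case 3: False
      then have "i mod 4 \<le> 2" "Suc i mod 4 = i mod 4 + 1" by presburger+
      then show ?thesis using step_quadratic[OF m(1) _ three, of "i mod 4"] False m(2) by (simp add: S_def)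
    qed
  qed
  show ?thesis
    using ord step by (intro exI[of _ S]) (auto simp: levi_zariski_sequence_def algebroid_surfaceI, simp add: S_def)
qed

section \<open>The characteristic polygon\<close>

abbreviation "corner_hull \<equiv> convex hull (quadrant_at (4/3, 0) \<union> quadrant_at (0, 4/3))"

lemma mem_quadrant: "x = fst p + real a \<Longrightarrow> y = snd p + real b \<Longrightarrow> (x, y) \<in> quadrant_at p"
  by (force simp: quadrant_at_def prod_eq_iff)

text \<open>\<open>quadrant_at\<close> consists of lattice translates only, so the points between
  them have to be recovered from convexity.\<close>

lemma convex_between:
  fixes S :: "(real \<times> real) set"
  assumes "convex S" "(x1, y) \<in> S" "(x2, y) \<in> S" "x1 \<le> x" "x \<le> x2" shows "(x, y) \<in> S"
proof (cases "x1 = x2")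
  case False
  define t where "t = (x - x1) / (x2 - x1)"
  have t: "0 \<le> t" "t \<le> 1" using assms False by (auto simp: t_def)
  have "x = (1 - t) * x1 + t * x2"
  proof -
    have "t * (x2 - x1) = x - x1" using False by (simp add: t_def)
    then show ?thesis by (simp add: algebra_simps)
  qed
  then have "(x, y) = (1 - t) *\<^sub>R (x1, y) + t *\<^sub>R (x2, y)" by (simp add: algebra_simps)
  then show ?thesis using convexD[OF assms(1-3), of "1 - t" t] t by simp
qed (use assms in auto)

lemma convex_between':
  fixes S :: "(real \<times> real) set"
  assumes "convex S" "(x, y1) \<in> S" "(x, y2) \<in> S" "y1 \<le> y" "y \<le> y2" shows "(x, y) \<in> S"
proof -
  have "convex (prod.swap ` S)"
    by (intro convex_linear_image assms(1)) (simp add: linear_iff prod.swap_def)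
  then have "(y, x) \<in> prod.swap ` S"
    by (rule convex_between[of _ y1 x y2]) (use assms(2-5) in force)+
  then show ?thesis by force
qed

text \<open>The point lies on the segment from (x + y, 0) to (0, x + y), whose end points lie
  between lattice translates of the corners.\<close>

lemma corner_hull_mem:
  assumes "x \<ge> 0" "y \<ge> 0" "x + y \<ge> 4/3" shows "(x, y) \<in> corner_hull"
proof -
  define s where "s = x + y"
  obtain n :: nat where n: "s \<le> real n" using real_arch_simple by blast
  have cv: "convex corner_hull" by (rule convex_convex_hull)
  have in1: "(4/3 + real k, 0) \<in> corner_hull" and in2: "(0, 4/3 + real k) \<in> corner_hull" for k
    by (intro hull_inc UnI1 mem_quadrant[of _ _ k _ 0], simp_all)
      (intro hull_inc UnI2 mem_quadrant[of _ _ 0 _ k], simp_all)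
  have s1: "(s, 0) \<in> corner_hull"
    by (rule convex_between[OF cv, of "4/3" 0 "4/3 + real n"])
      (use in1[of 0] in1[of n] assms n in \<open>simp_all add: s_def\<close>)
  have s2: "(0, s) \<in> corner_hull"
    by (rule convex_between'[OF cv, of 0 "4/3" "4/3 + real n"])
      (use in2[of 0] in2[of n] assms n in \<open>simp_all add: s_def\<close>)
  have "s > 0" using assms by (simp add: s_def)
  then have "(x, y) = (x / s) *\<^sub>R (s, 0) + (y / s) *\<^sub>R (0, s)" by simp
  moreover have "x / s + y / s = 1" using \<open>s > 0\<close> by (simp add: s_def flip: add_divide_distrib)
  ultimately show ?thesis using convexD[OF cv s1 s2, of "x / s" "y / s"] assms \<open>s > 0\<close> by simp
qed

lemma quadrant_subset_polygon:
  assumes "ps_order H = 3" "ps_coeff H i j 0 \<noteq> 0"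
  shows "quadrant_at (real i / 3, real j / 3) \<subseteq> hironaka_polygon H"
  unfolding hironaka_polygon_def
proof (intro subset_trans[OF _ hull_subset] Sup_upper CollectI exI conjI)
  show "quadrant_at (real i / 3, real j / 3) =
      quadrant_at (real i / real (ps_order H - 0), real j / real (ps_order H - 0))"
    by (simp add: assms(1))
qed (use assms in simp_all)

lemma convex_polygon: "convex (hironaka_polygon H)"
  by (simp add: hironaka_polygon_def)

text \<open>A monomial X^4 gives the corner itself. A monomial X^3 gives the point (1, 0), and each
  point (4/3 + a, b) lies between its translates (1 + a, b) and (2 + a, b); likewise for Y.\<close>

lemma corner_hull_subset_polygon:
  assumes H: "ps_order H = 3"
    and X: "ps_coeff H 4 0 0 \<noteq> 0 \<or> ps_coeff H 3 0 0 \<noteq> 0"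
    and Y: "ps_coeff H 0 4 0 \<noteq> 0 \<or> ps_coeff H 0 3 0 \<noteq> 0"
  shows "corner_hull \<subseteq> hironaka_polygon H"
proof (rule hull_minimal)
  have "quadrant_at (4/3, 0) \<subseteq> hironaka_polygon H"
  proof (cases "ps_coeff H 4 0 0 = 0")
    case False then show ?thesis using quadrant_subset_polygon[OF H False] by simp
  next
    case True
    then have q: "quadrant_at (1, 0) \<subseteq> hironaka_polygon H" using X quadrant_subset_polygon[OF H, of 3 0] by simp
    show ?thesis
    proof
      fix p assume "p \<in> quadrant_at (4/3, 0)"
      then obtain a b where p: "p = (4/3 + real a, real b)" by (auto simp: quadrant_at_def)
      have "(1 + real a, real b) \<in> quadrant_at (1, 0)" by (rule mem_quadrant[of _ _ a _ b]) simp_all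
      moreover have "(2 + real a, real b) \<in> quadrant_at (1, 0)" by (rule mem_quadrant[of _ _ "Suc a" _ b]) simp_all
      ultimately have "(1 + real a, real b) \<in> hironaka_polygon H" "(2 + real a, real b) \<in> hironaka_polygon H"
        using q by blast+
      then show "p \<in> hironaka_polygon H" unfolding p
        using convex_between[OF convex_polygon, of "1 + real a" "real b" H "2 + real a" "4/3 + real a"] by simp
    qed
  qed
  moreover have "quadrant_at (0, 4/3) \<subseteq> hironaka_polygon H"
  proof (cases "ps_coeff H 0 4 0 = 0")
    case False then show ?thesis using quadrant_subset_polygon[OF H False] by simp
  next
    case True
    then have q: "quadrant_at (0, 1) \<subseteq> hironaka_polygon H" using Y quadrant_subset_polygon[OF H, of 0 3] by simp
    show ?thesis
    proof
      fix p assume "p \<in> quadrant_at (0, 4/3)"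
      then obtain a b where p: "p = (real a, 4/3 + real b)" by (auto simp: quadrant_at_def)
      have "(real a, 1 + real b) \<in> quadrant_at (0, 1)" by (rule mem_quadrant[of _ _ a _ b]) simp_all
      moreover have "(real a, 2 + real b) \<in> quadrant_at (0, 1)" by (rule mem_quadrant[of _ _ a _ "Suc b"]) simp_all
      ultimately have "(real a, 1 + real b) \<in> hironaka_polygon H" "(real a, 2 + real b) \<in> hironaka_polygon H"
        using q by blast+
      then show "p \<in> hironaka_polygon H" unfolding p
        using convex_between'[OF convex_polygon, of "real a" "1 + real b" H "2 + real b" "4/3 + real b"] by simp
    qed
  qed
  ultimately show "quadrant_at (4/3, 0) \<union> quadrant_at (0, 4/3) \<subseteq> hironaka_polygon H" by blast
qed (rule convex_polygon)

lemma F_eq_polygon_subset: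
  assumes m: "m \<ge> 3" shows "hironaka_polygon (F_eq m :: 'a::field ps3) \<subseteq> corner_hull"
proof -
  have ord: "ps_order (F_eq m :: 'a ps3) = 3" using m by (intro F_eq_order) simp
  show ?thesis unfolding hironaka_polygon_def ord
  proof (rule hull_minimal)
    show "\<Union> {quadrant_at (real i / real (3 - k), real j / real (3 - k)) |i j k.
        k < 3 \<and> ps_coeff (F_eq m :: 'a ps3) i j k \<noteq> 0} \<subseteq> corner_hull"
    proof
      fix p assume "p \<in> \<Union> {quadrant_at (real i / real (3 - k), real j / real (3 - k)) |i j k.
        k < 3 \<and> ps_coeff (F_eq m :: 'a ps3) i j k \<noteq> 0}"
      then obtain i j k where k: "k < 3" "ps_coeff (F_eq m :: 'a ps3) i j k \<noteq> 0"
        and p: "p \<in> quadrant_at (real i / real (3 - k), real j / real (3 - k))" by blast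
      then obtain a b where ab: "p = (real i / real (3 - k) + real a, real j / real (3 - k) + real b)"
        by (auto simp: quadrant_at_def)
      consider "k = 0" "i + j \<ge> 4" | "k = 1" "i = m" "j = 0"
        using k wtD[OF X_minus_Y_in_wt[where 'a = 'a], of i j 0]
        by (fastforce simp: F_eq_coeff split: if_splits)
      then have "real i / real (3 - k) + real j / real (3 - k) \<ge> 4/3"
      proof cases
        case 1
        then have "real i + real j \<ge> 4" by linarith
        then show ?thesis using 1 by simp
      next
        case 2 then show ?thesis using m by simp
      qed
      moreover define u v where "u = real i / real (3 - k)" and "v = real j / real (3 - k)"
      ultimately have "u + v \<ge> 4/3" "u \<ge> 0" "v \<ge> 0" by simp_all
      then have "(u + real a, v + real b) \<in> corner_hull" by (intro corner_hull_mem) simp_all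
      then show "p \<in> corner_hull" by (simp only: ab u_def v_def)
    qed
  qed (rule convex_convex_hull)
qed

lemma shift_Z_F_eq:
  assumes m: "m \<ge> 2"
  shows "shift_Z \<alpha> (F_eq m :: 'a::field ps3) =
    (ps_X - ps_Y) ^ 4 + ps_X ^ m * (ps_Z + fps_const \<alpha>) + (ps_Z + fps_const \<alpha>) ^ 3"
proof -
  have Xm: "ps_X ^ m = fps_const (fps_const (fps_X ^ m) :: 'a fps fps)"
    by (simp add: ps_X_def fps_const_power)
  have XY: "(ps_X - ps_Y) ^ 4 = fps_const ((fps_const fps_X - fps_X) ^ 4 :: 'a fps fps)"
    by (simp add: ps_X_def ps_Y_def fps_const_power)
  have F: "F_eq m = fps_X ^ 3 + fps_const (fps_const (fps_X ^ m)) * fps_X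
      + fps_const ((fps_const fps_X - fps_X) ^ 4 :: 'a fps fps)"
    unfolding F_eq_def Xm XY by (simp add: ps_Z_def)
  have nth: "fps_const (fps_nth (F_eq m :: 'a ps3) 0) = (ps_X - ps_Y) ^ 4" "fps_const (fps_nth (F_eq m :: 'a ps3) 1) = ps_X ^ m"
    "fps_nth (F_eq m :: 'a ps3) 2 = 0" "fps_nth (F_eq m :: 'a ps3) 3 = 1"
    unfolding F Xm XY by (simp_all add: fps_X_power_nth)
  have "{..3::nat} = {0, 1, 2, 3}" by auto
  then have "shift_Z \<alpha> (F_eq m :: 'a ps3) = (\<Sum>k\<in>{0, 1, 2, 3}. fps_const (fps_nth (F_eq m) k) * (ps_Z + fps_const \<alpha>) ^ k)"
    using F_eq_order[OF m, where 'a = 'a] by (simp add: shift_Z_def)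
  also have "\<dots> = fps_const (fps_nth (F_eq m) 0) + fps_const (fps_nth (F_eq m) 1) * (ps_Z + fps_const \<alpha>)
      + fps_const (fps_nth (F_eq m) 2) * (ps_Z + fps_const \<alpha>) ^ 2
      + fps_const (fps_nth (F_eq m) 3) * (ps_Z + fps_const \<alpha>) ^ 3"
    by (simp add: add.assoc)
  finally show ?thesis by (simp only: nth) simp
qed

lemma F_eq_nth: "k > 3 \<Longrightarrow> fps_nth (F_eq m :: 'a::field ps3) k = 0" "m \<ge> 2 \<Longrightarrow> fps_nth (F_eq m :: 'a ps3) 3 = 1"
  by (auto simp: fps_eq_iff F_eq_coeff[unfolded ps_coeff_def])

text \<open>If \<open>b\<close> has order one, its cube contributes in degree three, where nothing
  else does. If the order is higher, the middle term has order at least m + 2 and the cube at least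
  six, so the fourth power survives. The factor \<open>c\<close> is 1 on the X-axis and 0 on the
  Y-axis.\<close>

lemma cubic_expression_coeff:
  fixes b :: "'a::field fps"
  assumes b: "fps_nth b 0 = 0" and m: "m \<ge> 3"
  shows "fps_nth (fps_X ^ 4 + fps_X ^ m * b * c + b ^ 3) 4 \<noteq> 0 \<or> fps_nth (fps_X ^ 4 + fps_X ^ m * b * c + b ^ 3) 3 \<noteq> 0"
proof -
  define b1 where "b1 = fps_shift 1 b"
  have b1: "b = fps_X * b1" using b by (intro fps_ext) (auto simp: b1_def)
  have e: "fps_X ^ 4 + fps_X ^ m * b * c + b ^ 3 = fps_X ^ 4 * 1 + fps_X ^ (m + 1) * (b1 * c) + fps_X ^ 3 * b1 ^ 3"
    by (simp add: b1 power_mult_distrib algebra_simps)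
  show ?thesis
  proof (cases "fps_nth b1 0 = 0")
    case False
    then have "fps_nth (fps_X ^ 4 + fps_X ^ m * b * c + b ^ 3) 3 \<noteq> 0"
      unfolding e using m by (simp add: fps_X_power_mult_nth del: power_Suc)
    then show ?thesis ..
  next
    case True
    define b2 where "b2 = fps_shift 1 b1"
    have b2: "b1 = fps_X * b2" using True by (intro fps_ext) (auto simp: b2_def)
    have "fps_X ^ (m + 1) * (b1 * c) = fps_X ^ (m + 2) * (b2 * c)" "fps_X ^ 3 * b1 ^ 3 = fps_X ^ 6 * b2 ^ 3"
      by (simp_all add: b2 power_mult_distrib power_add[symmetric] mult.assoc[symmetric] power_Suc2[symmetric] del: power_Suc)
    then have e2: "fps_X ^ 4 + fps_X ^ m * b * c + b ^ 3 = fps_X ^ 4 * 1 + fps_X ^ (m + 2) * (b2 * c) + fps_X ^ 6 * b2 ^ 3"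
      unfolding e by (simp only:)
    have "fps_nth (fps_X ^ 4 + fps_X ^ m * b * c + b ^ 3) 4 = 1"
      unfolding e2 using m by (simp add: fps_X_power_mult_nth del: power_Suc)
    then have "fps_nth (fps_X ^ 4 + fps_X ^ m * b * c + b ^ 3) 4 \<noteq> 0" by (simp only: one_neq_zero not_False_eq_True)
    then show ?thesis by (rule disjI1)
  qed
qed

text \<open>Restricting the shifted equation to each of the two axes gives the expression of
  \<open>cubic_expression_coeff\<close>, so a shift by a nonunit leaves a point at distance 1 or 4/3
  on both axes.\<close>

lemma corner_hull_subset_shift:
  fixes \<alpha> :: "'a::field fps fps"
  assumes m: "m \<ge> 3" and \<alpha>: "\<not> \<alpha> dvd 1"
  shows "corner_hull \<subseteq> hironaka_polygon (shift_Z \<alpha> (F_eq m))"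
proof -
  let ?a = "fps_const \<alpha> :: 'a ps3"
  define H where "H = (ps_X - ps_Y) ^ 4 + ps_X ^ m * (ps_Z + ?a) + (ps_Z + ?a) ^ 3"
  have sH: "shift_Z \<alpha> (F_eq m) = H" using shift_Z_F_eq[of m \<alpha>] m by (simp add: H_def)
  have \<alpha>0: "fps_nth (fps_nth \<alpha> 0) 0 = 0"
  proof (rule ccontr)
    assume "fps_nth (fps_nth \<alpha> 0) 0 \<noteq> 0"
    then have "fps_nth (fps_nth \<alpha> 0) 0 * inverse (fps_nth (fps_nth \<alpha> 0) 0) = 1" by simp
    then obtain c where "fps_nth \<alpha> 0 * c = 1" using fps_right_inverse by metis
    then obtain g where "\<alpha> * g = 1" using fps_right_inverse by metis
    then show False using \<alpha> by (metis dvd_triv_left)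
  qed
  have "?a \<in> mm" using \<alpha>0 by (simp add: in_mm_iff ps_coeff_def)
  then have a: "?a \<in> wt 1 1 1 1" unfolding mm_eq_wt .
  have Za: "ps_Z + ?a \<in> wt 1 1 1 1" using gens_in_mm(3)[unfolded mm_eq_wt] a by (rule wt_add)
  have "H \<in> wt 1 1 1 3"
    unfolding H_def
  proof (intro wt_add)
    show "(ps_X - ps_Y) ^ 4 \<in> (wt 1 1 1 3 :: 'a ps3 set)" using wt_antimono[of 3 4, OF _ X_minus_Y_in_wt] by simp
    have "ps_X ^ m * (ps_Z + ?a) \<in> wt 1 1 1 (m * 1 + 1)" by (intro wt_mult X_power_in_wt Za)
    then show "ps_X ^ m * (ps_Z + ?a) \<in> wt 1 1 1 3" using m by (auto elim: wt_antimono[rotated])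
    show "(ps_Z + ?a) ^ 3 \<in> wt 1 1 1 3" using wt_power[OF Za, of 3] by simp
  qed
  moreover have "ps_coeff H 0 0 3 \<noteq> 0"
  proof -
    have "ps_coeff ((ps_X - ps_Y) ^ 4 :: 'a ps3) 0 0 3 = 0"
      by (simp add: ps_coeff_def ps_X_def ps_Y_def fps_const_power)
    moreover have "ps_coeff (ps_X ^ m * (ps_Z + ?a)) 0 0 3 = 0" using m by simp
    moreover have "(ps_Z + ?a) ^ 3 = ps_Z ^ 3 * 1 + ps_Z ^ 2 * (?a + ?a + ?a) + ps_Z ^ 1 * (?a * ?a + ?a * ?a + ?a * ?a) + ps_Z ^ 0 * (?a * ?a * ?a)"
      by (simp add: power3_eq_cube power2_eq_square algebra_simps del: fps_const_add fps_const_mult)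
    then have "ps_coeff ((ps_Z + ?a) ^ 3) 0 0 3 = 1"
      by (simp only: ps_coeff_simps ps_coeff_Z_power_mult) (simp add: ps_coeff_def)
    ultimately show ?thesis by (simp add: H_def)
  qed
  ultimately have ord: "ps_order H = 3" by (rule ps_order_eq_3)
  have "ps_coeff H 4 0 0 \<noteq> 0 \<or> ps_coeff H 3 0 0 \<noteq> 0"
  proof -
    define ev :: "'a ps3 \<Rightarrow> 'a fps" where "ev = (\<lambda>b. fps_nth b 0) \<circ> (\<lambda>f. fps_nth f 0)"
    have ev: "rhom ev" unfolding ev_def by (intro rhom_comp rhomI) simp_all
    have "ev ps_X = fps_X" "ev ps_Y = 0" "ev ps_Z = 0" "ev ?a = fps_nth \<alpha> 0"
      by (simp_all add: ev_def ps_X_def ps_Y_def ps_Z_def)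
    then have "ev H = fps_X ^ 4 + fps_X ^ m * fps_nth \<alpha> 0 * 1 + fps_nth \<alpha> 0 ^ 3"
      by (simp add: H_def rhom_simps[OF ev])
    moreover have "ps_coeff H i 0 0 = fps_nth (ev H) i" for i by (simp add: ev_def ps_coeff_def)
    ultimately show ?thesis using cubic_expression_coeff[OF \<alpha>0 m, of 1] by simp
  qed
  moreover have "ps_coeff H 0 4 0 \<noteq> 0 \<or> ps_coeff H 0 3 0 \<noteq> 0"
  proof -
    have gens: "axis_part (ps_X :: 'a ps3) = 0" "axis_part (ps_Y :: 'a ps3) = fps_X" "axis_part (ps_Z :: 'a ps3) = 0"
      by (simp_all add: fps_eq_iff axis_part_nth ps_coeff_def ps_X_def ps_Y_def ps_Z_def fps_X_def)
    have c0: "fps_nth (axis_part ?a) 0 = 0" using \<alpha>0 by (simp add: axis_part_nth ps_coeff_def)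
    have "axis_part H = fps_X ^ 4 + fps_X ^ m * axis_part ?a * 0 + axis_part ?a ^ 3"
      using m by (simp add: H_def rhom_simps[OF rhom_axis_part] gens power_0_left)
    then show ?thesis using cubic_expression_coeff[OF c0 m, of 0] by (simp flip: axis_part_nth)
  qed
  ultimately show ?thesis unfolding sH by (rule corner_hull_subset_polygon[OF ord])
qed

lemma F_eq_polygons:
  assumes m: "m \<ge> 3"
  shows "hironaka_polygon (F_eq m :: 'a::field ps3) = corner_hull"
    and "characteristic_polygon (F_eq m :: 'a ps3) = corner_hull"
proof -
  have s0: "shift_Z 0 (F_eq m :: 'a ps3) = F_eq m"
    using shift_Z_F_eq[of m 0] m by (simp add: F_eq_def algebra_simps)
  have n0: "\<not> (0 :: 'a fps fps) dvd 1" by simp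
  show eq: "hironaka_polygon (F_eq m :: 'a ps3) = corner_hull"
    using F_eq_polygon_subset[OF m] corner_hull_subset_shift[OF m n0] unfolding s0 by blast
  show "characteristic_polygon (F_eq m :: 'a ps3) = corner_hull"
    unfolding characteristic_polygon_def
  proof (rule Least_equality)
    show "\<exists>\<alpha> :: 'a fps fps. \<not> \<alpha> dvd 1 \<and> corner_hull = hironaka_polygon (shift_Z \<alpha> (F_eq m))"
      using n0 s0 eq by (intro exI[of _ 0]) simp
    show "corner_hull \<subseteq> D" if "\<exists>\<alpha> :: 'a fps fps. \<not> \<alpha> dvd 1 \<and> D = hironaka_polygon (shift_Z \<alpha> (F_eq m))" for D
      using that corner_hull_subset_shift[OF m] by auto
  qed
qed

theorem mainTheorem1:
  assumes "CHAR('a::alg_closed_field) \<noteq> 3"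
  shows "(\<forall>m\<ge>19. algebroid_surface (F_eq m :: 'a ps3) \<and> ps_order (F_eq m :: 'a ps3) = 3
            \<and> weierstrass_form (F_eq m :: 'a ps3))
    \<and> (\<forall>m\<ge>19. characteristic_polygon (F_eq m :: 'a ps3) = hironaka_polygon (F_eq m :: 'a ps3)
            \<and> hironaka_polygon (F_eq m :: 'a ps3)
                = convex hull (quadrant_at (4/3, 0) \<union> quadrant_at (0, 4/3)))
    \<and> (\<forall>N. \<exists>m\<ge>19. \<exists>S :: nat \<Rightarrow> 'a ps3. S 0 = F_eq m \<and> levi_zariski_sequence S N
            \<and> (\<forall>i\<le>N. ps_order (S i) = 3))
    \<and> \<not> (\<exists>\<beta> :: (real \<times> real) set \<Rightarrow> nat. \<forall>(S :: nat \<Rightarrow> 'a ps3) N.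
            weierstrass_form (S 0) \<and> levi_zariski_sequence S N
              \<and> (\<forall>i\<le>N. ps_order (S i) = ps_order (S 0))
            \<longrightarrow> N \<le> \<beta> (characteristic_polygon (S 0)))
    \<and> \<not> (\<exists>\<beta> :: (real \<times> real) set \<Rightarrow> nat. \<forall>m\<ge>19. \<forall>(S :: nat \<Rightarrow> 'a ps3) N.
            S 0 = F_eq m \<and> levi_zariski_sequence S N
              \<and> (\<forall>i\<le>N. ps_order (S i) = ps_order (S 0))
            \<longrightarrow> N \<le> \<beta> (characteristic_polygon (S 0)))"
proof -
  have three: "(3 :: 'a) \<noteq> 0"
  proof
    assume "(3 :: 'a) = 0"
    then have "CHAR('a) dvd 3" using of_nat_eq_0_iff_char_dvd[where 'a = 'a, of 3] by simp
    then have "CHAR('a) = 1 \<or> CHAR('a) = 3" using prime_nat_iff[of 3] by auto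
    then show False using assms CHAR_not_1' by auto
  qed
  have ord: "ps_order (F_eq m :: 'a ps3) = 3" if "m \<ge> 19" for m using that by (intro F_eq_order) simp
  have ne: "(F_eq m :: 'a ps3) \<noteq> 0" if "m \<ge> 19" for m
    using F_eq_nth(2)[of m, where 'a = 'a] that by auto
  have wf: "weierstrass_form (F_eq m :: 'a ps3)" if "m \<ge> 19" for m
    using that ord[OF that] F_eq_nth(1)[of _ m, where 'a = 'a] F_eq_nth(2)[of m, where 'a = 'a] by (simp add: weierstrass_form_def)
  have seq: "\<exists>m\<ge>19. \<exists>S :: nat \<Rightarrow> 'a ps3. S 0 = F_eq m \<and> levi_zariski_sequence S N
            \<and> (\<forall>i\<le>N. ps_order (S i) = 3)" for N
    using long_sequence[OF three, of N] by (intro exI[of _ "2 * N + 19"]) simp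
  have unbounded: False
    if \<beta>: "\<And>m N S. m \<ge> 19 \<Longrightarrow> S 0 = (F_eq m :: 'a ps3) \<Longrightarrow> levi_zariski_sequence S N \<Longrightarrow>
      \<forall>i\<le>N. ps_order (S i) = ps_order (S 0) \<Longrightarrow> N \<le> \<beta> (characteristic_polygon (S 0))"
    for \<beta> :: "(real \<times> real) set \<Rightarrow> nat"
  proof -
    \<comment> \<open>One more than the alleged bound on the polygon shared by the whole
      family.\<close>
    define N where "N = Suc (\<beta> corner_hull)"
    obtain m S where S: "m \<ge> 19" "S 0 = (F_eq m :: 'a ps3)" "levi_zariski_sequence S N" "\<forall>i\<le>N. ps_order (S i) = 3"
      using seq[of N] by blast
    have "N \<le> \<beta> (characteristic_polygon (S 0))" using S ord[OF S(1)] by (intro \<beta>) simp_all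
    also have "characteristic_polygon (S 0) = corner_hull" using F_eq_polygons(2)[of m] S by simp
    finally show False by (simp add: N_def)
  qed
  show ?thesis
  proof (intro conjI allI impI)
    fix m :: nat assume m: "m \<ge> 19"
    show "algebroid_surface (F_eq m :: 'a ps3)" using ord[OF m] ne[OF m] by (simp add: algebroid_surface_def)
    show "ps_order (F_eq m :: 'a ps3) = 3" "weierstrass_form (F_eq m :: 'a ps3)" using ord[OF m] wf[OF m] by auto
    show "characteristic_polygon (F_eq m :: 'a ps3) = hironaka_polygon (F_eq m :: 'a ps3)"
      "hironaka_polygon (F_eq m :: 'a ps3) = corner_hull"
      using F_eq_polygons[of m, where 'a = 'a] m by simp_all
  next
    show "\<exists>m\<ge>19. \<exists>S :: nat \<Rightarrow> 'a ps3. S 0 = F_eq m \<and> levi_zariski_sequence S N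
            \<and> (\<forall>i\<le>N. ps_order (S i) = 3)" for N by (rule seq)
  next
    show "\<not> (\<exists>\<beta> :: (real \<times> real) set \<Rightarrow> nat. \<forall>(S :: nat \<Rightarrow> 'a ps3) N.
            weierstrass_form (S 0) \<and> levi_zariski_sequence S N
              \<and> (\<forall>i\<le>N. ps_order (S i) = ps_order (S 0))
            \<longrightarrow> N \<le> \<beta> (characteristic_polygon (S 0)))"
    proof (rule notI, elim exE)
      fix \<beta> :: "(real \<times> real) set \<Rightarrow> nat"
      assume \<beta>: "\<forall>(S :: nat \<Rightarrow> 'a ps3) N. weierstrass_form (S 0) \<and> levi_zariski_sequence S N
        \<and> (\<forall>i\<le>N. ps_order (S i) = ps_order (S 0)) \<longrightarrow> N \<le> \<beta> (characteristic_polygon (S 0))"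
      show False
      proof (rule unbounded[of \<beta>])
        fix m N :: nat and S :: "nat \<Rightarrow> 'a ps3"
        assume "m \<ge> 19" "S 0 = F_eq m" "levi_zariski_sequence S N" "\<forall>i\<le>N. ps_order (S i) = ps_order (S 0)"
        then show "N \<le> \<beta> (characteristic_polygon (S 0))"
          using \<beta>[rule_format, of S N] wf[of m] by simp
      qed
    qed
  next
    show "\<not> (\<exists>\<beta> :: (real \<times> real) set \<Rightarrow> nat. \<forall>m\<ge>19. \<forall>(S :: nat \<Rightarrow> 'a ps3) N.
            S 0 = F_eq m \<and> levi_zariski_sequence S N
              \<and> (\<forall>i\<le>N. ps_order (S i) = ps_order (S 0))
            \<longrightarrow> N \<le> \<beta> (characteristic_polygon (S 0)))"
    proof (rule notI, elim exE)
      fix \<beta> :: "(real \<times> real) set \<Rightarrow> nat"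
      assume \<beta>: "\<forall>m\<ge>19. \<forall>(S :: nat \<Rightarrow> 'a ps3) N. S 0 = F_eq m \<and> levi_zariski_sequence S N
        \<and> (\<forall>i\<le>N. ps_order (S i) = ps_order (S 0)) \<longrightarrow> N \<le> \<beta> (characteristic_polygon (S 0))"
      show False
      proof (rule unbounded[of \<beta>])
        fix m N :: nat and S :: "nat \<Rightarrow> 'a ps3"
        assume "m \<ge> 19" "S 0 = F_eq m" "levi_zariski_sequence S N" "\<forall>i\<le>N. ps_order (S i) = ps_order (S 0)"
        then show "N \<le> \<beta> (characteristic_polygon (S 0))"
          using \<beta>[rule_format, of m S N] by simp
      qed
    qed
  qed
qed

end
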